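(* Let $(M,g)$ be a non-flat connected $3$-dimensional Lorentzian strict Walker manifold and let $f\in C^\infty(M)$. Then $(M,g,f)$ is a gradient Ricci soliton if and only if there exists a cover of $M$ by coordinate systems $(t,x,y)$ in which the metric has the form $$g=2\,dt\,dy+dx^2+\phi(x,y)\,dy^2$$ and where one of the following occurs: (1) $\phi(x,y)=\frac{1}{\alpha^2}\,a(y)\,e^{\alpha x}+x\,b(y)+c(y)$ and $f(x,y)=x\,\alpha+\gamma(y)$, where $0\neq\alpha\in\mathbb{R}$ and $\gamma''(y)=-\frac12\,\alpha\,b(y)$. In this setting, $\nabla f=\alpha\,\partial_x+\gamma'(y)\,\partial_t$ is spacelike. (2) $\phi(x,y)=x^2\,a(y)+x\,b(y)+c(y)$ and $f(x,y)=\gamma(y)$, where $\gamma''(y)=a(y)$. In this setting, $\nabla f=\gamma'\,\partial_t$ is null. Here $a,b,c,\gamma$ are smooth functions of $y$. Moreover, in both cases the Ricci soliton is steady.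
   Context: A Lorentzian manifold is strict Walker if it admits a parallel null vector field. $(M,g,f)$ is a gradient Ricci soliton if $\operatorname{Hess}_f+\rho=\lambda g$ for some $\lambda\in\mathbb{R}$, where $\rho$ is the Ricci tensor and $\operatorname{Hess}_f(X,Y)=XY(f)-(\nabla_XY)(f)$; it is steady if $\lambda=0$. $\nabla f$ is the gradient of $f$. No local homogeneity is assumed. Here "$\nabla f$ is null" means $g(\nabla f,\nabla f)=0$. *)

theory Defs
  imports "HOL-Analysis.Analysis"
begin

section \<open>Smooth maps between normed spaces\<close>

text \<open>Only meaningful for open \<open>S\<close>: all iterated directional derivatives up to order \<open>n\<close>
  exist as Frechet derivatives and are continuous.\<close>

primrec k_smooth_on :: "nat \<Rightarrow> 'e::real_normed_vector set \<Rightarrow> ('e \<Rightarrow> 'b::real_normed_vector) \<Rightarrow> bool"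
  where
    "k_smooth_on 0 S f \<longleftrightarrow> continuous_on S f"
  | "k_smooth_on (Suc n) S f \<longleftrightarrow>
       (\<forall>x\<in>S. f differentiable (at x)) \<and>
       (\<forall>v. k_smooth_on n S (\<lambda>x. frechet_derivative f (at x) v))"

definition smooth_on :: "'e::real_normed_vector set \<Rightarrow> ('e \<Rightarrow> 'b::real_normed_vector) \<Rightarrow> bool"
  where "smooth_on S f \<longleftrightarrow> (\<forall>n. k_smooth_on n S f)"


section \<open>Smooth manifolds\<close>

text \<open>The manifold is the whole type \<open>'a\<close>; its dimension is \<open>CARD('n)\<close>.
  A chart is a domain together with its coordinate map.\<close>

type_synonym ('a, 'n) chart = "'a set \<times> ('a \<Rightarrow> real ^ 'n)"

abbreviation chart_dom :: "('a, 'n) chart \<Rightarrow> 'a set"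
  where "chart_dom \<equiv> fst"

abbreviation chart_map :: "('a, 'n) chart \<Rightarrow> 'a \<Rightarrow> real ^ 'n"
  where "chart_map \<equiv> snd"

definition chart_inv :: "('a, 'n) chart \<Rightarrow> real ^ 'n \<Rightarrow> 'a"
  where "chart_inv \<kappa> = inv_into (chart_dom \<kappa>) (chart_map \<kappa>)"

definition is_chart :: "('a::topological_space, 'n::finite) chart \<Rightarrow> bool"
  where "is_chart \<kappa> \<longleftrightarrow>
    open (chart_dom \<kappa>) \<and> open (chart_map \<kappa> ` chart_dom \<kappa>) \<and>
    homeomorphism (chart_dom \<kappa>) (chart_map \<kappa> ` chart_dom \<kappa>) (chart_map \<kappa>) (chart_inv \<kappa>)"

definition smoothly_compatible :: "('a, 'n::finite) chart \<Rightarrow> ('a, 'n) chart \<Rightarrow> bool"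
  where "smoothly_compatible \<kappa> \<mu> \<longleftrightarrow>
    smooth_on (chart_map \<kappa> ` (chart_dom \<kappa> \<inter> chart_dom \<mu>)) (chart_map \<mu> \<circ> chart_inv \<kappa>) \<and>
    smooth_on (chart_map \<mu> ` (chart_dom \<kappa> \<inter> chart_dom \<mu>)) (chart_map \<kappa> \<circ> chart_inv \<mu>)"

definition smooth_atlas :: "('a::topological_space, 'n::finite) chart set \<Rightarrow> bool"
  where "smooth_atlas A \<longleftrightarrow>
    (\<forall>\<kappa>\<in>A. is_chart \<kappa>) \<and> (\<Union>\<kappa>\<in>A. chart_dom \<kappa>) = UNIV \<and>
    (\<forall>\<kappa>\<in>A. \<forall>\<mu>\<in>A. smoothly_compatible \<kappa> \<mu>)"

text \<open>The maximal atlas determined by \<open>A\<close>.\<close>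

definition coordinate_systems ::
    "('a::topological_space, 'n::finite) chart set \<Rightarrow> ('a, 'n) chart set"
  where "coordinate_systems A = {\<kappa>. is_chart \<kappa> \<and> (\<forall>\<mu>\<in>A. smoothly_compatible \<kappa> \<mu>)}"

definition smooth_fun_on ::
    "('a::topological_space, 'n::finite) chart set \<Rightarrow> 'a set \<Rightarrow> ('a \<Rightarrow> real) \<Rightarrow> bool"
  where "smooth_fun_on A U f \<longleftrightarrow>
    (\<forall>\<kappa>\<in>coordinate_systems A. smooth_on (chart_map \<kappa> ` (chart_dom \<kappa> \<inter> U)) (f \<circ> chart_inv \<kappa>))"

definition smooth_fun_at ::
    "('a::topological_space, 'n::finite) chart set \<Rightarrow> 'a \<Rightarrow> ('a \<Rightarrow> real) \<Rightarrow> bool"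
  where "smooth_fun_at A p f \<longleftrightarrow> (\<exists>U. open U \<and> p \<in> U \<and> smooth_fun_on A U f)"


section \<open>Tangent vectors and vector fields\<close>

text \<open>A tangent vector at \<open>p\<close> is a directional derivative acting on the functions that are smooth
  near \<open>p\<close>. It is given the value \<open>0\<close> on all other functions, so that equality of tangent vectors
  is equality of functionals; linear combinations are taken pointwise.\<close>

type_synonym 'a tangent = "('a \<Rightarrow> real) \<Rightarrow> real"

type_synonym 'a vfield = "'a \<Rightarrow> 'a tangent"

definition coord_tangent ::
    "('a::topological_space, 'n::finite) chart set \<Rightarrow> ('a, 'n) chart \<Rightarrow> 'a \<Rightarrow> real ^ 'n \<Rightarrow> 'a tangent"
  where "coord_tangent A \<kappa> p v =
    (\<lambda>h. if smooth_fun_at A p h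
         then frechet_derivative (h \<circ> chart_inv \<kappa>) (at (chart_map \<kappa> p)) v else 0)"

definition tangent_space ::
    "('a::topological_space, 'n::finite) chart set \<Rightarrow> 'a \<Rightarrow> 'a tangent set"
  where "tangent_space A p =
    {coord_tangent A \<kappa> p v | \<kappa> v. \<kappa> \<in> coordinate_systems A \<and> p \<in> chart_dom \<kappa>}"

text \<open>The coordinate vector field of the \<open>i\<close>-th coordinate, relevant only on the chart domain.\<close>

definition coord_field ::
    "('a::topological_space, 'n::finite) chart set \<Rightarrow> ('a, 'n) chart \<Rightarrow> 'n \<Rightarrow> 'a vfield"
  where "coord_field A \<kappa> i = (\<lambda>p. coord_tangent A \<kappa> p (axis i 1))"

definition smooth_vfield_on ::
    "('a::topological_space, 'n::finite) chart set \<Rightarrow> 'a set \<Rightarrow> 'a vfield \<Rightarrow> bool"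
  where "smooth_vfield_on A U X \<longleftrightarrow>
    (\<forall>p\<in>U. X p \<in> tangent_space A p) \<and>
    (\<forall>W h. open W \<longrightarrow> W \<subseteq> U \<longrightarrow> smooth_fun_on A W h \<longrightarrow> smooth_fun_on A W (\<lambda>p. X p h))"

definition smooth_vfield_at ::
    "('a::topological_space, 'n::finite) chart set \<Rightarrow> 'a \<Rightarrow> 'a vfield \<Rightarrow> bool"
  where "smooth_vfield_at A p X \<longleftrightarrow> (\<exists>U. open U \<and> p \<in> U \<and> smooth_vfield_on A U X)"

definition lie_bracket ::
    "('a::topological_space, 'n::finite) chart set \<Rightarrow> 'a vfield \<Rightarrow> 'a vfield \<Rightarrow> 'a vfield"
  where "lie_bracket A X Y p =
    (\<lambda>h. if smooth_fun_at A p h then X p (\<lambda>q. Y q h) - Y p (\<lambda>q. X q h) else 0)"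


section \<open>Lorentzian metrics\<close>

type_synonym 'a metric_field = "'a \<Rightarrow> 'a tangent \<Rightarrow> 'a tangent \<Rightarrow> real"

text \<open>Signature \<open>(-,+,\<dots>,+)\<close>, expressed by an orthonormal frame of \<open>CARD('n)\<close> vectors; this also
  gives nondegeneracy.\<close>

definition lorentzian_metric ::
    "('a::topological_space, 'n::finite) chart set \<Rightarrow> 'a metric_field \<Rightarrow> bool"
  where "lorentzian_metric A g \<longleftrightarrow>
    (\<forall>p. \<forall>D\<in>tangent_space A p. \<forall>E\<in>tangent_space A p. g p D E = g p E D) \<and>
    (\<forall>p. \<forall>D\<in>tangent_space A p. \<forall>E\<in>tangent_space A p. \<forall>F\<in>tangent_space A p. \<forall>r s.
        g p (\<lambda>h. r * D h + s * E h) F = r * g p D F + s * g p E F) \<and>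
    (\<forall>p. \<exists>(e :: 'n \<Rightarrow> 'a tangent) i0. (\<forall>i. e i \<in> tangent_space A p) \<and>
        (\<forall>i j. g p (e i) (e j) = (if i \<noteq> j then 0 else if i = i0 then -1 else 1))) \<and>
    (\<forall>W X Y. open W \<longrightarrow> smooth_vfield_on A W X \<longrightarrow> smooth_vfield_on A W Y \<longrightarrow>
        smooth_fun_on A W (\<lambda>p. g p (X p) (Y p)))"

definition lorentzian_manifold ::
    "('a::{second_countable_topology,t2_space}, 'n::finite) chart set \<Rightarrow> 'a metric_field \<Rightarrow> bool"
  where "lorentzian_manifold A g \<longleftrightarrow> smooth_atlas A \<and> lorentzian_metric A g"

text \<open>The Levi-Civita connection, determined by the Koszul formula.\<close>

definition koszul ::
    "('a::topological_space, 'n::finite) chart set \<Rightarrow> 'a metric_field \<Rightarrow>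
     'a vfield \<Rightarrow> 'a vfield \<Rightarrow> 'a vfield \<Rightarrow> 'a \<Rightarrow> real"
  where "koszul A g X Y Z p =
    X p (\<lambda>q. g q (Y q) (Z q)) + Y p (\<lambda>q. g q (X q) (Z q)) - Z p (\<lambda>q. g q (X q) (Y q))
    + g p (lie_bracket A X Y p) (Z p) - g p (lie_bracket A X Z p) (Y p)
    - g p (lie_bracket A Y Z p) (X p)"

definition levi_civita ::
    "('a::topological_space, 'n::finite) chart set \<Rightarrow> 'a metric_field \<Rightarrow> 'a vfield \<Rightarrow> 'a vfield \<Rightarrow> 'a vfield"
  where "levi_civita A g X Y p =
    (THE D. D \<in> tangent_space A p \<and>
       (\<forall>Z. smooth_vfield_at A p Z \<longrightarrow> 2 * g p D (Z p) = koszul A g X Y Z p))"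

definition curvature ::
    "('a::topological_space, 'n::finite) chart set \<Rightarrow> 'a metric_field \<Rightarrow>
     'a vfield \<Rightarrow> 'a vfield \<Rightarrow> 'a vfield \<Rightarrow> 'a vfield"
  where "curvature A g X Y Z p =
    (\<lambda>h. levi_civita A g X (levi_civita A g Y Z) p h - levi_civita A g Y (levi_civita A g X Z) p h
         - levi_civita A g (lie_bracket A X Y) Z p h)"

definition flat ::
    "('a::topological_space, 'n::finite) chart set \<Rightarrow> 'a metric_field \<Rightarrow> bool"
  where "flat A g \<longleftrightarrow>
    (\<forall>p X Y Z. smooth_vfield_at A p X \<longrightarrow> smooth_vfield_at A p Y \<longrightarrow> smooth_vfield_at A p Z \<longrightarrow>
       curvature A g X Y Z p = (\<lambda>h. 0))"

text \<open>\<open>ricci A g X Y p\<close> is the trace of \<open>Z \<mapsto> R(Z, X) Y\<close> at \<open>p\<close> (positive on round spheres),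
  computed in a coordinate basis; a trace does not depend on the chosen chart.\<close>

definition ricci ::
    "('a::topological_space, 'n::finite) chart set \<Rightarrow> 'a metric_field \<Rightarrow> 'a vfield \<Rightarrow> 'a vfield \<Rightarrow> 'a \<Rightarrow> real"
  where "ricci A g X Y p =
    (let \<kappa> = (SOME \<kappa>. \<kappa> \<in> coordinate_systems A \<and> p \<in> chart_dom \<kappa>)
     in \<Sum>k\<in>UNIV. curvature A g (coord_field A \<kappa> k) X Y p (\<lambda>q. chart_map \<kappa> q $ k))"

definition gradient ::
    "('a::topological_space, 'n::finite) chart set \<Rightarrow> 'a metric_field \<Rightarrow> ('a \<Rightarrow> real) \<Rightarrow> 'a vfield"
  where "gradient A g f p =
    (THE D. D \<in> tangent_space A p \<and> (\<forall>E\<in>tangent_space A p. g p D E = E f))"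

definition hessian ::
    "('a::topological_space, 'n::finite) chart set \<Rightarrow> 'a metric_field \<Rightarrow> ('a \<Rightarrow> real) \<Rightarrow>
     'a vfield \<Rightarrow> 'a vfield \<Rightarrow> 'a \<Rightarrow> real"
  where "hessian A g f X Y p = X p (\<lambda>q. Y q f) - levi_civita A g X Y p f"


section \<open>Strict Walker manifolds and gradient Ricci solitons\<close>

text \<open>A null vector is by convention nonzero.\<close>

definition strict_walker ::
    "('a::topological_space, 'n::finite) chart set \<Rightarrow> 'a metric_field \<Rightarrow> bool"
  where "strict_walker A g \<longleftrightarrow>
    (\<exists>V. smooth_vfield_on A UNIV V \<and>
         (\<forall>p. V p \<noteq> (\<lambda>h. 0) \<and> g p (V p) (V p) = 0) \<and>
         (\<forall>p X. smooth_vfield_at A p X \<longrightarrow> levi_civita A g X V p = (\<lambda>h. 0)))"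

definition ricci_soliton_const ::
    "('a::topological_space, 'n::finite) chart set \<Rightarrow> 'a metric_field \<Rightarrow> ('a \<Rightarrow> real) \<Rightarrow> real \<Rightarrow> bool"
  where "ricci_soliton_const A g f l \<longleftrightarrow>
    (\<forall>p X Y. smooth_vfield_at A p X \<longrightarrow> smooth_vfield_at A p Y \<longrightarrow>
       hessian A g f X Y p + ricci A g X Y p = l * g p (X p) (Y p))"

definition gradient_ricci_soliton ::
    "('a::topological_space, 'n::finite) chart set \<Rightarrow> 'a metric_field \<Rightarrow> ('a \<Rightarrow> real) \<Rightarrow> bool"
  where "gradient_ricci_soliton A g f \<longleftrightarrow> (\<exists>l. ricci_soliton_const A g f l)"


section \<open>Walker coordinates\<close>

text \<open>The coordinates \<open>(t, x, y)\<close> are the components \<open>1, 2, 3\<close> of a chart into \<open>real ^ 3\<close>.\<close>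

abbreviation ct :: "('a, 3) chart \<Rightarrow> 'a \<Rightarrow> real" where "ct \<kappa> p \<equiv> chart_map \<kappa> p $ 1"
abbreviation cx :: "('a, 3) chart \<Rightarrow> 'a \<Rightarrow> real" where "cx \<kappa> p \<equiv> chart_map \<kappa> p $ 2"
abbreviation cy :: "('a, 3) chart \<Rightarrow> 'a \<Rightarrow> real" where "cy \<kappa> p \<equiv> chart_map \<kappa> p $ 3"

text \<open>\<open>g = 2 dt dy + dx\<^sup>2 + \<phi>(x,y) dy\<^sup>2\<close> on the chart domain, where \<open>dt(D) = D t\<close> etc. and
  \<open>2 dt dy\<close> is the symmetric product \<open>dt \<otimes> dy + dy \<otimes> dt\<close>.\<close>

definition walker_form ::
    "('a::topological_space, 3) chart set \<Rightarrow> 'a metric_field \<Rightarrow> ('a, 3) chart \<Rightarrow>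
     (real \<Rightarrow> real \<Rightarrow> real) \<Rightarrow> bool"
  where "walker_form A g \<kappa> \<phi> \<longleftrightarrow>
    (\<forall>p\<in>chart_dom \<kappa>. \<forall>D\<in>tangent_space A p. \<forall>E\<in>tangent_space A p.
       g p D E = D (ct \<kappa>) * E (cy \<kappa>) + D (cy \<kappa>) * E (ct \<kappa>) + D (cx \<kappa>) * E (cx \<kappa>)
                 + \<phi> (cx \<kappa> p) (cy \<kappa> p) * D (cy \<kappa>) * E (cy \<kappa>))"

definition exponential_form ::
    "('a::topological_space, 3) chart set \<Rightarrow> 'a metric_field \<Rightarrow> ('a \<Rightarrow> real) \<Rightarrow> ('a, 3) chart \<Rightarrow>
     real \<Rightarrow> (real \<Rightarrow> real) \<Rightarrow> (real \<Rightarrow> real) \<Rightarrow> (real \<Rightarrow> real) \<Rightarrow> (real \<Rightarrow> real) \<Rightarrow> bool"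
  where "exponential_form A g f \<kappa> \<alpha> a b c \<gamma> \<longleftrightarrow>
    \<alpha> \<noteq> 0 \<and>
    smooth_on (cy \<kappa> ` chart_dom \<kappa>) a \<and> smooth_on (cy \<kappa> ` chart_dom \<kappa>) b \<and>
    smooth_on (cy \<kappa> ` chart_dom \<kappa>) c \<and> smooth_on (cy \<kappa> ` chart_dom \<kappa>) \<gamma> \<and>
    walker_form A g \<kappa> (\<lambda>x y. 1 / \<alpha>\<^sup>2 * a y * exp (\<alpha> * x) + x * b y + c y) \<and>
    (\<forall>p\<in>chart_dom \<kappa>. f p = cx \<kappa> p * \<alpha> + \<gamma> (cy \<kappa> p)) \<and>
    (\<forall>y\<in>cy \<kappa> ` chart_dom \<kappa>. deriv (deriv \<gamma>) y = - (1 / 2) * \<alpha> * b y)"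

definition quadratic_form ::
    "('a::topological_space, 3) chart set \<Rightarrow> 'a metric_field \<Rightarrow> ('a \<Rightarrow> real) \<Rightarrow> ('a, 3) chart \<Rightarrow>
     (real \<Rightarrow> real) \<Rightarrow> (real \<Rightarrow> real) \<Rightarrow> (real \<Rightarrow> real) \<Rightarrow> (real \<Rightarrow> real) \<Rightarrow> bool"
  where "quadratic_form A g f \<kappa> a b c \<gamma> \<longleftrightarrow>
    smooth_on (cy \<kappa> ` chart_dom \<kappa>) a \<and> smooth_on (cy \<kappa> ` chart_dom \<kappa>) b \<and>
    smooth_on (cy \<kappa> ` chart_dom \<kappa>) c \<and> smooth_on (cy \<kappa> ` chart_dom \<kappa>) \<gamma> \<and>
    walker_form A g \<kappa> (\<lambda>x y. x\<^sup>2 * a y + x * b y + c y) \<and>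
    (\<forall>p\<in>chart_dom \<kappa>. f p = \<gamma> (cy \<kappa> p)) \<and>
    (\<forall>y\<in>cy \<kappa> ` chart_dom \<kappa>. deriv (deriv \<gamma>) y = a y)"

definition coordinate_cover ::
    "('a::topological_space, 'n::finite) chart set \<Rightarrow> ('a, 'n) chart set \<Rightarrow> bool"
  where "coordinate_cover A C \<longleftrightarrow> C \<subseteq> coordinate_systems A \<and> (\<Union>\<kappa>\<in>C. chart_dom \<kappa>) = UNIV"

end

theory Submission
  imports Defs
begin

text \<open>In Walker coordinates the soliton equation says that \<open>f\<close> has Hessian
  \<open>\<lambda> g + (\<phi>\<^sub>x\<^sub>x / 2) dy\<^sup>2\<close>. Cross differentiation gives \<open>\<phi>\<^sub>x\<^sub>x f\<^sub>t = 0\<close> and \<open>\<lambda> \<phi>\<^sub>x\<^sub>x = 0\<close>; since \<open>M\<close> is not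
  flat, \<open>\<phi>\<^sub>x\<^sub>x\<close> is nonzero somewhere, so \<open>\<lambda> = 0\<close>. Now \<open>f\<^sub>t = V f\<close> and \<open>f\<^sub>x\<^sup>2 = g(\<nabla>f, \<nabla>f)\<close> are locally
  constant, hence constant, the first one zero, and the last component of the equation is a linear
  ordinary differential equation for \<open>\<phi>\<close> in \<open>x\<close> with explicit solutions. The sign of
  \<open>\<alpha> = f\<^sub>x\<close> is normalised by \<open>x \<mapsto> -x\<close>.

  Walker coordinates are obtained from the parallel null field \<open>V\<close> without solving differential
  equations: \<open>V\<close> is Killing and its dual form is closed, and \<open>y\<close>, \<open>x\<close>, \<open>t\<close> are successive potentials of
  (leafwise) closed one-forms.\<close>

section \<open>Smooth functions\<close>

text \<open>The usual construction of Walker coordinates straightens \<open>V\<close> along its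
  flow. Here integration along segments with smooth parameters suffices, because the metric has rank
  one on each leaf y = const, with kernel spanned by \<open>V\<close>: it is the square of a
  one-form there, and the Killing equation is what makes this form and the remaining mixed
  coefficients leafwise closed. Integration along segments, and later the displacement of points
  along coordinate directions, is why the constructed charts have balls as images. Tangent vectors
  are functionals and the connection is a definite description, so all geometry is moved to
  component functions by \<open>represents\<close>; from then on only Frechet derivatives of maps on
  open sets occur. Values in different charts can be compared only through chart-independent
  quantities: \<open>V f\<close>, and g(grad f, grad f). The latter fixes f_x in each chart only up
  to sign, so one \<alpha> for the whole cover has to be its nonnegative root. The coefficient
  functions of y arise by restricting functions that are constant on leaves to a transversal
  line.\<close>

abbreviation fd :: "('e::real_normed_vector \<Rightarrow> 'b::real_normed_vector) \<Rightarrow> 'e \<Rightarrow> 'e \<Rightarrow> 'b"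
  where "fd f x \<equiv> frechet_derivative f (at x)"

lemma fd_eq: "(f has_derivative f') (at x) \<Longrightarrow> fd f x = f'"
  by (rule frechet_derivative_at[symmetric])

lemma fd_cong:
  assumes "open S" "x \<in> S" "\<And>y. y \<in> S \<Longrightarrow> f y = g y"
  shows "fd f x = fd g x"
proof (cases "f differentiable (at x)")
  case True
  then show ?thesis
    using assms by (intro frechet_derivative_transform_within_open) auto
next
  case False
  have "\<not> g differentiable (at x)"
    using False assms by (metis differentiable_def has_derivative_transform_within_open)
  \<comment> \<open>Neither function has a derivative here, so both sides are the same choice from
    an unsatisfiable predicate.\<close>
  with False show ?thesis
    unfolding frechet_derivative_def differentiable_def by meson
qed

lemma linear_fd: "f differentiable (at x) \<Longrightarrow> linear (fd f x)"
  by (rule linear_frechet_derivative)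

lemma has_derivative_fd: "f differentiable (at x) \<Longrightarrow> (f has_derivative fd f x) (at x)"
  by (simp add: frechet_derivative_works)

section \<open>Smoothness of finite order: locality, products and composition\<close>

lemma k_smooth_on_Suc_D: "k_smooth_on (Suc n) S f \<Longrightarrow> k_smooth_on n S f"
proof (induction n arbitrary: f)
  case 0
  then show ?case
    by (auto intro!: continuous_at_imp_continuous_on differentiable_imp_continuous_within)
next
  case (Suc n)
  have 1: "\<And>v. k_smooth_on (Suc n) S (\<lambda>x. fd f x v)"
    and 2: "\<forall>x\<in>S. f differentiable (at x)"
    using Suc.prems by (subst (asm) k_smooth_on.simps(2), blast)+
  have "\<And>v. k_smooth_on n S (\<lambda>x. fd f x v)"
    using 1 Suc.IH by blast
  with 2 show ?case by simp
qed

lemma k_smooth_on_subset: "k_smooth_on n S f \<Longrightarrow> T \<subseteq> S \<Longrightarrow> k_smooth_on n T f"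
  by (induction n arbitrary: f) (auto intro: continuous_on_subset)

lemma k_smooth_on_cong:
  assumes "open S" "\<And>x. x \<in> S \<Longrightarrow> f x = g x" "k_smooth_on n S f"
  shows "k_smooth_on n S g"
  using assms(2,3)
proof (induction n arbitrary: f g)
  case 0
  then show ?case by (simp cong: continuous_on_cong)
next
  case (Suc n)
  have "g differentiable (at x)" if "x \<in> S" for x
    using Suc.prems assms(1) that
    by (metis differentiable_def has_derivative_transform_within_open k_smooth_on.simps(2))
  moreover have "k_smooth_on n S (\<lambda>x. fd g x v)" for v
  proof (rule Suc.IH)
    show "k_smooth_on n S (\<lambda>x. fd f x v)" using Suc.prems by simp
    show "fd f x v = fd g x v" if "x \<in> S" for x
      using fd_cong[OF assms(1) that Suc.prems(1)] by simp
  qed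
  ultimately show ?case by simp
qed

text \<open>Every clause of the definition is pointwise, which lets the induction pass to
  neighbourhoods. This is how smoothness of transition maps is glued together.\<close>

lemma k_smooth_on_local:
  assumes "\<And>x. x \<in> S \<Longrightarrow> \<exists>T. open T \<and> x \<in> T \<and> k_smooth_on n T f"
  shows "k_smooth_on n S f"
  using assms
proof (induction n arbitrary: f)
  case 0
  then show ?case
    by (metis continuous_at_imp_continuous_on continuous_on_eq_continuous_at k_smooth_on.simps(1))
next
  case (Suc n)
  have "f differentiable (at x)" if "x \<in> S" for x
    using Suc.prems[OF that] by auto
  moreover have "k_smooth_on n S (\<lambda>x. fd f x v)" for v
    by (rule Suc.IH) (metis Suc.prems k_smooth_on.simps(2))
  ultimately show ?case by simp
qed

lemma k_smooth_on_const [simp]: "k_smooth_on n S (\<lambda>x. c)"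
  by (induction n arbitrary: c) (auto)

lemma k_smooth_on_bounded_linear: "bounded_linear L \<Longrightarrow> k_smooth_on n S L"
proof (cases n)
  case (Suc m)
  assume L: "bounded_linear L"
  then have "fd L x = L" for x
    by (intro fd_eq bounded_linear_imp_has_derivative)
  with L Suc show ?thesis
    by (auto simp: bounded_linear_imp_differentiable)
qed (auto simp: linear_continuous_on)

lemma k_smooth_on_add:
  assumes "open S" "k_smooth_on n S f" "k_smooth_on n S g"
  shows "k_smooth_on n S (\<lambda>x. f x + g x)"
  using assms(2,3)
proof (induction n arbitrary: f g)
  case 0
  then show ?case by (auto intro!: continuous_on_add)
next
  case (Suc n)
  have *: "((\<lambda>x. f x + g x) has_derivative (\<lambda>v. fd f x v + fd g x v)) (at x)" if "x \<in> S" for x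
    using Suc.prems that by (auto intro!: derivative_intros has_derivative_fd)
  have "k_smooth_on n S (\<lambda>x. fd (\<lambda>x. f x + g x) x v)" for v
  proof (rule k_smooth_on_cong[OF assms(1)])
    show "k_smooth_on n S (\<lambda>x. fd f x v + fd g x v)"
      using Suc by auto
  qed (simp add: fd_eq[OF *])
  then show ?case using * by (auto simp: differentiable_def)
qed

lemma k_smooth_on_bilinear:
  assumes "bounded_bilinear bp" "open S" "k_smooth_on n S f" "k_smooth_on n S g"
  shows "k_smooth_on n S (\<lambda>x. bp (f x) (g x))"
  using assms(3,4)
proof (induction n arbitrary: f g)
  case 0
  then show ?case by (auto intro: bounded_bilinear.continuous_on[OF assms(1)])
next
  case (Suc n)
  have *: "((\<lambda>x. bp (f x) (g x)) has_derivative (\<lambda>v. bp (f x) (fd g x v) + bp (fd f x v) (g x))) (at x)"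
    if "x \<in> S" for x
    using Suc.prems that by (intro bounded_bilinear.FDERIV[OF assms(1)]) (auto intro!: has_derivative_fd)
  have "k_smooth_on n S (\<lambda>x. fd (\<lambda>x. bp (f x) (g x)) x v)" for v
  proof (rule k_smooth_on_cong[OF assms(2)])
    show "k_smooth_on n S (\<lambda>x. bp (f x) (fd g x v) + bp (fd f x v) (g x))"
      using k_smooth_on_Suc_D[OF Suc.prems(1)] k_smooth_on_Suc_D[OF Suc.prems(2)] Suc.prems
      by (intro k_smooth_on_add assms Suc.IH) simp_all
  qed (simp add: fd_eq[OF *])
  then show ?case using * by (auto simp: differentiable_def)
qed

lemma k_smooth_on_linear_comp:
  assumes "bounded_linear L" "open S" "k_smooth_on n S f"
  shows "k_smooth_on n S (\<lambda>x. L (f x))"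
  using assms(3)
proof (induction n arbitrary: f)
  case 0
  then show ?case by (auto intro: bounded_linear.continuous_on[OF assms(1)])
next
  case (Suc n)
  have *: "((\<lambda>x. L (f x)) has_derivative (\<lambda>v. L (fd f x v))) (at x)" if "x \<in> S" for x
    using Suc.prems that by (intro bounded_linear.has_derivative[OF assms(1)]) (auto intro!: has_derivative_fd)
  have "k_smooth_on n S (\<lambda>x. fd (\<lambda>x. L (f x)) x v)" for v
  proof (rule k_smooth_on_cong[OF assms(2)])
    show "k_smooth_on n S (\<lambda>x. L (fd f x v))"
      using Suc by auto
  qed (simp add: fd_eq[OF *])
  then show ?case using * by (auto simp: differentiable_def)
qed

lemma k_smooth_on_sum:
  assumes "open S" "\<And>i. i \<in> I \<Longrightarrow> k_smooth_on n S (f i :: _ \<Rightarrow> _)"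
  shows "k_smooth_on n S (\<lambda>x. \<Sum>i\<in>I. f i x)"
  using assms(2)
proof (induction I rule: infinite_finite_induct)
  case (insert i I)
  then show ?case by (simp add: k_smooth_on_add[OF assms(1)])
qed auto

text \<open>\<open>k_smooth_on\<close> differentiates in fixed directions only, whereas chain rules
  produce directions that vary with the point. The basis expansion reduces the latter to the
  former.\<close>

lemma fd_euclidean_sum:
  fixes f :: "'e::euclidean_space \<Rightarrow> 'b::real_normed_vector"
  assumes "f differentiable (at x)"
  shows "fd f x v = (\<Sum>i\<in>Basis. (v \<bullet> i) *\<^sub>R fd f x i)"
proof -
  interpret linear "fd f x" using linear_fd[OF assms] .
  have "fd f x v = fd f x (\<Sum>i\<in>Basis. (v \<bullet> i) *\<^sub>R i)" by (simp add: euclidean_representation)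
  then show ?thesis by (simp add: sum scaleR)
qed

text \<open>By the chain rule and the basis expansion, each directional derivative is a sum of
  products of derivatives of \<open>g\<close> with \<open>fd f (g x) i\<close>. The latter has one
  order less in \<open>f\<close> and the same inner map, so the induction hypothesis
  applies.\<close>

lemma k_smooth_on_compose:
  fixes f :: "'e::euclidean_space \<Rightarrow> 'b::real_normed_vector" and g :: "'c::real_normed_vector \<Rightarrow> 'e"
  assumes "open S" "open T" "g ` S \<subseteq> T" "k_smooth_on n T f" "k_smooth_on n S g"
  shows "k_smooth_on n S (\<lambda>x. f (g x))"
  using assms(4,5)
proof (induction n arbitrary: f)
  case 0
  then show ?case using assms(3) by (auto intro: continuous_on_compose2)
next
  case (Suc n)
  have gT: "\<And>x. x \<in> S \<Longrightarrow> g x \<in> T" using assms(3) by auto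
  have *: "((\<lambda>x. f (g x)) has_derivative (\<lambda>v. fd f (g x) (fd g x v))) (at x)" if "x \<in> S" for x
  proof (rule has_derivative_compose[where f=g and g=f])
    show "(g has_derivative fd g x) (at x)"
      using Suc.prems that by (auto intro!: has_derivative_fd)
    show "(f has_derivative fd f (g x)) (at (g x))"
      using Suc.prems gT[OF that] by (auto intro!: has_derivative_fd)
  qed
  have "k_smooth_on n S (\<lambda>x. fd (\<lambda>x. f (g x)) x v)" for v
  proof (rule k_smooth_on_cong[OF assms(1)])
    have gn: "k_smooth_on n S g" using Suc.prems k_smooth_on_Suc_D by blast
    have "k_smooth_on n S (\<lambda>x. (fd g x v \<bullet> i) *\<^sub>R fd f (g x) i)" for i
    proof (rule k_smooth_on_bilinear[OF bounded_bilinear_scaleR assms(1)])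
      show "k_smooth_on n S (\<lambda>x. fd g x v \<bullet> i)"
        using Suc.prems by (intro k_smooth_on_linear_comp[OF bounded_linear_inner_left assms(1)]) auto
      show "k_smooth_on n S (\<lambda>x. fd f (g x) i)"
        using Suc.prems gn by (intro Suc.IH) auto
    qed
    then show "k_smooth_on n S (\<lambda>x. \<Sum>i\<in>Basis. (fd g x v \<bullet> i) *\<^sub>R fd f (g x) i)"
      by (intro k_smooth_on_sum assms(1))
    show "(\<Sum>i\<in>Basis. (fd g x v \<bullet> i) *\<^sub>R fd f (g x) i) = fd (\<lambda>x. f (g x)) x v" if "x \<in> S" for x
      using Suc.prems gT[OF that] fd_eq[OF *[OF that]] by (simp add: fd_euclidean_sum[symmetric])
  qed
  then show ?case using * by (auto simp: differentiable_def)
qed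

section \<open>Smoothness of infinite order\<close>

lemma smooth_onD: "smooth_on S f \<Longrightarrow> x \<in> S \<Longrightarrow> f differentiable (at x)"
  unfolding smooth_on_def by (drule spec[where x="Suc 0"]) simp

lemma smooth_on_fd:
  assumes "smooth_on S f" shows "smooth_on S (\<lambda>x. fd f x v)"
  unfolding smooth_on_def
proof
  fix n
  have "k_smooth_on (Suc n) S f" using assms unfolding smooth_on_def by blast
  then show "k_smooth_on n S (\<lambda>x. fd f x v)" by simp
qed

lemma smooth_on_has_derivative: "smooth_on S f \<Longrightarrow> x \<in> S \<Longrightarrow> (f has_derivative fd f x) (at x)"
  by (simp add: has_derivative_fd smooth_onD)

lemma smooth_on_continuous: "smooth_on S f \<Longrightarrow> continuous_on S f"
  unfolding smooth_on_def by (drule spec[where x=0]) simp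

lemma smooth_on_subset: "smooth_on S f \<Longrightarrow> T \<subseteq> S \<Longrightarrow> smooth_on T f"
  unfolding smooth_on_def using k_smooth_on_subset by blast

lemma smooth_on_cong:
  assumes "open S" "smooth_on S f" "\<And>x. x \<in> S \<Longrightarrow> f x = g x"
  shows "smooth_on S g"
  unfolding smooth_on_def
proof
  fix n show "k_smooth_on n S g"
    by (rule k_smooth_on_cong[OF assms(1,3)]) (use assms(2) in \<open>auto simp: smooth_on_def\<close>)
qed

lemma smooth_on_local:
  assumes "\<And>x. x \<in> S \<Longrightarrow> \<exists>T. open T \<and> x \<in> T \<and> smooth_on T f"
  shows "smooth_on S f"
  unfolding smooth_on_def
proof
  fix n show "k_smooth_on n S f"
    by (rule k_smooth_on_local) (use assms in \<open>auto simp: smooth_on_def\<close>)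
qed

lemma smooth_on_const [simp]: "smooth_on S (\<lambda>x. c)"
  by (simp add: smooth_on_def)

lemma smooth_on_bounded_linear: "bounded_linear L \<Longrightarrow> smooth_on S L"
  by (simp add: smooth_on_def k_smooth_on_bounded_linear)

lemma smooth_on_ident [simp]: "smooth_on S (\<lambda>x. x)"
  by (intro smooth_on_bounded_linear bounded_linear_ident)

lemma smooth_on_bilinear:
  assumes "bounded_bilinear bp" "open S" "smooth_on S f" "smooth_on S g"
  shows "smooth_on S (\<lambda>x. bp (f x) (g x))"
  unfolding smooth_on_def
  by (rule allI, rule k_smooth_on_bilinear[OF assms(1,2)]) (use assms(3,4) in \<open>simp_all add: smooth_on_def\<close>)

lemma smooth_on_linear_comp:
  assumes "bounded_linear L" "open S" "smooth_on S f"
  shows "smooth_on S (\<lambda>x. L (f x))"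
  unfolding smooth_on_def
  by (rule allI, rule k_smooth_on_linear_comp[OF assms(1,2)]) (use assms(3) in \<open>simp_all add: smooth_on_def\<close>)

lemma smooth_on_add:
  assumes "open S" "smooth_on S f" "smooth_on S g" shows "smooth_on S (\<lambda>x. f x + g x)"
  unfolding smooth_on_def
  by (rule allI, rule k_smooth_on_add[OF assms(1)]) (use assms(2,3) in \<open>simp_all add: smooth_on_def\<close>)

lemma smooth_on_sum:
  assumes "open S" "\<And>i. i \<in> I \<Longrightarrow> smooth_on S (f i)" shows "smooth_on S (\<lambda>x. \<Sum>i\<in>I. f i x)"
  unfolding smooth_on_def
  by (rule allI, rule k_smooth_on_sum[OF assms(1)]) (use assms(2) in \<open>simp_all add: smooth_on_def\<close>)

lemma smooth_on_compose:
  fixes f :: "'e::euclidean_space \<Rightarrow> 'b::real_normed_vector" and g :: "'c::real_normed_vector \<Rightarrow> 'e"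
  assumes "smooth_on T f" "open S" "open T" "smooth_on S g" "\<And>x. x \<in> S \<Longrightarrow> g x \<in> T"
  shows "smooth_on S (\<lambda>x. f (g x))"
proof -
  have "g ` S \<subseteq> T" using assms(5) by auto
  then show ?thesis
    unfolding smooth_on_def
    by (intro allI, rule k_smooth_on_compose[OF assms(2,3)])
      (use assms(1,4) in \<open>simp_all add: smooth_on_def\<close>)
qed

lemmas smooth_on_minus = smooth_on_linear_comp[OF bounded_linear_minus[OF bounded_linear_ident]]
lemmas smooth_on_mult = smooth_on_bilinear[OF bounded_bilinear_mult]
lemmas smooth_on_scaleR = smooth_on_bilinear[OF bounded_bilinear_scaleR]
lemmas smooth_on_inner = smooth_on_bilinear[OF bounded_bilinear_inner]
lemmas smooth_on_nth = smooth_on_linear_comp[OF bounded_linear_vec_nth]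

lemma smooth_on_diff:
  assumes "open S" "smooth_on S f" "smooth_on S g" shows "smooth_on S (\<lambda>x. f x - g x)"
  using smooth_on_add[OF assms(1,2) smooth_on_minus[OF assms(1,3)]] by simp

lemma smooth_on_vec_lambda:
  assumes "open S" "\<And>i::'n::finite. smooth_on S (f i :: _ \<Rightarrow> real)"
  shows "smooth_on S (\<lambda>x. \<chi> i. f i x)"
proof -
  have "(\<lambda>x. \<chi> i. f i x) = (\<lambda>x. \<Sum>i\<in>UNIV. f i x *\<^sub>R (axis i 1 :: real^'n))"
    by (auto simp: vec_eq_iff axis_def if_distrib cong: if_cong)
  then show ?thesis
    by simp (intro smooth_on_sum smooth_on_scaleR smooth_on_const assms)
qed

text \<open>The derivative is a product of constants and \<open>inverse\<close> itself, so order n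
  of the function gives order n of its derivative. The exponential and the square root are treated
  by the same self-reference.\<close>

lemma smooth_on_real_inverse:
  assumes "open S" "0 \<notin> S" shows "smooth_on S (inverse :: real \<Rightarrow> real)"
  unfolding smooth_on_def
proof
  fix n show "k_smooth_on n S (inverse :: real \<Rightarrow> real)"
  proof (induction n)
    case 0
    then show ?case using assms by (auto intro!: continuous_intros)
  next
    case (Suc n)
    have *: "(inverse has_derivative (\<lambda>v. - (inverse x * v * inverse x))) (at x)" if "x \<in> S" for x :: real
      using that assms by (intro has_derivative_inverse') auto
    have "k_smooth_on n S (\<lambda>x. fd inverse x v)" for v :: real
    proof (rule k_smooth_on_cong[OF assms(1)])
      show "k_smooth_on n S (\<lambda>x::real. (- v) * (inverse x * inverse x))"
        by (intro k_smooth_on_bilinear[OF bounded_bilinear_mult assms(1)] Suc) auto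
    qed (auto simp: fd_eq[OF *])
    then show ?case using * by (auto simp: differentiable_def)
  qed
qed

lemma smooth_on_real_exp: "smooth_on S (exp :: real \<Rightarrow> real)"
proof -
  have "k_smooth_on n UNIV (exp :: real \<Rightarrow> real)" for n
  proof (induction n)
    case 0
    then show ?case by (auto intro!: continuous_intros)
  next
    case (Suc n)
    have *: "(exp has_derivative (\<lambda>v. v * exp x)) (at x)" for x :: real
      by (auto intro!: derivative_eq_intros)
    have "k_smooth_on n UNIV (\<lambda>x. fd exp x v)" for v :: real
      unfolding fd_eq[OF *]
      by (intro k_smooth_on_bilinear[OF bounded_bilinear_mult] k_smooth_on_const Suc) auto
    then show ?case using * by (auto simp: differentiable_def)
  qed
  then have "k_smooth_on n S (exp :: real \<Rightarrow> real)" for n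
    by (rule k_smooth_on_subset) auto
  then show ?thesis by (simp add: smooth_on_def)
qed

lemma smooth_on_real_sqrt: "smooth_on {0<..} sqrt"
  unfolding smooth_on_def
proof
  fix n show "k_smooth_on n {0<..} sqrt"
  proof (induction n)
    case 0
    then show ?case by (auto intro!: continuous_intros)
  next
    case (Suc n)
    have *: "(sqrt has_derivative (\<lambda>v. v * (inverse (sqrt x) / 2))) (at x)" if "x \<in> {0<..}" for x :: real
      using that by (auto intro!: derivative_eq_intros simp: field_simps)
    have "k_smooth_on n {0<..} (\<lambda>x. fd sqrt x v)" for v :: real
    proof (rule k_smooth_on_cong)
      have "k_smooth_on n {0<..} (\<lambda>x. inverse (sqrt x))"
        by (rule k_smooth_on_compose[of _ "{0<..}"])
          (use smooth_on_real_inverse[of "{0<..}"] Suc in \<open>auto simp: smooth_on_def\<close>)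
      then show "k_smooth_on n {0<..} (\<lambda>x::real. (v/2) * inverse (sqrt x))"
        by (intro k_smooth_on_bilinear[OF bounded_bilinear_mult] k_smooth_on_const) auto
    qed (auto simp: fd_eq[OF *])
    then show ?case using * by (auto simp: differentiable_def)
  qed
qed

lemma smooth_on_inverse:
  fixes f :: "'e::real_normed_vector \<Rightarrow> real"
  assumes "open S" "smooth_on S f" "\<And>x. x \<in> S \<Longrightarrow> f x \<noteq> 0"
  shows "smooth_on S (\<lambda>x. inverse (f x))"
  by (rule smooth_on_compose[OF smooth_on_real_inverse, of "-{0}"]) (use assms in auto)

lemma smooth_on_divide:
  fixes f g :: "'e::real_normed_vector \<Rightarrow> real"
  assumes "open S" "smooth_on S f" "smooth_on S g" "\<And>x. x \<in> S \<Longrightarrow> g x \<noteq> 0"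
  shows "smooth_on S (\<lambda>x. f x / g x)"
  unfolding divide_inverse by (intro smooth_on_mult smooth_on_inverse assms)

lemma smooth_on_exp:
  fixes f :: "'e::real_normed_vector \<Rightarrow> real"
  assumes "open S" "smooth_on S f"
  shows "smooth_on S (\<lambda>x. exp (f x))"
  by (rule smooth_on_compose[OF smooth_on_real_exp[of UNIV]]) (use assms in auto)

lemma smooth_on_sqrt:
  fixes f :: "'e::real_normed_vector \<Rightarrow> real"
  assumes "open S" "smooth_on S f" "\<And>x. x \<in> S \<Longrightarrow> f x > 0"
  shows "smooth_on S (\<lambda>x. sqrt (f x))"
  by (rule smooth_on_compose[OF smooth_on_real_sqrt]) (use assms in auto)

lemma smooth_on_fd_apply:
  fixes f :: "'e::euclidean_space \<Rightarrow> 'b::real_normed_vector"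
  assumes "open S" "smooth_on S f" "smooth_on S w"
  shows "smooth_on S (\<lambda>x. fd f x (w x))"
proof (rule smooth_on_cong[OF assms(1)])
  show "smooth_on S (\<lambda>x. \<Sum>i\<in>Basis. (w x \<bullet> i) *\<^sub>R fd f x i)"
    by (intro smooth_on_sum smooth_on_scaleR smooth_on_inner smooth_on_fd smooth_on_const assms)
  show "(\<Sum>i\<in>Basis. (w x \<bullet> i) *\<^sub>R fd f x i) = fd f x (w x)" if "x \<in> S" for x
    by (rule fd_euclidean_sum[OF smooth_onD[OF assms(2) that], symmetric])
qed

lemma smooth_on_fst_snd:
  "smooth_on S (fst :: 'a::real_normed_vector \<times> 'b::real_normed_vector \<Rightarrow> 'a)"
  "smooth_on S (snd :: 'a::real_normed_vector \<times> 'b::real_normed_vector \<Rightarrow> 'b)"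
  by (simp_all add: smooth_on_bounded_linear bounded_linear_fst bounded_linear_snd)

lemmas smooth_intros = smooth_on_const smooth_on_ident smooth_on_add smooth_on_diff smooth_on_minus
  smooth_on_mult smooth_on_scaleR smooth_on_inner smooth_on_nth smooth_on_fd smooth_on_fd_apply

subsection \<open>Symmetry of second derivatives\<close>

text \<open>The mean value theorem is applied twice: along u to the increment of \<open>f\<close> in
  direction v, then along v to the u-derivative. The left side is symmetric in u and v, which is the
  source of the symmetry of second derivatives.\<close>

lemma second_difference_mvt:
  fixes f :: "'e::euclidean_space \<Rightarrow> real"
  assumes f: "smooth_on (ball x r) f" and t: "0 < t" "t * (norm u + norm v) < r"
  shows "\<exists>z\<in>ball x r. f (x + t *\<^sub>R u + t *\<^sub>R v) - f (x + t *\<^sub>R u) - f (x + t *\<^sub>R v) + f x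
           = t * (t * fd (\<lambda>z. fd f z u) z v)"
proof -
  have inball: "x + a *\<^sub>R u + b *\<^sub>R v \<in> ball x r" if "0 \<le> a" "a \<le> t" "0 \<le> b" "b \<le> t" for a b
  proof -
    have "norm (a *\<^sub>R u + b *\<^sub>R v) \<le> a * norm u + b * norm v"
      using that norm_triangle_ineq[of "a *\<^sub>R u" "b *\<^sub>R v"] by simp
    also have "\<dots> \<le> t * norm u + t * norm v"
      using that by (intro add_mono mult_right_mono) auto
    finally have "norm (a *\<^sub>R u + b *\<^sub>R v) < r" using t by (simp add: distrib_left)
    moreover have "dist x (x + a *\<^sub>R u + b *\<^sub>R v) = norm (a *\<^sub>R u + b *\<^sub>R v)"
      by (metis add.assoc add_diff_cancel_left' dist_commute dist_norm)
    ultimately show ?thesis by simp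
  qed
  define \<phi> where "\<phi> = (\<lambda>s. f (x + s *\<^sub>R u + t *\<^sub>R v) - f (x + s *\<^sub>R u + 0 *\<^sub>R v))"
  have d1: "((\<lambda>s. f (x + s *\<^sub>R u + b *\<^sub>R v)) has_derivative (\<lambda>h. fd f (x + s *\<^sub>R u + b *\<^sub>R v) (h *\<^sub>R u))) (at s within {0..t})"
    if "0 \<le> s" "s \<le> t" "0 \<le> b" "b \<le> t" for s b
  proof (rule has_derivative_compose[where g=f and f="\<lambda>s. x + s *\<^sub>R u + b *\<^sub>R v"])
    show "((\<lambda>s. x + s *\<^sub>R u + b *\<^sub>R v) has_derivative (\<lambda>h. h *\<^sub>R u)) (at s within {0..t})"
      by (auto intro!: derivative_eq_intros)
  qed (intro smooth_on_has_derivative[OF f] inball that)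
  have d\<phi>: "(\<phi> has_derivative (\<lambda>h. fd f (x + s *\<^sub>R u + t *\<^sub>R v) (h *\<^sub>R u) - fd f (x + s *\<^sub>R u + 0 *\<^sub>R v) (h *\<^sub>R u)))
      (at s within {0..t})" if "0 \<le> s" "s \<le> t" for s
    unfolding \<phi>_def using that t by (intro has_derivative_diff d1) auto
  obtain s where s: "0 < s" "s < t" and
    1: "\<phi> t - \<phi> 0 = fd f (x + s *\<^sub>R u + t *\<^sub>R v) (t *\<^sub>R u) - fd f (x + s *\<^sub>R u + 0 *\<^sub>R v) (t *\<^sub>R u)"
    using mvt_simple[OF t(1) d\<phi>] by auto
  have lin: "fd f y (t *\<^sub>R u) = t * fd f y u" if "y \<in> ball x r" for y
    using linear_scale[OF linear_fd[OF smooth_onD[OF f that]], of t u] by simp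
  have 2: "\<phi> t - \<phi> 0 = t * (fd f (x + s *\<^sub>R u + t *\<^sub>R v) u - fd f (x + s *\<^sub>R u + 0 *\<^sub>R v) u)"
    using s t 1 lin[OF inball[of s t]] lin[OF inball[of s 0]] by (simp add: right_diff_distrib)
  define \<psi> where "\<psi> = (\<lambda>b. fd f (x + s *\<^sub>R u + b *\<^sub>R v) u)"
  note f2 = smooth_on_fd[OF f, of u]
  have d\<psi>: "(\<psi> has_derivative (\<lambda>h. fd (\<lambda>z. fd f z u) (x + s *\<^sub>R u + b *\<^sub>R v) (h *\<^sub>R v))) (at b within {0..t})"
    if "0 \<le> b" "b \<le> t" for b
    unfolding \<psi>_def
  proof (rule has_derivative_compose[where g="\<lambda>z. fd f z u" and f="\<lambda>b. x + s *\<^sub>R u + b *\<^sub>R v"])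
    show "((\<lambda>b. x + s *\<^sub>R u + b *\<^sub>R v) has_derivative (\<lambda>h. h *\<^sub>R v)) (at b within {0..t})"
      by (auto intro!: derivative_eq_intros)
    show "((\<lambda>z. fd f z u) has_derivative fd (\<lambda>z. fd f z u) (x + s *\<^sub>R u + b *\<^sub>R v)) (at (x + s *\<^sub>R u + b *\<^sub>R v))"
      using that s by (intro smooth_on_has_derivative[OF f2] inball) auto
  qed
  obtain b where b: "0 < b" "b < t" and
    3: "\<psi> t - \<psi> 0 = fd (\<lambda>z. fd f z u) (x + s *\<^sub>R u + b *\<^sub>R v) (t *\<^sub>R v)"
    using mvt_simple[OF t(1) d\<psi>] by auto
  have z: "x + s *\<^sub>R u + b *\<^sub>R v \<in> ball x r" using s b by (intro inball) auto
  have "\<psi> t - \<psi> 0 = t * fd (\<lambda>z. fd f z u) (x + s *\<^sub>R u + b *\<^sub>R v) v"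
    using 3 linear_scale[OF linear_fd[OF smooth_onD[OF f2 z]], of t v] by simp
  with 2 have "\<phi> t - \<phi> 0 = t * (t * fd (\<lambda>z. fd f z u) (x + s *\<^sub>R u + b *\<^sub>R v) v)"
    by (simp add: \<psi>_def)
  then show ?thesis
    using z by (intro bexI[of _ "x + s *\<^sub>R u + b *\<^sub>R v"]) (auto simp: \<phi>_def)
qed

lemma fd_fd_commute_real:
  fixes f :: "'e::euclidean_space \<Rightarrow> real"
  assumes S: "open S" "x \<in> S" and f: "smooth_on S f"
  shows "fd (\<lambda>z. fd f z u) x v = fd (\<lambda>z. fd f z v) x u"
proof (rule ccontr)
  let ?a = "\<lambda>z. fd (\<lambda>z. fd f z u) z v" and ?b = "\<lambda>z. fd (\<lambda>z. fd f z v) z u"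
  assume ne: "?a x \<noteq> ?b x"
  \<comment> \<open>Half of the gap: a value within \<open>e\<close> of \<open>?a x\<close> and a
    value within \<open>e\<close> of \<open>?b x\<close> cannot coincide.\<close>
  define e where "e = \<bar>?a x - ?b x\<bar> / 2"
  have e: "e > 0" using ne by (simp add: e_def)
  have "isCont ?a x" "isCont ?b x"
    using smooth_on_continuous[OF smooth_on_fd[OF smooth_on_fd[OF f]]] S
    by (simp_all add: continuous_on_eq_continuous_at)
  note * = this[unfolded continuous_at_eps_delta]
  obtain r1 where r1: "r1 > 0" "\<And>z. dist z x < r1 \<Longrightarrow> dist (?a z) (?a x) < e"
    using *(1)[rule_format, OF e] by auto
  obtain r2 where r2: "r2 > 0" "\<And>z. dist z x < r2 \<Longrightarrow> dist (?b z) (?b x) < e"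
    using *(2)[rule_format, OF e] by auto
  obtain r3 where r3: "r3 > 0" "ball x r3 \<subseteq> S" using S open_contains_ball by blast
  define r where "r = min r1 (min r2 r3)"
  have rpos: "r > 0" using r1 r2 r3 by (simp add: r_def)
  have fr: "smooth_on (ball x r) f" using f r3 by (intro smooth_on_subset[OF f]) (auto simp: r_def)
  \<comment> \<open>The summand 1 keeps the denominator positive when u and v vanish, and makes the
    bound by r strict.\<close>
  define t where "t = r / (norm u + norm v + 1)"
  have pos: "norm u + norm v + 1 > 0" by (simp add: add_nonneg_pos)
  have t: "t > 0" "t * (norm u + norm v) < r" "t * (norm v + norm u) < r"
    using rpos pos by (auto simp: t_def field_simps)
  obtain z where z: "z \<in> ball x r" and
    1: "f (x + t *\<^sub>R u + t *\<^sub>R v) - f (x + t *\<^sub>R u) - f (x + t *\<^sub>R v) + f x = t * (t * ?a z)"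
    using second_difference_mvt[OF fr t(1,2)] by blast
  obtain z' where z': "z' \<in> ball x r" and
    2: "f (x + t *\<^sub>R v + t *\<^sub>R u) - f (x + t *\<^sub>R v) - f (x + t *\<^sub>R u) + f x = t * (t * ?b z')"
    using second_difference_mvt[OF fr t(1,3)] by blast
  have comm: "x + t *\<^sub>R v + t *\<^sub>R u = x + t *\<^sub>R u + t *\<^sub>R v" by (simp add: algebra_simps)
  have "t * (t * ?a z) = t * (t * ?b z')" using 1 2[unfolded comm] by linarith
  then have eq: "?a z = ?b z'" using t by simp
  have "dist z x < r1" "dist z' x < r2"
    using z z' by (simp_all add: r_def dist_commute)
  then have "dist (?a z) (?a x) < e" "dist (?b z') (?b x) < e"
    using r1(2) r2(2) by blast+
  moreover have "\<bar>?a x - ?b x\<bar> = 2 * e" by (simp add: e_def)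
  ultimately show False using eq unfolding dist_real_def by linarith
qed

lemma fd_inner_left:
  assumes "f differentiable (at x)"
  shows "fd (\<lambda>z. f z \<bullet> w) x v = fd f x v \<bullet> w"
  using fd_eq[OF has_derivative_inner_left[OF has_derivative_fd[OF assms], of w]] by simp

lemma fd_fd_commute:
  fixes f :: "'e::euclidean_space \<Rightarrow> 'b::euclidean_space"
  assumes S: "open S" "x \<in> S" and f: "smooth_on S f"
  shows "fd (\<lambda>z. fd f z u) x v = fd (\<lambda>z. fd f z v) x u"
proof (rule euclidean_eqI)
  fix i :: 'b
  have *: "fd (\<lambda>z. fd f z u) x v \<bullet> i = fd (\<lambda>z. fd (\<lambda>z. f z \<bullet> i) z u) x v" for u v
  proof -
    have "fd (\<lambda>z. fd f z u) x v \<bullet> i = fd (\<lambda>z. fd f z u \<bullet> i) x v"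
      by (rule fd_inner_left[OF smooth_onD[OF smooth_on_fd[OF f] S(2)], symmetric])
    also have "fd (\<lambda>z. fd f z u \<bullet> i) x = fd (\<lambda>z. fd (\<lambda>z. f z \<bullet> i) z u) x"
      by (rule fd_cong[OF S]) (simp add: fd_inner_left[OF smooth_onD[OF f]])
    finally show ?thesis .
  qed
  have "smooth_on S (\<lambda>z. f z \<bullet> i)" by (intro smooth_on_inner S f smooth_on_const)
  from fd_fd_commute_real[OF S this] show "fd (\<lambda>z. fd f z u) x v \<bullet> i = fd (\<lambda>z. fd f z v) x u \<bullet> i"
    by (simp only: *)
qed

subsection \<open>Integrals depending smoothly on a parameter\<close>

text \<open>Differentiation under the integral by the Leibniz rule, which wants the derivative as a
  continuous family of bounded linear maps; \<open>fx\<close> is this family. The derivative of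
  \<open>K\<close> is taken in the product space also at the ends s = 0 and s = 1, hence a set
  \<open>T\<close> on which \<open>K\<close> is fully differentiable.\<close>

lemma integral_param_has_derivative:
  fixes K :: "'e::euclidean_space \<times> real \<Rightarrow> real"
  assumes T: "U \<times> {0..1} \<subseteq> T" and U: "open U" "z \<in> U"
    and diff: "\<And>w. w \<in> T \<Longrightarrow> K differentiable (at w)"
    and cont: "\<And>v. continuous_on T (\<lambda>w. fd K w v)"
  shows "((\<lambda>z. integral {0..1} (\<lambda>s. K (z, s))) has_derivative
           (\<lambda>v. integral {0..1} (\<lambda>s. fd K (z, s) (v, 0)))) (at z)"
proof -
  obtain r where r: "r > 0" "ball z r \<subseteq> U" using U open_contains_ball by blast
  have inT: "(y, s) \<in> T" if "y \<in> ball z r" "s \<in> {0..1}" for y s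
    using that T r by (meson mem_Sigma_iff subsetD)
  have lin: "linear (\<lambda>v. fd K (y, s) (v, 0))" if "y \<in> ball z r" "s \<in> {0..1}" for y s
  proof -
    have "linear (fd K (y, s))" using linear_fd[OF diff[OF inT[OF that]]] .
    from linear_compose[OF _ this, of "\<lambda>v. (v, 0)"] show ?thesis
      by (simp add: o_def linear_iff)
  qed
  define fx where "fx = (\<lambda>y s. Blinfun (\<lambda>v. fd K (y, s) (v, 0)))"
  have fx: "blinfun_apply (fx y s) = (\<lambda>v. fd K (y, s) (v, 0))" if "y \<in> ball z r" "s \<in> {0..1}" for y s
    unfolding fx_def using lin[OF that] by (intro bounded_linear_Blinfun_apply) (simp add: linear_conv_bounded_linear)
  have contfx: "continuous_on (ball z r \<times> cbox 0 1) (\<lambda>(y, s). fx y s)"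
  proof (rule continuous_on_blinfun_componentwise)
    fix i :: 'e
    have "continuous_on (ball z r \<times> {0..1}) (\<lambda>w. fd K w (i, 0))"
      by (rule continuous_on_subset[OF cont]) (use inT in auto)
    then show "continuous_on (ball z r \<times> cbox 0 1) (\<lambda>w. blinfun_apply (case w of (y, s) \<Rightarrow> fx y s) i)"
      unfolding cbox_interval by (rule continuous_on_eq) (auto simp: fx)
  qed
  have contK: "continuous_on T K"
    using diff by (auto intro!: continuous_at_imp_continuous_on differentiable_imp_continuous_within)
  have slice: "continuous_on {0..1} (\<lambda>s. K (y, s))" if "y \<in> ball z r" for y
    by (rule continuous_on_compose2[OF contK]) (use inT that in \<open>auto intro!: continuous_intros\<close>)
  have der: "((\<lambda>y. integral (cbox 0 1) (\<lambda>s. K (y, s))) has_derivative blinfun_apply (integral (cbox 0 1) (fx z))) (at z within ball z r)"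
  proof (rule leibniz_rule[OF _ _ contfx])
    fix y s assume ys: "y \<in> ball z r" "s \<in> cbox (0::real) 1"
    have "((\<lambda>y. (y, s)) has_derivative (\<lambda>v. (v, 0))) (at y within ball z r)"
      by (auto intro!: derivative_eq_intros)
    moreover have "(K has_derivative fd K (y, s)) (at (y, s))"
      using ys inT by (intro has_derivative_fd diff) auto
    ultimately show "((\<lambda>y. K (y, s)) has_derivative blinfun_apply (fx y s)) (at y within ball z r)"
      unfolding fx[OF ys(1) ys(2)[unfolded cbox_interval]]
      by (rule has_derivative_compose[where f="\<lambda>y. (y, s)" and g=K])
  next
    fix y assume "y \<in> ball z r"
    then show "(\<lambda>s. K (y, s)) integrable_on cbox 0 1"
      using slice by (auto intro: integrable_continuous_real)
  qed (use r in auto)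
  have app: "blinfun_apply (integral {0..1} (fx z)) = (\<lambda>v. integral {0..1} (\<lambda>s. fd K (z, s) (v, 0)))"
  proof -
    have "continuous_on {0..1} (\<lambda>s. fx z s)"
    proof -
      have "continuous_on {0..1} (\<lambda>s::real. (z, s))" by (intro continuous_intros)
      from continuous_on_compose2[OF contfx this] show ?thesis using r by (simp add: image_subset_iff)
    qed
    then have "fx z integrable_on {0..1}" by (rule integrable_continuous_real)
    then show ?thesis
    proof (intro ext)
      fix v
      have "blinfun_apply (integral {0..1} (fx z)) v = integral {0..1} (\<lambda>s. blinfun_apply (fx z s) v)"
        by (rule blinfun_apply_integral) fact
      also have "\<dots> = integral {0..1} (\<lambda>s. fd K (z, s) (v, 0))"
        by (rule integral_cong) (simp add: fx r)
      finally show "blinfun_apply (integral {0..1} (fx z)) v = integral {0..1} (\<lambda>s. fd K (z, s) (v, 0))" .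
    qed
  qed
  have *: "at z within ball z r = at z" by (rule at_within_open) (use r in auto)
  show ?thesis using der unfolding cbox_interval app * .
qed

text \<open>The derivative of the integral is the integral of \<open>fd K\<close> in direction (v,
  0), a kernel of one order less on the same \<open>T\<close>, so the induction runs over
  kernels.\<close>

lemma k_smooth_on_integral_param:
  fixes K :: "'e::euclidean_space \<times> real \<Rightarrow> real"
  assumes "open U" "U \<times> {0..1} \<subseteq> T" "k_smooth_on n T K"
  shows "k_smooth_on n U (\<lambda>z. integral {0..1} (\<lambda>s. K (z, s)))"
  using assms(3)
proof (induction n arbitrary: K)
  case 0
  have "continuous_on (U \<times> cbox 0 1) (\<lambda>(z, s). K (z, s))"
    using 0 assms(2) by (auto intro: continuous_on_subset)
  then show ?case using integral_continuous_on_param by fastforce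
next
  case (Suc n)
  have cont: "continuous_on T (\<lambda>w. fd K w v)" for v
  proof -
    have "k_smooth_on n T (\<lambda>w. fd K w v)" using Suc.prems unfolding k_smooth_on.simps(2) by blast
    moreover have "k_smooth_on m T f \<Longrightarrow> continuous_on T f" for m and f :: "'e \<times> real \<Rightarrow> real"
      by (induction m arbitrary: f) (auto intro!: continuous_at_imp_continuous_on differentiable_imp_continuous_within)
    ultimately show ?thesis by blast
  qed
  have *: "((\<lambda>z. integral {0..1} (\<lambda>s. K (z, s))) has_derivative
           (\<lambda>v. integral {0..1} (\<lambda>s. fd K (z, s) (v, 0)))) (at z)" if "z \<in> U" for z
    by (rule integral_param_has_derivative[OF assms(2,1) that _ cont]) (use Suc.prems in simp)
  have "k_smooth_on n U (\<lambda>z. fd (\<lambda>z. integral {0..1} (\<lambda>s. K (z, s))) z v)" for v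
  proof (rule k_smooth_on_cong[OF assms(1)])
    show "k_smooth_on n U (\<lambda>z. integral {0..1} (\<lambda>s. fd K (z, s) (v, 0)))"
      by (rule Suc.IH) (use Suc.prems in simp)
  qed (simp add: fd_eq[OF *])
  then show ?case using * by (auto simp: differentiable_def)
qed

text \<open>The kernel of \<open>P\<close> plays the role of a space of smooth parameters. The potential integrates
  \<open>\<omega>\<close> along the segment from \<open>z - P (z - c)\<close> to \<open>z\<close>.\<close>

lemma relative_poincare:
  fixes \<omega> :: "'e::euclidean_space \<Rightarrow> 'e"
  assumes \<omega>: "smooth_on (ball c r) \<omega>"
    and P: "linear P" "\<And>v. P (P v) = P v"
    and contr: "\<And>v s. 0 \<le> s \<Longrightarrow> s \<le> 1 \<Longrightarrow> norm (v - (1 - s) *\<^sub>R P v) \<le> norm v"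
    and closed: "\<And>z u v. z \<in> ball c r \<Longrightarrow> fd \<omega> z (P u) \<bullet> P v = fd \<omega> z (P v) \<bullet> P u"
  obtains F where "smooth_on (ball c r) F" "\<And>z v. z \<in> ball c r \<Longrightarrow> fd F z (P v) = \<omega> z \<bullet> P v"
proof -
  let ?B = "ball c r"
  have bP: "bounded_linear P" using P(1) by (simp add: linear_conv_bounded_linear)
  \<comment> \<open>The segment of integration: s = 0 gives z - P (z - c), s = 1 gives z.\<close>
  define m where "m = (\<lambda>w::'e \<times> real. fst w - (1 - snd w) *\<^sub>R P (fst w - c))"
  define K where "K = (\<lambda>w. \<omega> (m w) \<bullet> P (fst w - c))"
  \<comment> \<open>An open set on which the integrand is smooth. It contains the ball times [0, 1]
    because the norm hypothesis on \<open>P\<close> keeps the segments inside the ball.\<close>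
  define T where "T = m -` ?B"
  have sP: "smooth_on UNIV (\<lambda>w::'e \<times> real. P (fst w - c))"
    by (intro smooth_on_linear_comp[OF bP] smooth_on_diff smooth_on_fst_snd smooth_on_const open_UNIV)
  have sm: "smooth_on UNIV m"
    unfolding m_def by (intro smooth_on_diff smooth_on_scaleR smooth_on_fst_snd smooth_on_const sP open_UNIV)
  have oT: "open T" unfolding T_def
    by (rule open_vimage[OF open_ball smooth_on_continuous[OF sm]])
  have sK: "smooth_on T K" unfolding K_def
  proof (rule smooth_on_inner[OF oT])
    show "smooth_on T (\<lambda>w. \<omega> (m w))"
      by (rule smooth_on_compose[OF \<omega> oT open_ball]) (auto simp: T_def intro: smooth_on_subset[OF sm])
    show "smooth_on T (\<lambda>w. P (fst w - c))" by (rule smooth_on_subset[OF sP]) simp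
  qed
  have mB: "m (z, s) \<in> ?B" if "z \<in> ?B" "0 \<le> s" "s \<le> 1" for z s
  proof -
    have "dist c (m (z, s)) = norm ((z - c) - (1 - s) *\<^sub>R P (z - c))"
      unfolding m_def dist_norm by (subst norm_minus_commute) (simp add: algebra_simps)
    also have "\<dots> \<le> norm (z - c)" by (rule contr) (use that in auto)
    also have "\<dots> < r" using that by (simp add: dist_norm norm_minus_commute)
    finally show ?thesis by simp
  qed
  then have UT: "?B \<times> {0..1} \<subseteq> T" by (auto simp: T_def)
  define F where "F = (\<lambda>z. integral {0..1} (\<lambda>s. K (z, s)))"
  have sF: "smooth_on ?B F" unfolding F_def smooth_on_def
    by (intro allI k_smooth_on_integral_param[OF _ UT]) (use sK in \<open>auto simp: smooth_on_def\<close>)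
  moreover have "fd F z (P v) = \<omega> z \<bullet> P v" if z: "z \<in> ?B" for z v
  proof -
    let ?p = "P (z - c)"
    have dF: "fd F z (P v) = integral {0..1} (\<lambda>s. fd K (z, s) (P v, 0))"
      unfolding F_def
      by (subst fd_eq[OF integral_param_has_derivative[OF UT open_ball z]])
        (use sK smooth_on_continuous smooth_on_fd smooth_onD in blast)+
    have d\<omega>: "(\<omega> has_derivative fd \<omega> (m (z, s))) (at (m (z, s)))" if "s \<in> {0..1}" for s
      using that z mB by (intro smooth_on_has_derivative[OF \<omega>]) auto
    have lin\<omega>: "linear (fd \<omega> (m (z, s)))" if "s \<in> {0..1}" for s
      using that z mB by (intro linear_fd smooth_onD[OF \<omega>]) auto
    have dK: "fd K (z, s) (P v, 0) = s * (fd \<omega> (m (z, s)) ?p \<bullet> P v) + \<omega> (m (z, s)) \<bullet> P v"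
      if s: "s \<in> {0..1}" for s
    proof -
      have dm: "(m has_derivative (\<lambda>h. fst h - ((1 - s) *\<^sub>R P (fst h) + (- snd h) *\<^sub>R ?p))) (at (z, s))"
        unfolding m_def
        by (auto intro!: derivative_eq_intros bounded_linear.has_derivative[OF bP])
      have dP: "((\<lambda>w. P (fst w - c)) has_derivative (\<lambda>h. P (fst h))) (at (z, s))"
        by (auto intro!: derivative_eq_intros bounded_linear.has_derivative[OF bP])
      have "(K has_derivative (\<lambda>h. \<omega> (m (z, s)) \<bullet> P (fst h) +
          fd \<omega> (m (z, s)) (fst h - ((1 - s) *\<^sub>R P (fst h) + (- snd h) *\<^sub>R ?p)) \<bullet> P (fst (z, s) - c))) (at (z, s))"
        unfolding K_def
        by (rule has_derivative_inner[OF has_derivative_compose[OF dm d\<omega>[OF s]] dP])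
      from fd_eq[OF this] have "fd K (z, s) (P v, 0) = \<omega> (m (z, s)) \<bullet> P v + fd \<omega> (m (z, s)) (s *\<^sub>R P v) \<bullet> ?p"
        by (simp add: P(2) algebra_simps)
      also have "fd \<omega> (m (z, s)) (s *\<^sub>R P v) \<bullet> ?p = s * (fd \<omega> (m (z, s)) (P v) \<bullet> ?p)"
        using linear_scale[OF lin\<omega>[OF s]] by simp
      also have "fd \<omega> (m (z, s)) (P v) \<bullet> ?p = fd \<omega> (m (z, s)) ?p \<bullet> P v"
        using closed[OF mB[OF z]] s by auto
      finally show ?thesis by simp
    qed
    \<comment> \<open>Closedness exchanges the two arguments in \<open>dK\<close> and thereby turns
      the integrand into the derivative of \<open>q\<close>; the boundary values are q 0 = 0 and q 1
      = \<omega> z \<bullet> P v.\<close>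
    define q where "q = (\<lambda>s. s * (\<omega> (m (z, s)) \<bullet> P v))"
    have "(q has_vector_derivative (s * (fd \<omega> (m (z, s)) ?p \<bullet> P v) + \<omega> (m (z, s)) \<bullet> P v)) (at s within {0..1})"
      if s: "s \<in> {0..1}" for s
    proof -
      have dm: "((\<lambda>s. m (z, s)) has_derivative (\<lambda>h. h *\<^sub>R ?p)) (at s within {0..1})"
        unfolding m_def by (auto intro!: derivative_eq_intros)
      have "(q has_derivative (\<lambda>h. s * (fd \<omega> (m (z, s)) (h *\<^sub>R ?p) \<bullet> P v) + h * (\<omega> (m (z, s)) \<bullet> P v)))
          (at s within {0..1})"
        unfolding q_def
        by (rule has_derivative_mult[OF has_derivative_ident
              has_derivative_inner_left[OF has_derivative_compose[OF dm d\<omega>[OF s]]]])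
      then show ?thesis
        unfolding has_vector_derivative_def
        by (rule has_derivative_eq_rhs) (simp add: linear_scale[OF lin\<omega>[OF s]] fun_eq_iff algebra_simps)
    qed
    then have "((\<lambda>s. s * (fd \<omega> (m (z, s)) ?p \<bullet> P v) + \<omega> (m (z, s)) \<bullet> P v) has_integral q 1 - q 0) {0..1}"
      by (intro fundamental_theorem_of_calculus) auto
    then have "((\<lambda>s. fd K (z, s) (P v, 0)) has_integral q 1 - q 0) {0..1}"
      by (rule has_integral_eq[rotated]) (simp add: dK)
    then have "fd F z (P v) = q 1 - q 0" unfolding dF by (rule integral_unique)
    also have "\<dots> = \<omega> z \<bullet> P v" by (simp add: q_def m_def)
    finally show ?thesis .
  qed
  ultimately show thesis by (rule that)
qed

subsection \<open>The smooth inverse function theorem\<close>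

lemma smooth_on_prod:
  fixes f :: "'i \<Rightarrow> 'e::real_normed_vector \<Rightarrow> real"
  assumes "open S" "\<And>i. i \<in> I \<Longrightarrow> smooth_on S (f i)"
  shows "smooth_on S (\<lambda>x. \<Prod>i\<in>I. f i x)"
  using assms(2)
proof (induction I rule: infinite_finite_induct)
  case (insert i I)
  have "smooth_on S (\<lambda>x. f i x * (\<Prod>i\<in>I. f i x))"
    by (rule smooth_on_mult[OF assms(1)]) (use insert in auto)
  then show ?case using insert by simp
qed auto

lemma smooth_on_det:
  fixes A :: "'e::real_normed_vector \<Rightarrow> real^'n^'n"
  assumes "open S" "\<And>i j. smooth_on S (\<lambda>x. A x $ i $ j)"
  shows "smooth_on S (\<lambda>x. det (A x))"
  unfolding det_def
  by (intro smooth_on_sum smooth_on_mult smooth_on_prod smooth_on_const assms)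

text \<open>The inverse function theorem supplies a differentiable local inverse \<open>g\<close>.
  Its derivative at y is the inverse of the Jacobian at \<open>g y\<close>, which by Cramer's rule
  is a quotient of determinants of smooth entries (the map \<open>M\<close>). Thus order n of
  \<open>g\<close> gives order n of its derivative, and smoothness follows by induction.\<close>

lemma smooth_inverse_function:
  fixes F :: "real^'n \<Rightarrow> real^'n"
  assumes U: "open U" "z0 \<in> U" and F: "smooth_on U F"
    and inj: "\<And>v. fd F z0 v = 0 \<Longrightarrow> v = 0"
  obtains U' V g where "open U'" "U' \<subseteq> U" "z0 \<in> U'" "open V" "homeomorphism U' V F g" "smooth_on V g"
proof -
  define F' where "F' = (\<lambda>z. Blinfun (fd F z))"
  have F': "blinfun_apply (F' z) = fd F z" if "z \<in> U" for z
    unfolding F'_def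
    by (rule bounded_linear_Blinfun_apply) (use linear_fd[OF smooth_onD[OF F that]] in \<open>simp add: linear_conv_bounded_linear\<close>)
  have contF': "continuous_on U F'"
  proof (rule continuous_on_blinfun_componentwise)
    fix i :: "real^'n"
    have "continuous_on U (\<lambda>x. fd F x i)" using smooth_on_continuous smooth_on_fd F by blast
    then show "continuous_on U (\<lambda>x. blinfun_apply (F' x) i)"
      by (rule continuous_on_eq) (simp add: F')
  qed
  have lin0: "linear (fd F z0)" using linear_fd[OF smooth_onD[OF F U(2)]] .
  then have "inj (fd F z0)" using inj by (simp add: linear_injective_0)
  then obtain G where G: "linear G" "G \<circ> fd F z0 = id"
    using linear_injective_left_inverse[OF lin0] by blast
  have "Blinfun G o\<^sub>L F' z0 = id_blinfun"
    using G U(2) by (intro blinfun_eqI)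
      (simp add: F' bounded_linear_Blinfun_apply linear_conv_bounded_linear fun_eq_iff)
  moreover have "\<And>x. x \<in> U \<Longrightarrow> (F has_derivative blinfun_apply (F' x)) (at x)"
    by (simp add: F' smooth_on_has_derivative[OF F])
  ultimately obtain U' V g g' where 1: "open U'" "U' \<subseteq> U" "z0 \<in> U'" "open V" "homeomorphism U' V F g"
    and dg: "\<And>y. y \<in> V \<Longrightarrow> (g has_derivative g' y) (at y)"
      "\<And>y. y \<in> V \<Longrightarrow> g' y = inv (blinfun_apply (F' (g y)))"
      "\<And>y. y \<in> V \<Longrightarrow> bij (blinfun_apply (F' (g y)))"
    using inverse_function_theorem[OF U(1) _ contF' U(2), of F "Blinfun G"] by metis
  have gV: "g y \<in> U'" if "y \<in> V" for y using 1(5) that by (auto simp: homeomorphism_def)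
  have gU: "g y \<in> U" if "y \<in> V" for y using gV[OF that] 1(2) by auto
  have Ug: "\<exists>y\<in>V. z = g y" if "z \<in> U'" for z using 1(5) that by (auto simp: homeomorphism_def)
  have bij: "bij (fd F z)" if "z \<in> U'" for z
    using Ug[OF that] dg(3) gU by (auto simp: F')
  define J where "J = (\<lambda>z. matrix (fd F z))"
  have linF: "linear (fd F z)" if "z \<in> U'" for z using that 1(2) by (intro linear_fd smooth_onD[OF F]) auto
  have J: "J z *v v = fd F z v" if "z \<in> U'" for z v
    unfolding J_def using fun_cong[OF matrix_vector_mul(2)[OF linF[OF that]], of v] .
  have detJ: "det (J z) \<noteq> 0" if "z \<in> U'" for z
    unfolding J_def using det_nz_iff_inj[OF linF[OF that]] bij[OF that] by (simp add: bij_def)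
  define M where "M = (\<lambda>z v. \<chi> k. det (\<chi> i j. if j = k then v $ i else J z $ i $ j) / det (J z))"
  have M: "inv (fd F z) v = M z v" if "z \<in> U'" for z v
  proof -
    have "J z *v inv (fd F z) v = v"
      using J[OF that] bij[OF that] by (simp add: bij_def surj_f_inv_f)
    then show ?thesis using cramer[OF detJ[OF that]] unfolding M_def by blast
  qed
  have sJ: "smooth_on U' (\<lambda>z. J z $ i $ j)" for i j
    unfolding J_def matrix_def
    using smooth_on_nth[OF 1(1) smooth_on_fd[OF smooth_on_subset[OF F 1(2)]]] by simp
  have sM: "smooth_on U' (\<lambda>z. M z v)" for v
    unfolding M_def
  proof (intro smooth_on_vec_lambda smooth_on_divide smooth_on_det 1(1) sJ)
    show "smooth_on U' (\<lambda>x. (\<chi> i j. if j = k then v $ i else J x $ i $ j) $ a $ b)" for k a b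
      by (cases "b = k") (simp_all add: sJ)
  qed (use detJ in auto)
  have "k_smooth_on n V g" for n
  proof (induction n)
    case 0
    then show ?case using 1(5) by (simp add: homeomorphism_def)
  next
    case (Suc n)
    have "k_smooth_on n V (\<lambda>y. fd g y v)" for v
    proof (rule k_smooth_on_cong[OF 1(4)])
      show "k_smooth_on n V (\<lambda>y. M (g y) v)"
        by (rule k_smooth_on_compose[OF 1(4,1) _ _ Suc, of "\<lambda>z. M z v"])
          (use sM gV in \<open>auto simp: smooth_on_def\<close>)
      show "M (g y) v = fd g y v" if "y \<in> V" for y
        using that by (simp add: fd_eq[OF dg(1)] dg(2) F'[OF gU] M[OF gV])
    qed
    then show ?case using dg(1) by (auto simp: differentiable_def)
  qed
  then have "smooth_on V g" by (simp add: smooth_on_def)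
  then show thesis using that 1 by blast
qed

section \<open>Calculus in charts\<close>

text \<open>A product rule for a point-dependent linear map applied to a point-dependent vector.
  Expanding the vector in a basis leaves products of scalar functions with \<open>L z i\<close> for
  fixed i, so differentiability for frozen arguments is enough.\<close>

lemma linear_family_derivative:
  fixes L :: "'e::real_normed_vector \<Rightarrow> 'b::euclidean_space \<Rightarrow> 'c::real_normed_vector"
  assumes S: "open S" "x \<in> S" and lin: "\<And>z. z \<in> S \<Longrightarrow> linear (L z)"
    and diff: "\<And>u. (\<lambda>z. L z u) differentiable (at x)" and w: "w differentiable (at x)"
  shows "((\<lambda>z. L z (w z)) has_derivative (\<lambda>v. fd (\<lambda>z. L z (w x)) x v + L x (fd w x v))) (at x)"
proof -
  have expand: "L z u = (\<Sum>i\<in>Basis. (u \<bullet> i) *\<^sub>R L z i)" if "z \<in> S" for z u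
  proof -
    interpret linear "L z" using lin[OF that] .
    have "L z u = L z (\<Sum>i\<in>Basis. (u \<bullet> i) *\<^sub>R i)" by (simp add: euclidean_representation)
    then show ?thesis by (simp add: sum scaleR)
  qed
  have d: "((\<lambda>z. L z u) has_derivative fd (\<lambda>z. L z u) x) (at x)" for u
    by (rule has_derivative_fd[OF diff])
  have "((\<lambda>z. \<Sum>i\<in>Basis. (w x \<bullet> i) *\<^sub>R L z i) has_derivative
      (\<lambda>v. \<Sum>i\<in>Basis. (w x \<bullet> i) *\<^sub>R fd (\<lambda>z. L z i) x v)) (at x)"
    by (intro has_derivative_sum has_derivative_scaleR_right d)
  then have "((\<lambda>z. L z (w x)) has_derivative
      (\<lambda>v. \<Sum>i\<in>Basis. (w x \<bullet> i) *\<^sub>R fd (\<lambda>z. L z i) x v)) (at x)"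
    by (rule has_derivative_transform_within_open[OF _ S]) (rule expand[symmetric])
  from fd_eq[OF this] have 1: "fd (\<lambda>z. L z (w x)) x = (\<lambda>v. \<Sum>i\<in>Basis. (w x \<bullet> i) *\<^sub>R fd (\<lambda>z. L z i) x v)" .
  have "((\<lambda>z. \<Sum>i\<in>Basis. (w z \<bullet> i) *\<^sub>R L z i) has_derivative
      (\<lambda>v. \<Sum>i\<in>Basis. (w x \<bullet> i) *\<^sub>R fd (\<lambda>z. L z i) x v + (fd w x v \<bullet> i) *\<^sub>R L x i)) (at x)"
    by (intro has_derivative_sum has_derivative_scaleR d has_derivative_inner_left has_derivative_fd w)
  then have "((\<lambda>z. L z (w z)) has_derivative
      (\<lambda>v. \<Sum>i\<in>Basis. (w x \<bullet> i) *\<^sub>R fd (\<lambda>z. L z i) x v + (fd w x v \<bullet> i) *\<^sub>R L x i)) (at x)"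
    by (rule has_derivative_transform_within_open[OF _ S]) (rule expand[symmetric])
  then show ?thesis
    by (simp add: 1 sum.distrib expand[OF S(2), symmetric])
qed

lemma fd_fd_apply:
  fixes f :: "'e::euclidean_space \<Rightarrow> 'b::real_normed_vector"
  assumes "open S" "x \<in> S" "smooth_on S f" "w differentiable (at x)"
  shows "fd (\<lambda>z. fd f z (w z)) x v = fd (\<lambda>z. fd f z (w x)) x v + fd f x (fd w x v)"
proof -
  have "((\<lambda>z. fd f z (w z)) has_derivative (\<lambda>v. fd (\<lambda>z. fd f z (w x)) x v + fd f x (fd w x v))) (at x)"
    by (rule linear_family_derivative[OF assms(1,2) linear_fd[OF smooth_onD[OF assms(3)]]
          smooth_onD[OF smooth_on_fd[OF assms(3)] assms(2)] assms(4)])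
  from fd_eq[OF this] show ?thesis by simp
qed

subsection \<open>Charts\<close>

locale chart =
  fixes \<kappa> :: "('a::topological_space, 'n::finite) chart"
  assumes is_chart: "is_chart \<kappa>"
begin

lemma open_dom: "open (chart_dom \<kappa>)"
  and homeo: "homeomorphism (chart_dom \<kappa>) (chart_map \<kappa> ` chart_dom \<kappa>) (chart_map \<kappa>) (chart_inv \<kappa>)"
  and open_image_dom: "open (chart_map \<kappa> ` chart_dom \<kappa>)"
  using is_chart by (simp_all add: is_chart_def)

lemma inv_map [simp]: "p \<in> chart_dom \<kappa> \<Longrightarrow> chart_inv \<kappa> (chart_map \<kappa> p) = p"
  using homeo by (simp add: homeomorphism_def)

lemma open_image: "open W \<Longrightarrow> W \<subseteq> chart_dom \<kappa> \<Longrightarrow> open (chart_map \<kappa> ` W)"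
  using homeomorphism_imp_open_map[OF homeo, of W] openin_open_eq[OF open_dom] openin_open_eq[OF open_image_dom]
  by blast

lemma inv_map': "W \<subseteq> chart_dom \<kappa> \<Longrightarrow> q \<in> W \<Longrightarrow> chart_inv \<kappa> (chart_map \<kappa> q) = q"
  by (simp add: subset_iff)

lemma open_vimage: "open Z \<Longrightarrow> open {q \<in> chart_dom \<kappa>. chart_map \<kappa> q \<in> Z}"
proof -
  assume "open Z"
  then have "open (chart_map \<kappa> -` Z \<inter> chart_dom \<kappa>)"
    using homeo open_dom by (metis continuous_on_open_vimage homeomorphism_def)
  then show ?thesis by (simp add: vimage_def Int_def conj_commute)
qed

end

lemma chart_inv_eq: "inj_on (chart_map \<kappa>) (chart_dom \<kappa>) \<Longrightarrow> p \<in> chart_dom \<kappa> \<Longrightarrow> chart_inv \<kappa> (chart_map \<kappa> p) = p"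
  by (simp add: chart_inv_def)

text \<open>On the image of \<open>W\<close>, the map f o \<kappa>^-1 is the composition of f o
  \<nu>^-1 with the transition \<nu> o \<kappa>^-1.\<close>

lemma smooth_transition_trans:
  assumes ch: "is_chart \<kappa>" "is_chart \<mu>" "is_chart \<nu>"
    and W: "open W" "W \<subseteq> chart_dom \<kappa>" "W \<subseteq> chart_dom \<nu>"
    and 1: "smooth_on (chart_map \<kappa> ` W) (chart_map \<nu> \<circ> chart_inv \<kappa>)"
    and 2: "smooth_on (chart_map \<nu> ` W) (f \<circ> chart_inv \<nu>)"
  shows "smooth_on (chart_map \<kappa> ` W) (f \<circ> chart_inv \<kappa>)"
proof -
  interpret k: chart \<kappa> + n: chart \<nu> using ch by (simp_all add: chart_def)
  have "smooth_on (chart_map \<kappa> ` W) (\<lambda>z. (f \<circ> chart_inv \<nu>) ((chart_map \<nu> \<circ> chart_inv \<kappa>) z))"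
    by (rule smooth_on_compose[OF 2 k.open_image n.open_image 1]) (use W k.inv_map'[OF W(2)] in auto)
  then show ?thesis
    by (rule smooth_on_cong[OF k.open_image[OF W(1,2)]]) (use k.inv_map'[OF W(2)] n.inv_map'[OF W(3)] in auto)
qed

locale smooth_manifold =
  fixes A :: "('a::topological_space, 'n::finite) chart set"
  assumes atlas: "smooth_atlas A"
begin

abbreviation "CS \<equiv> coordinate_systems A"

lemma cs_chart: "\<kappa> \<in> CS \<Longrightarrow> chart \<kappa>"
  by (simp add: coordinate_systems_def chart_def)

lemma atlas_cs: "A \<subseteq> CS"
  using atlas by (auto simp: coordinate_systems_def smooth_atlas_def)

lemma atlas_at: "\<exists>\<kappa>\<in>A. p \<in> chart_dom \<kappa>"
  using atlas by (auto simp: smooth_atlas_def)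

text \<open>Members of the maximal atlas are by definition compatible only with the charts in
  \<open>A\<close>. Near each point the transition therefore factors through some chart of
  \<open>A\<close> there, and the local results are glued.\<close>

lemma transition_smooth:
  assumes "\<kappa> \<in> CS" "\<mu> \<in> CS"
  shows "smooth_on (chart_map \<kappa> ` (chart_dom \<kappa> \<inter> chart_dom \<mu>)) (chart_map \<mu> \<circ> chart_inv \<kappa>)"
proof (rule smooth_on_local)
  interpret k: chart \<kappa> + m: chart \<mu> using assms by (simp_all add: cs_chart)
  fix z assume "z \<in> chart_map \<kappa> ` (chart_dom \<kappa> \<inter> chart_dom \<mu>)"
  then obtain p where p: "p \<in> chart_dom \<kappa>" "p \<in> chart_dom \<mu>" "z = chart_map \<kappa> p" by auto
  obtain \<nu> where \<nu>: "\<nu> \<in> A" "p \<in> chart_dom \<nu>" using atlas_at by blast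
  interpret n: chart \<nu> using \<nu> atlas_cs cs_chart by blast
  define W where "W = chart_dom \<kappa> \<inter> chart_dom \<mu> \<inter> chart_dom \<nu>"
  have W: "open W" by (simp add: W_def k.open_dom m.open_dom n.open_dom open_Int)
  have c: "smoothly_compatible \<kappa> \<nu>" "smoothly_compatible \<mu> \<nu>"
    using assms \<nu> by (auto simp: coordinate_systems_def)
  have "smooth_on (chart_map \<kappa> ` W) (chart_map \<mu> \<circ> chart_inv \<kappa>)"
  proof (rule smooth_transition_trans[OF k.is_chart m.is_chart n.is_chart W])
    show "smooth_on (chart_map \<kappa> ` W) (chart_map \<nu> \<circ> chart_inv \<kappa>)"
      by (rule smooth_on_subset[OF c(1)[unfolded smoothly_compatible_def, THEN conjunct1]]) (auto simp: W_def)
    show "smooth_on (chart_map \<nu> ` W) (chart_map \<mu> \<circ> chart_inv \<nu>)"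
      by (rule smooth_on_subset[OF c(2)[unfolded smoothly_compatible_def, THEN conjunct2]]) (auto simp: W_def)
  qed (auto simp: W_def)
  moreover have "open (chart_map \<kappa> ` W)" by (rule k.open_image[OF W]) (auto simp: W_def)
  ultimately show "\<exists>T. open T \<and> z \<in> T \<and> smooth_on T (chart_map \<mu> \<circ> chart_inv \<kappa>)"
    using p \<nu> by (intro exI[of _ "chart_map \<kappa> ` W"]) (auto simp: W_def)
qed

lemma smooth_fun_onD:
  "smooth_fun_on A U f \<Longrightarrow> \<kappa> \<in> CS \<Longrightarrow> W \<subseteq> chart_dom \<kappa> \<inter> U \<Longrightarrow> smooth_on (chart_map \<kappa> ` W) (f \<circ> chart_inv \<kappa>)"
  by (rule smooth_on_subset[where S="chart_map \<kappa> ` (chart_dom \<kappa> \<inter> U)"]) (auto simp: smooth_fun_on_def)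

text \<open>\<open>smooth_fun_on\<close> quantifies over all coordinate systems; a check in a single
  chart containing \<open>U\<close> carries over by smooth transitions.\<close>

lemma smooth_fun_onI:
  assumes "\<kappa> \<in> CS" "open U" "U \<subseteq> chart_dom \<kappa>" "smooth_on (chart_map \<kappa> ` U) (f \<circ> chart_inv \<kappa>)"
  shows "smooth_fun_on A U f"
  unfolding smooth_fun_on_def
proof
  fix \<mu> assume \<mu>: "\<mu> \<in> CS"
  interpret k: chart \<kappa> + m: chart \<mu> using assms \<mu> by (simp_all add: cs_chart)
  show "smooth_on (chart_map \<mu> ` (chart_dom \<mu> \<inter> U)) (f \<circ> chart_inv \<mu>)"
  proof (rule smooth_transition_trans[OF m.is_chart k.is_chart k.is_chart])
    show "open (chart_dom \<mu> \<inter> U)" using assms(2) m.open_dom by blast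
    show "smooth_on (chart_map \<mu> ` (chart_dom \<mu> \<inter> U)) (chart_map \<kappa> \<circ> chart_inv \<mu>)"
      by (rule smooth_on_subset[OF transition_smooth[OF \<mu> assms(1)]]) (use assms in auto)
    show "smooth_on (chart_map \<kappa> ` (chart_dom \<mu> \<inter> U)) (f \<circ> chart_inv \<kappa>)"
      by (rule smooth_on_subset[OF assms(4)]) auto
  qed (use assms in auto)
qed

lemma smooth_fun_on_subset: "smooth_fun_on A U f \<Longrightarrow> W \<subseteq> U \<Longrightarrow> smooth_fun_on A W f"
  unfolding smooth_fun_on_def
proof
  fix \<kappa> assume a: "W \<subseteq> U" "\<forall>\<kappa>\<in>CS. smooth_on (chart_map \<kappa> ` (chart_dom \<kappa> \<inter> U)) (f \<circ> chart_inv \<kappa>)" "\<kappa> \<in> CS"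
  show "smooth_on (chart_map \<kappa> ` (chart_dom \<kappa> \<inter> W)) (f \<circ> chart_inv \<kappa>)"
    by (rule smooth_on_subset[OF a(2)[rule_format, OF a(3)]]) (use a(1) in auto)
qed

lemma smooth_fun_atI: "smooth_fun_on A U f \<Longrightarrow> open U \<Longrightarrow> p \<in> U \<Longrightarrow> smooth_fun_at A p f"
  by (auto simp: smooth_fun_at_def)

lemma coordinate_smooth:
  assumes "\<kappa> \<in> CS"
  shows "smooth_fun_on A (chart_dom \<kappa>) (\<lambda>q. chart_map \<kappa> q $ i)"
proof (rule smooth_fun_onI[OF assms _ order_refl])
  interpret chart \<kappa> using assms by (rule cs_chart)
  show "open (chart_dom \<kappa>)" by (rule open_dom)
  show "smooth_on (chart_map \<kappa> ` chart_dom \<kappa>) ((\<lambda>q. chart_map \<kappa> q $ i) \<circ> chart_inv \<kappa>)"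
    by (rule smooth_on_cong[OF open_image_dom smooth_on_nth[OF open_image_dom smooth_on_ident], of i]) auto
qed

lemma smooth_fun_at_differentiable:
  assumes "\<kappa> \<in> CS" "p \<in> chart_dom \<kappa>" "smooth_fun_at A p h"
  shows "(h \<circ> chart_inv \<kappa>) differentiable (at (chart_map \<kappa> p))"
proof -
  obtain U where U: "p \<in> U" "smooth_fun_on A U h" using assms(3) by (auto simp: smooth_fun_at_def)
  show ?thesis
    by (rule smooth_onD[OF smooth_fun_onD[OF U(2) assms(1) order_refl]]) (use U assms in auto)
qed

subsection \<open>Tangent vectors in charts\<close>

lemma coord_tangent_apply:
  "smooth_fun_at A p h \<Longrightarrow> coord_tangent A \<kappa> p v h = fd (h \<circ> chart_inv \<kappa>) (chart_map \<kappa> p) v"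
  by (simp add: coord_tangent_def)

lemma coord_tangent_coordinate:
  assumes "\<kappa> \<in> CS" "p \<in> chart_dom \<kappa>"
  shows "coord_tangent A \<kappa> p v (\<lambda>q. chart_map \<kappa> q $ i) = v $ i"
proof -
  interpret chart \<kappa> using assms(1) by (rule cs_chart)
  have "fd ((\<lambda>q. chart_map \<kappa> q $ i) \<circ> chart_inv \<kappa>) (chart_map \<kappa> p) = fd (\<lambda>z. z $ i) (chart_map \<kappa> p)"
    by (rule fd_cong[OF open_image_dom]) (use assms in auto)
  also have "\<dots> = (\<lambda>v. v $ i)"
    by (intro fd_eq bounded_linear_imp_has_derivative bounded_linear_vec_nth)
  finally show ?thesis
    using smooth_fun_atI[OF coordinate_smooth[OF assms(1)] open_dom assms(2)]
    by (simp add: coord_tangent_apply)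
qed

lemma coord_tangent_inject:
  assumes "\<kappa> \<in> CS" "p \<in> chart_dom \<kappa>" "coord_tangent A \<kappa> p u = coord_tangent A \<kappa> p v"
  shows "u = v"
proof (rule vec_eq_iff[THEN iffD2], rule allI)
  fix i show "u $ i = v $ i"
    using coord_tangent_coordinate[OF assms(1,2), of u i] coord_tangent_coordinate[OF assms(1,2), of v i] assms(3)
    by simp
qed

lemma coord_tangent_linear:
  assumes "\<kappa> \<in> CS" "p \<in> chart_dom \<kappa>"
  shows "coord_tangent A \<kappa> p (a *\<^sub>R u + b *\<^sub>R v) = (\<lambda>h. a * coord_tangent A \<kappa> p u h + b * coord_tangent A \<kappa> p v h)"
proof
  fix h
  show "coord_tangent A \<kappa> p (a *\<^sub>R u + b *\<^sub>R v) h = a * coord_tangent A \<kappa> p u h + b * coord_tangent A \<kappa> p v h"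
  proof (cases "smooth_fun_at A p h")
    case True
    note l = linear_fd[OF smooth_fun_at_differentiable[OF assms True]]
    show ?thesis unfolding coord_tangent_apply[OF True] linear_add[OF l] linear_scale[OF l] by simp
  qed (simp add: coord_tangent_def)
qed

lemma coord_tangent_0: "\<kappa> \<in> CS \<Longrightarrow> p \<in> chart_dom \<kappa> \<Longrightarrow> coord_tangent A \<kappa> p 0 = (\<lambda>h. 0)"
  using coord_tangent_linear[of \<kappa> p 0 0 0 0] by simp

lemma transition_has_derivative:
  assumes "\<kappa> \<in> CS" "\<mu> \<in> CS" "p \<in> chart_dom \<kappa>" "p \<in> chart_dom \<mu>"
  shows "((chart_map \<kappa> \<circ> chart_inv \<mu>) has_derivative fd (chart_map \<kappa> \<circ> chart_inv \<mu>) (chart_map \<mu> p)) (at (chart_map \<mu> p))"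
  by (rule smooth_on_has_derivative[OF transition_smooth[OF assms(2,1)]]) (use assms in auto)

lemma coord_tangent_change:
  assumes "\<kappa> \<in> CS" "\<mu> \<in> CS" "p \<in> chart_dom \<kappa>" "p \<in> chart_dom \<mu>"
  shows "coord_tangent A \<mu> p w = coord_tangent A \<kappa> p (fd (chart_map \<kappa> \<circ> chart_inv \<mu>) (chart_map \<mu> p) w)"
proof
  fix h
  interpret k: chart \<kappa> + m: chart \<mu> using assms by (simp_all add: cs_chart)
  show "coord_tangent A \<mu> p w h = coord_tangent A \<kappa> p (fd (chart_map \<kappa> \<circ> chart_inv \<mu>) (chart_map \<mu> p) w) h"
  proof (cases "smooth_fun_at A p h")
    case True
    have dh: "((h \<circ> chart_inv \<kappa>) has_derivative fd (h \<circ> chart_inv \<kappa>) (chart_map \<kappa> p))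
        (at ((chart_map \<kappa> \<circ> chart_inv \<mu>) (chart_map \<mu> p)))"
      using has_derivative_fd[OF smooth_fun_at_differentiable[OF assms(1,3) True]] assms(4) by simp
    have "((\<lambda>z. (h \<circ> chart_inv \<kappa>) ((chart_map \<kappa> \<circ> chart_inv \<mu>) z)) has_derivative
        (\<lambda>w. fd (h \<circ> chart_inv \<kappa>) (chart_map \<kappa> p) (fd (chart_map \<kappa> \<circ> chart_inv \<mu>) (chart_map \<mu> p) w)))
        (at (chart_map \<mu> p))"
      by (rule has_derivative_compose[OF transition_has_derivative[OF assms] dh])
    then have "((h \<circ> chart_inv \<mu>) has_derivative
        (\<lambda>w. fd (h \<circ> chart_inv \<kappa>) (chart_map \<kappa> p) (fd (chart_map \<kappa> \<circ> chart_inv \<mu>) (chart_map \<mu> p) w)))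
        (at (chart_map \<mu> p))"
    proof (rule has_derivative_transform_within_open)
      show "open (chart_map \<mu> ` (chart_dom \<kappa> \<inter> chart_dom \<mu>))"
        by (rule m.open_image) (auto intro: k.open_dom m.open_dom)
    qed (use assms in auto)
    from fd_eq[OF this] show ?thesis using True by (simp add: coord_tangent_apply)
  qed (simp add: coord_tangent_def)
qed

text \<open>\<open>tangent_space\<close> collects directional derivatives from all charts. By the
  chain rule one chart already produces all of them, and so the tangent space is parametrised by the
  model vectors of that chart.\<close>

lemma tangent_space_eq:
  assumes "\<kappa> \<in> CS" "p \<in> chart_dom \<kappa>"
  shows "tangent_space A p = range (coord_tangent A \<kappa> p)"
proof (intro subset_antisym subsetI)
  fix D assume "D \<in> tangent_space A p"
  then obtain \<mu> v where "D = coord_tangent A \<mu> p v" "\<mu> \<in> CS" "p \<in> chart_dom \<mu>"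
    unfolding tangent_space_def by blast
  then show "D \<in> range (coord_tangent A \<kappa> p)" using coord_tangent_change[OF assms(1) _ assms(2)] by simp
next
  fix D assume "D \<in> range (coord_tangent A \<kappa> p)"
  then show "D \<in> tangent_space A p" unfolding tangent_space_def using assms by blast
qed

lemma coord_tangent_in: "\<kappa> \<in> CS \<Longrightarrow> p \<in> chart_dom \<kappa> \<Longrightarrow> coord_tangent A \<kappa> p v \<in> tangent_space A p"
  unfolding tangent_space_def by blast

subsection \<open>Vector fields in charts\<close>

text \<open>The dictionary between abstract fields and component functions. The set \<open>W\<close>
  is part of it because fields are often smooth only near a point, and several fields are compared
  after shrinking to a common \<open>W\<close>.\<close>

definition represents :: "('a, 'n) chart \<Rightarrow> 'a set \<Rightarrow> 'a vfield \<Rightarrow> (real^'n \<Rightarrow> real^'n) \<Rightarrow> bool"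
  where "represents \<kappa> W X \<xi> \<longleftrightarrow> \<kappa> \<in> CS \<and> open W \<and> W \<subseteq> chart_dom \<kappa> \<and> smooth_on (chart_map \<kappa> ` W) \<xi> \<and>
    (\<forall>q\<in>W. X q = coord_tangent A \<kappa> q (\<xi> (chart_map \<kappa> q)))"

lemma representsD:
  assumes "represents \<kappa> W X \<xi>"
  shows "\<kappa> \<in> CS" "chart \<kappa>" "open W" "W \<subseteq> chart_dom \<kappa>" "open (chart_map \<kappa> ` W)" "smooth_on (chart_map \<kappa> ` W) \<xi>"
    "\<And>q. q \<in> W \<Longrightarrow> X q = coord_tangent A \<kappa> q (\<xi> (chart_map \<kappa> q))"
    "\<And>q. q \<in> W \<Longrightarrow> q \<in> chart_dom \<kappa>"
proof -
  show r: "\<kappa> \<in> CS" "open W" "W \<subseteq> chart_dom \<kappa>" "smooth_on (chart_map \<kappa> ` W) \<xi>"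
    "\<And>q. q \<in> W \<Longrightarrow> X q = coord_tangent A \<kappa> q (\<xi> (chart_map \<kappa> q))"
    using assms unfolding represents_def by blast+
  show "chart \<kappa>" by (rule cs_chart[OF r(1)])
  then show "open (chart_map \<kappa> ` W)" by (rule chart.open_image[OF _ r(2,3)])
  show "\<And>q. q \<in> W \<Longrightarrow> q \<in> chart_dom \<kappa>" using r(3) by blast
qed

lemma represents_subset:
  assumes "represents \<kappa> W X \<xi>" "open W'" "W' \<subseteq> W"
  shows "represents \<kappa> W' X \<xi>"
proof -
  note r = representsD[OF assms(1)]
  have "smooth_on (chart_map \<kappa> ` W') \<xi>" by (rule smooth_on_subset[OF r(6) image_mono[OF assms(3)]])
  moreover have "W' \<subseteq> chart_dom \<kappa>" using assms(3) r(4) by (rule order_trans)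
  ultimately show ?thesis unfolding represents_def using r(1,7) assms(2,3) by (simp add: subset_iff)
qed

lemma represents_const:
  assumes "\<kappa> \<in> CS" shows "represents \<kappa> (chart_dom \<kappa>) (\<lambda>q. coord_tangent A \<kappa> q v) (\<lambda>z. v)"
  unfolding represents_def using assms chart.open_dom[OF cs_chart[OF assms]] by simp

lemma represents_apply:
  assumes "represents \<kappa> W X \<xi>" "q \<in> W" "smooth_fun_at A q h"
  shows "X q h = fd (h \<circ> chart_inv \<kappa>) (chart_map \<kappa> q) (\<xi> (chart_map \<kappa> q))"
  using representsD(7)[OF assms(1,2)] coord_tangent_apply[OF assms(3)] by simp

lemma represents_smooth_apply:
  assumes X: "represents \<kappa> W X \<xi>" and h: "open U" "U \<subseteq> W" "smooth_fun_on A U h"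
  shows "smooth_fun_on A U (\<lambda>q. X q h)"
proof -
  note r = representsD[OF X]
  interpret chart \<kappa> by (rule r)
  have U: "U \<subseteq> chart_dom \<kappa>" using h r by auto
  note oU = open_image[OF h(1) U]
  show ?thesis
  proof (rule smooth_fun_onI[OF r(1) h(1) U], rule smooth_on_cong[OF oU])
    show "smooth_on (chart_map \<kappa> ` U) (\<lambda>z. fd (h \<circ> chart_inv \<kappa>) z (\<xi> z))"
      by (intro smooth_on_fd_apply[OF oU] smooth_fun_onD[OF h(3) r(1)] smooth_on_subset[OF r(6)])
        (use U h(2) in auto)
    show "fd (h \<circ> chart_inv \<kappa>) z (\<xi> z) = ((\<lambda>q. X q h) \<circ> chart_inv \<kappa>) z" if "z \<in> chart_map \<kappa> ` U" for z
      using that inv_map'[OF U] h(2) represents_apply[OF X _ smooth_fun_atI[OF h(3,1)]] by auto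
  qed
qed

lemma represents_smooth_vfield:
  assumes "represents \<kappa> W X \<xi>"
  shows "smooth_vfield_on A W X"
  unfolding smooth_vfield_on_def
proof (intro conjI ballI allI impI)
  show "X p \<in> tangent_space A p" if "p \<in> W" for p
    using representsD(7)[OF assms that] coord_tangent_in[OF representsD(1,8)[OF assms]] that by simp
qed (rule represents_smooth_apply[OF assms])

lemma represents_smooth_vfield_at:
  "represents \<kappa> W X \<xi> \<Longrightarrow> p \<in> W \<Longrightarrow> smooth_vfield_at A p X"
  unfolding smooth_vfield_at_def by (intro exI[of _ W] conjI representsD(3) represents_smooth_vfield)

text \<open>A smooth field maps the coordinate functions to smooth functions, and these values are
  the components: each X q is some \<open>coord_tangent\<close>, whose vector is recovered by
  applying it to the coordinates.\<close>

lemma smooth_vfield_represents: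
  assumes X: "smooth_vfield_on A U X" "open U" and \<kappa>: "\<kappa> \<in> CS"
  shows "represents \<kappa> (U \<inter> chart_dom \<kappa>) X (\<lambda>z. \<chi> i. X (chart_inv \<kappa> z) (\<lambda>q. chart_map \<kappa> q $ i))"
proof -
  interpret chart \<kappa> by (rule cs_chart[OF \<kappa>])
  let ?W = "U \<inter> chart_dom \<kappa>"
  have W: "open ?W" using X(2) open_dom by blast
  have "smooth_fun_on A ?W (\<lambda>q. X q (\<lambda>q. chart_map \<kappa> q $ i))" for i
  proof -
    have "smooth_fun_on A ?W (\<lambda>q. chart_map \<kappa> q $ i)"
      by (rule smooth_fun_on_subset[OF coordinate_smooth[OF \<kappa>]]) simp
    moreover have "?W \<subseteq> U" by simp
    ultimately show ?thesis using X(1)[unfolded smooth_vfield_on_def, THEN conjunct2] W by simp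
  qed
  then have *: "smooth_on (chart_map \<kappa> ` ?W) ((\<lambda>q. X q (\<lambda>q. chart_map \<kappa> q $ i)) \<circ> chart_inv \<kappa>)" for i
    by (rule smooth_fun_onD[OF _ \<kappa>]) simp
  have "smooth_on (chart_map \<kappa> ` ?W) (\<lambda>z. \<chi> i. X (chart_inv \<kappa> z) (\<lambda>q. chart_map \<kappa> q $ i))"
    by (rule smooth_on_vec_lambda[OF open_image[OF W]]) (use *[unfolded o_def] in simp_all)
  moreover have "X q = coord_tangent A \<kappa> q (\<chi> i. X q (\<lambda>q. chart_map \<kappa> q $ i))" if "q \<in> ?W" for q
  proof -
    have "X q \<in> tangent_space A q"
      using X(1)[unfolded smooth_vfield_on_def, THEN conjunct1] that by simp
    moreover have "tangent_space A q = range (coord_tangent A \<kappa> q)"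
      by (rule tangent_space_eq[OF \<kappa>]) (use that in simp)
    ultimately obtain v where v: "X q = coord_tangent A \<kappa> q v" by auto
    have "(\<chi> i. X q (\<lambda>q. chart_map \<kappa> q $ i)) = v"
      unfolding v using that by (simp add: coord_tangent_coordinate[OF \<kappa>] vec_eq_iff)
    with v show ?thesis by metis
  qed
  ultimately show ?thesis unfolding represents_def using W \<kappa> by simp
qed

lemma smooth_vfield_at_represents:
  assumes "smooth_vfield_at A p X" "\<kappa> \<in> CS" "p \<in> chart_dom \<kappa>"
  obtains W \<xi> where "represents \<kappa> W X \<xi>" "p \<in> W"
proof -
  obtain U where "open U" "p \<in> U" "smooth_vfield_on A U X" using assms(1) unfolding smooth_vfield_at_def by blast
  then show thesis using that[OF smooth_vfield_represents[OF _ _ assms(2)]] assms(3) by blast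
qed

text \<open>The second-order terms in h cancel by symmetry of second derivatives. On functions that
  are not smooth at the point both functionals are 0, so the equality holds for functionals and not
  merely on smooth functions.\<close>

lemma represents_bracket:
  assumes X: "represents \<kappa> W X \<xi>" and Y: "represents \<kappa> W Y \<eta>"
  shows "represents \<kappa> W (lie_bracket A X Y) (\<lambda>z. fd \<eta> z (\<xi> z) - fd \<xi> z (\<eta> z))"
proof -
  note rX = representsD[OF X] and rY = representsD[OF Y]
  interpret chart \<kappa> by (rule rX)
  have "lie_bracket A X Y q h = coord_tangent A \<kappa> q (fd \<eta> (chart_map \<kappa> q) (\<xi> (chart_map \<kappa> q)) - fd \<xi> (chart_map \<kappa> q) (\<eta> (chart_map \<kappa> q))) h"
    if q: "q \<in> W" for q h
  proof (cases "smooth_fun_at A q h")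
    case True
    then obtain U where U: "open U" "q \<in> U" "smooth_fun_on A U h" by (auto simp: smooth_fun_at_def)
    define V where "V = U \<inter> W"
    have V: "open V" "q \<in> V" "V \<subseteq> W" "V \<subseteq> chart_dom \<kappa>" "smooth_fun_on A V h"
      using U rX(3,4) q smooth_fun_on_subset[OF U(3)] by (auto simp: V_def)
    let ?z = "chart_map \<kappa> q" and ?h = "h \<circ> chart_inv \<kappa>"
    note oV = open_image[OF V(1,4)]
    have zV: "?z \<in> chart_map \<kappa> ` V" using V by auto
    have sh: "smooth_on (chart_map \<kappa> ` V) ?h"
      by (rule smooth_fun_onD[OF V(5) rX(1)]) (use V in auto)
    have *: "X' q (\<lambda>q. Y' q h) = fd (\<lambda>z. fd ?h z (\<xi>' ?z)) ?z (\<eta>' ?z) + fd ?h ?z (fd \<eta>' ?z (\<xi>' ?z))"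
      if X': "represents \<kappa> W X' \<xi>'" and Y': "represents \<kappa> W Y' \<eta>'" for X' Y' \<xi>' \<eta>'
    proof -
      have "smooth_fun_at A q (\<lambda>q. Y' q h)"
        using smooth_fun_atI[OF represents_smooth_apply[OF Y' V(1,3,5)] V(1,2)] .
      then have "X' q (\<lambda>q. Y' q h) = fd ((\<lambda>q. Y' q h) \<circ> chart_inv \<kappa>) ?z (\<xi>' ?z)"
        by (rule represents_apply[OF X' q])
      also have "fd ((\<lambda>q. Y' q h) \<circ> chart_inv \<kappa>) ?z = fd (\<lambda>z. fd ?h z (\<eta>' z)) ?z"
        by (rule fd_cong[OF oV zV])
          (use V(3) inv_map'[OF V(4)] represents_apply[OF Y' _ smooth_fun_atI[OF V(5,1)]] in auto)
      also have "fd (\<lambda>z. fd ?h z (\<eta>' z)) ?z (\<xi>' ?z)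
          = fd (\<lambda>z. fd ?h z (\<eta>' ?z)) ?z (\<xi>' ?z) + fd ?h ?z (fd \<eta>' ?z (\<xi>' ?z))"
        by (rule fd_fd_apply[OF oV zV sh smooth_onD[OF representsD(6)[OF Y'] imageI[OF q]]])
      also have "fd (\<lambda>z. fd ?h z (\<eta>' ?z)) ?z (\<xi>' ?z) = fd (\<lambda>z. fd ?h z (\<xi>' ?z)) ?z (\<eta>' ?z)"
        by (rule fd_fd_commute[OF oV zV sh])
      finally show ?thesis .
    qed
    note l = linear_fd[OF smooth_onD[OF sh zV]]
    have "X q (\<lambda>q. Y q h) - Y q (\<lambda>q. X q h) = fd ?h ?z (fd \<eta> ?z (\<xi> ?z)) - fd ?h ?z (fd \<xi> ?z (\<eta> ?z))"
      unfolding *[OF X Y] *[OF Y X] fd_fd_commute[OF oV zV sh, of "\<eta> ?z" "\<xi> ?z"] by simp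
    then show ?thesis using True by (simp add: lie_bracket_def coord_tangent_apply linear_diff[OF l])
  qed (simp add: lie_bracket_def coord_tangent_def)
  moreover have "smooth_on (chart_map \<kappa> ` W) (\<lambda>z. fd \<eta> z (\<xi> z) - fd \<xi> z (\<eta> z))"
    by (intro smooth_on_diff smooth_on_fd_apply rX rY)
  ultimately show ?thesis using rX(1,3,4) by (simp add: represents_def fun_eq_iff)
qed

end

subsection \<open>The metric and the Levi-Civita connection in charts\<close>

locale lorentz = smooth_manifold A
  for A :: "('a::topological_space, 'n::finite) chart set" +
  fixes g :: "'a metric_field"
  assumes metric: "lorentzian_metric A g"
begin

lemma g_sym: "D \<in> tangent_space A p \<Longrightarrow> E \<in> tangent_space A p \<Longrightarrow> g p D E = g p E D"
  using metric unfolding lorentzian_metric_def by simp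

lemma g_linear:
  "D \<in> tangent_space A p \<Longrightarrow> E \<in> tangent_space A p \<Longrightarrow> F \<in> tangent_space A p \<Longrightarrow>
    g p (\<lambda>h. r * D h + s * E h) F = r * g p D F + s * g p E F"
  using metric unfolding lorentzian_metric_def by simp

lemma g_frame:
  obtains e :: "'n \<Rightarrow> 'a tangent" and i0 where "\<And>i. e i \<in> tangent_space A p"
    "\<And>i j. g p (e i) (e j) = (if i \<noteq> j then 0 else if i = i0 then -1 else 1)"
proof -
  have "\<exists>(e :: 'n \<Rightarrow> 'a tangent) i0. (\<forall>i. e i \<in> tangent_space A p) \<and>
        (\<forall>i j. g p (e i) (e j) = (if i \<noteq> j then 0 else if i = i0 then -1 else 1))"
    using metric unfolding lorentzian_metric_def by blast
  then show thesis using that by blast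
qed

lemma g_smooth:
  "open W \<Longrightarrow> smooth_vfield_on A W X \<Longrightarrow> smooth_vfield_on A W Y \<Longrightarrow> smooth_fun_on A W (\<lambda>p. g p (X p) (Y p))"
  using metric unfolding lorentzian_metric_def by simp

definition G :: "('a, 'n) chart \<Rightarrow> real^'n \<Rightarrow> real^'n \<Rightarrow> real^'n \<Rightarrow> real"
  where "G \<kappa> z u v = g (chart_inv \<kappa> z) (coord_tangent A \<kappa> (chart_inv \<kappa> z) u) (coord_tangent A \<kappa> (chart_inv \<kappa> z) v)"

abbreviation dG :: "('a, 'n) chart \<Rightarrow> real^'n \<Rightarrow> real^'n \<Rightarrow> real^'n \<Rightarrow> real^'n \<Rightarrow> real"
  where "dG \<kappa> z w u v \<equiv> fd (\<lambda>z. G \<kappa> z u v) z w"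

lemma G_chart_map:
  assumes "\<kappa> \<in> CS" "p \<in> chart_dom \<kappa>"
  shows "G \<kappa> (chart_map \<kappa> p) u v = g p (coord_tangent A \<kappa> p u) (coord_tangent A \<kappa> p v)"
  using chart.inv_map[OF cs_chart[OF assms(1)] assms(2)] by (simp add: G_def)

context
  fixes \<kappa> assumes cs: "\<kappa> \<in> CS"
begin

interpretation chart \<kappa> by (rule cs_chart[OF cs])

abbreviation "Z \<equiv> chart_map \<kappa> ` chart_dom \<kappa>"

lemma inv_in: "z \<in> Z \<Longrightarrow> chart_inv \<kappa> z \<in> chart_dom \<kappa>"
  by (erule imageE) (simp only: inv_map)

lemma G_sym: "z \<in> Z \<Longrightarrow> G \<kappa> z u v = G \<kappa> z v u"
proof -
  assume "z \<in> Z"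
  from inv_in[OF this] show ?thesis
    unfolding G_def by (intro g_sym coord_tangent_in[OF cs])
qed

lemma G_linear_left: "z \<in> Z \<Longrightarrow> linear (\<lambda>u. G \<kappa> z u v)"
proof -
  assume "z \<in> Z"
  then have p: "chart_inv \<kappa> z \<in> chart_dom \<kappa>" by (rule inv_in)
  have lin: "G \<kappa> z (r *\<^sub>R u + s *\<^sub>R u') v = r * G \<kappa> z u v + s * G \<kappa> z u' v" for r s u u'
    unfolding G_def coord_tangent_linear[OF cs p]
    by (rule g_linear; rule coord_tangent_in[OF cs p])
  show ?thesis
    using lin[where r=1 and s=1] lin[where s=0] by (simp add: linear_iff)
qed

lemma G_linear_right: "z \<in> Z \<Longrightarrow> linear (\<lambda>v. G \<kappa> z u v)"
  using G_linear_left[of z u] unfolding linear_iff by (metis G_sym)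

lemma G_smooth: "smooth_on Z (\<lambda>z. G \<kappa> z u v)"
proof -
  have "smooth_fun_on A (chart_dom \<kappa>) (\<lambda>p. g p (coord_tangent A \<kappa> p u) (coord_tangent A \<kappa> p v))"
    by (intro g_smooth open_dom represents_smooth_vfield[OF represents_const[OF cs]])
  from smooth_fun_onD[OF this cs, of "chart_dom \<kappa>"] show ?thesis by (simp add: G_def o_def)
qed

lemma G_differentiable: "z \<in> Z \<Longrightarrow> (\<lambda>z. G \<kappa> z u v) differentiable (at z)"
  by (rule smooth_onD[OF G_smooth])

lemma dG_sym: "z \<in> Z \<Longrightarrow> dG \<kappa> z w u v = dG \<kappa> z w v u"
proof -
  assume z: "z \<in> Z"
  have "fd (\<lambda>z. G \<kappa> z u v) z = fd (\<lambda>z. G \<kappa> z v u) z"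
    by (rule fd_cong[OF open_image_dom z]) (rule G_sym)
  then show ?thesis by simp
qed

lemma G_has_derivative:
  assumes z: "z \<in> Z" and d: "\<xi> differentiable (at z)" "\<eta> differentiable (at z)"
  shows "((\<lambda>z. G \<kappa> z (\<xi> z) (\<eta> z)) has_derivative
    (\<lambda>w. dG \<kappa> z w (\<xi> z) (\<eta> z) + G \<kappa> z (fd \<xi> z w) (\<eta> z) + G \<kappa> z (\<xi> z) (fd \<eta> z w))) (at z)"
proof -
  have 1: "((\<lambda>z. G \<kappa> z u (\<eta> z)) has_derivative (\<lambda>w. dG \<kappa> z w u (\<eta> z) + G \<kappa> z u (fd \<eta> z w))) (at z)" for u
    by (rule linear_family_derivative[OF open_image_dom z G_linear_right G_differentiable[OF z] d(2)])
  have 2: "((\<lambda>z. G \<kappa> z (\<xi> z) (\<eta> z)) has_derivative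
      (\<lambda>w. fd (\<lambda>z'. G \<kappa> z' (\<xi> z) (\<eta> z')) z w + G \<kappa> z (fd \<xi> z w) (\<eta> z))) (at z)"
    by (rule linear_family_derivative[OF open_image_dom z G_linear_left _ d(1)])
      (use 1 in \<open>auto simp: differentiable_def\<close>)
  show ?thesis
    by (rule has_derivative_eq_rhs[OF 2]) (simp add: fd_eq[OF 1] fun_eq_iff)
qed

lemma G_smooth_apply:
  assumes "open U" "U \<subseteq> Z" "smooth_on U \<xi>" "smooth_on U \<eta>"
  shows "smooth_on U (\<lambda>z. G \<kappa> z (\<xi> z) (\<eta> z))"
proof (rule smooth_on_cong[OF assms(1)])
  show "smooth_on U (\<lambda>z. \<Sum>i\<in>Basis. (\<xi> z \<bullet> i) * (\<Sum>j\<in>Basis. (\<eta> z \<bullet> j) * G \<kappa> z i j))"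
    by (intro smooth_on_sum smooth_on_mult smooth_on_inner smooth_on_const assms smooth_on_subset[OF G_smooth])
  fix z assume "z \<in> U"
  then have z: "z \<in> Z" using assms by auto
  have L: "\<phi> u = (\<Sum>i\<in>Basis. (u \<bullet> i) * \<phi> i)" if "linear \<phi>" for \<phi> :: "real^'n \<Rightarrow> real" and u
  proof -
    interpret linear \<phi> by (rule that)
    have "\<phi> u = \<phi> (\<Sum>i\<in>Basis. (u \<bullet> i) *\<^sub>R i)" by (simp add: euclidean_representation)
    then show ?thesis by (simp add: sum scaleR)
  qed
  show "(\<Sum>i\<in>Basis. (\<xi> z \<bullet> i) * (\<Sum>j\<in>Basis. (\<eta> z \<bullet> j) * G \<kappa> z i j)) = G \<kappa> z (\<xi> z) (\<eta> z)"
    unfolding L[OF G_linear_right[OF z], of _ "\<eta> z", symmetric]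
    by (rule L[OF G_linear_left[OF z], symmetric])
qed

lemma dG_linear: 
  assumes z: "z \<in> Z"
  shows "linear (\<lambda>w. dG \<kappa> z w u v)" "linear (\<lambda>u. dG \<kappa> z w u v)" "linear (\<lambda>v. dG \<kappa> z w u v)"
proof -
  show "linear (\<lambda>w. dG \<kappa> z w u v)" by (rule linear_fd[OF G_differentiable[OF z]])
  have *: "linear (\<lambda>u. dG \<kappa> z w u v)" for v
  proof (rule linearI)
    fix a b and r :: real
    have "((\<lambda>z. G \<kappa> z a v + G \<kappa> z b v) has_derivative (\<lambda>w. dG \<kappa> z w a v + dG \<kappa> z w b v)) (at z)"
      by (intro has_derivative_add has_derivative_fd G_differentiable z)
    moreover have "fd (\<lambda>z. G \<kappa> z (a + b) v) z = fd (\<lambda>z. G \<kappa> z a v + G \<kappa> z b v) z"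
      by (rule fd_cong[OF open_image_dom z]) (rule linear_add[OF G_linear_left])
    ultimately show "dG \<kappa> z w (a + b) v = dG \<kappa> z w a v + dG \<kappa> z w b v" by (simp add: fd_eq)
    have "((\<lambda>z. r *\<^sub>R G \<kappa> z a v) has_derivative (\<lambda>w. r *\<^sub>R dG \<kappa> z w a v)) (at z)"
      by (intro has_derivative_scaleR_right has_derivative_fd G_differentiable z)
    moreover have "fd (\<lambda>z. G \<kappa> z (r *\<^sub>R a) v) z = fd (\<lambda>z. r *\<^sub>R G \<kappa> z a v) z"
      by (rule fd_cong[OF open_image_dom z]) (rule linear_scale[OF G_linear_left])
    ultimately show "dG \<kappa> z w (r *\<^sub>R a) v = r *\<^sub>R dG \<kappa> z w a v" by (simp add: fd_eq)
  qed
  show "linear (\<lambda>u. dG \<kappa> z w u v)" by (rule *)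
  have "(\<lambda>v. dG \<kappa> z w u v) = (\<lambda>v. dG \<kappa> z w v u)"
    by (rule ext) (rule dG_sym[OF z])
  then show "linear (\<lambda>v. dG \<kappa> z w u v)" using * by simp
qed

text \<open>Pairing a combination of frame vectors with the j-th one returns the j-th coefficient up
  to sign. Hence the frame is independent, and by dimension it spans.\<close>

lemma orthonormal_frame:
  assumes "p \<in> chart_dom \<kappa>"
  obtains e :: "'n \<Rightarrow> real^'n" and i0 where
    "\<And>i j. G \<kappa> (chart_map \<kappa> p) (e i) (e j) = (if i \<noteq> j then 0 else if i = i0 then -1 else 1)"
    "\<And>u. \<exists>c. u = (\<Sum>i\<in>UNIV. c i *\<^sub>R e i)"
proof -
  let ?z = "chart_map \<kappa> p"
  have z: "?z \<in> Z" using assms by simp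
  obtain E :: "'n \<Rightarrow> 'a tangent" and i0 where E: "\<And>i. E i \<in> tangent_space A p"
    "\<And>i j. g p (E i) (E j) = (if i \<noteq> j then 0 else if i = i0 then -1 else 1)"
    by (rule g_frame[of p]) blast
  have "\<forall>i. \<exists>v. E i = coord_tangent A \<kappa> p v"
    using E(1) tangent_space_eq[OF cs assms] by (auto simp: image_iff)
  then obtain e where e: "\<And>i. E i = coord_tangent A \<kappa> p (e i)" by metis
  have Ge: "G \<kappa> ?z (e i) (e j) = (if i \<noteq> j then 0 else if i = i0 then -1 else 1)" for i j
    using E(2)[of i j] unfolding e by (simp add: G_chart_map[OF cs assms])
  define S where "S = (\<lambda>c :: real^'n. \<Sum>i\<in>UNIV. (c $ i) *\<^sub>R e i)"
  have linS: "linear S"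
    unfolding S_def by (intro linearI) (simp_all add: scaleR_left_distrib sum.distrib scaleR_sum_right)
  have GS: "G \<kappa> ?z (S c) (e j) = c $ j * (if j = i0 then -1 else 1)" for c j
  proof -
    interpret linear "\<lambda>u. G \<kappa> ?z u (e j)" by (rule G_linear_left[OF z])
    have "G \<kappa> ?z (S c) (e j) = (\<Sum>i\<in>UNIV. c $ i * G \<kappa> ?z (e i) (e j))"
      unfolding S_def by (simp add: sum scaleR)
    also have "\<dots> = (\<Sum>i\<in>UNIV. if i = j then c $ j * (if j = i0 then -1 else 1) else 0)"
      by (rule sum.cong) (auto simp: Ge)
    finally show ?thesis by simp
  qed
  have "inj S"
    unfolding linear_injective_0[OF linS]
  proof (intro allI impI)
    fix c assume "S c = 0"
    then have "c $ j = 0" for j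
      using GS[of c j] linear_0[OF G_linear_left[OF z]] by (simp split: if_splits)
    then show "c = 0" by (simp add: vec_eq_iff)
  qed
  then have "surj S" by (rule linear_inj_imp_surj[OF linS])
  have "\<exists>c. u = (\<Sum>i\<in>UNIV. c i *\<^sub>R e i)" for u
  proof -
    obtain c where "u = S c" using \<open>surj S\<close> by (rule surjE)
    then show ?thesis unfolding S_def by blast
  qed
  then show thesis by (rule that[OF Ge])
qed

lemma G_nondegenerate:
  assumes z: "z \<in> Z" and 0: "\<And>w. G \<kappa> z u w = 0"
  shows "u = 0"
proof -
  obtain p where p: "p \<in> chart_dom \<kappa>" "z = chart_map \<kappa> p" using z by auto
  show "u = 0"
  proof (rule orthonormal_frame[OF p(1), folded p(2)])
    fix e :: "'n \<Rightarrow> real^'n" and i0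
    assume e: "\<And>i j. G \<kappa> z (e i) (e j) = (if i \<noteq> j then 0 else if i = i0 then -1 else 1)"
      "\<And>u. \<exists>c. u = (\<Sum>i\<in>UNIV. c i *\<^sub>R e i)"
    obtain c where c: "u = (\<Sum>i\<in>UNIV. c i *\<^sub>R e i)" using e(2) by blast
    have "c j = 0" for j
    proof -
      interpret linear "\<lambda>u. G \<kappa> z u (e j)" by (rule G_linear_left[OF z])
      have "G \<kappa> z u (e j) = (\<Sum>i\<in>UNIV. c i * G \<kappa> z (e i) (e j))"
        unfolding c by (simp add: sum scaleR)
      also have "\<dots> = (\<Sum>i\<in>UNIV. if i = j then c j * (if j = i0 then -1 else 1) else 0)"
        by (rule sum.cong) (auto simp: e)
      finally show ?thesis using 0 by (simp split: if_splits)
    qed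
    then show ?thesis unfolding c by simp
  qed
qed

text \<open>Nondegeneracy makes d \<mapsto> G d injective, hence surjective by dimension. This
  provides the Christoffel term of the connection in charts where the metric is not
  explicit.\<close>

lemma G_riesz:
  assumes z: "z \<in> Z" and K: "linear K"
  obtains d where "\<And>w. G \<kappa> z d w = K w"
proof -
  define T where "T = (\<lambda>d. \<chi> i. G \<kappa> z d (axis i 1))"
  have linT: "linear T"
    unfolding T_def
    by (intro linearI) (simp_all add: vec_eq_iff linear_add[OF G_linear_left[OF z]] linear_scale[OF G_linear_left[OF z]])
  have ext: "\<phi> = \<psi>" if "linear \<phi>" "linear \<psi>" "\<And>i. \<phi> (axis i 1) = \<psi> (axis i 1)" for \<phi> \<psi> :: "real^'n \<Rightarrow> real"
    by (rule linear_eq_stdbasis[OF that(1,2)]) (use that(3) in \<open>auto simp: Basis_vec_def\<close>)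
  have "inj T"
    unfolding linear_injective_0[OF linT]
  proof (intro allI impI)
    fix d assume "T d = 0"
    then have "G \<kappa> z d (axis i 1) = 0" for i by (simp add: T_def vec_eq_iff)
    then have "G \<kappa> z d = (\<lambda>w. 0)"
      by (intro ext[OF G_linear_right[OF z] linear_zero]) auto
    then show "d = 0" by (intro G_nondegenerate[OF z]) simp
  qed
  then have "surj T" by (rule linear_inj_imp_surj[OF linT])
  then obtain d where "T d = (\<chi> i. K (axis i 1))" by (metis surjD)
  then have "G \<kappa> z d (axis i 1) = K (axis i 1)" for i by (simp add: T_def vec_eq_iff)
  then have "G \<kappa> z d = K" by (intro ext[OF G_linear_right[OF z] K])
  then show thesis using that[of d] by simp
qed

text \<open>The bracket terms cancel the derivatives of \<zeta>, so the test field enters only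
  through its value at the point. What remains beside the derivative of \<eta> are the Christoffel
  symbols of the first kind.\<close>

lemma koszul_chart:
  assumes X: "represents \<kappa> W X \<xi>" and Y: "represents \<kappa> W Y \<eta>" and Q: "represents \<kappa> W Q \<zeta>" and p: "p \<in> W"
  defines "z \<equiv> chart_map \<kappa> p"
  shows "koszul A g X Y Q p = 2 * G \<kappa> z (fd \<eta> z (\<xi> z)) (\<zeta> z)
    + dG \<kappa> z (\<xi> z) (\<eta> z) (\<zeta> z) + dG \<kappa> z (\<eta> z) (\<xi> z) (\<zeta> z) - dG \<kappa> z (\<zeta> z) (\<xi> z) (\<eta> z)"
proof -
  note W = representsD(3-5,8)[OF X]
  have z: "z \<in> Z" "z \<in> chart_map \<kappa> ` W" using p W by (auto simp: z_def)
  have *: "X' p (\<lambda>q. g q (Y' q) (Q' q)) = dG \<kappa> z (\<xi>' z) (\<eta>' z) (\<zeta>' z)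
      + G \<kappa> z (fd \<eta>' z (\<xi>' z)) (\<zeta>' z) + G \<kappa> z (\<eta>' z) (fd \<zeta>' z (\<xi>' z))"
    if X': "represents \<kappa> W X' \<xi>'" and Y': "represents \<kappa> W Y' \<eta>'" and Q': "represents \<kappa> W Q' \<zeta>'"
    for X' Y' Q' \<xi>' \<eta>' \<zeta>'
  proof -
    have "smooth_fun_on A W (\<lambda>q. g q (Y' q) (Q' q))"
      by (intro g_smooth W represents_smooth_vfield[OF Y'] represents_smooth_vfield[OF Q'])
    from represents_apply[OF X' p smooth_fun_atI[OF this W(1) p]]
    have "X' p (\<lambda>q. g q (Y' q) (Q' q)) = fd ((\<lambda>q. g q (Y' q) (Q' q)) \<circ> chart_inv \<kappa>) z (\<xi>' z)"
      by (simp add: z_def)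
    also have "fd ((\<lambda>q. g q (Y' q) (Q' q)) \<circ> chart_inv \<kappa>) z = fd (\<lambda>z. G \<kappa> z (\<eta>' z) (\<zeta>' z)) z"
    proof (rule fd_cong[OF W(3) z(2)])
      fix y assume "y \<in> chart_map \<kappa> ` W"
      then obtain q where q: "q \<in> W" "y = chart_map \<kappa> q" by auto
      then have "q \<in> chart_dom \<kappa>" using W by auto
      then show "((\<lambda>q. g q (Y' q) (Q' q)) \<circ> chart_inv \<kappa>) y = G \<kappa> y (\<eta>' y) (\<zeta>' y)"
        using representsD(7)[OF Y' q(1)] representsD(7)[OF Q' q(1)] by (simp add: q G_def)
    qed
    also have "fd (\<lambda>z. G \<kappa> z (\<eta>' z) (\<zeta>' z)) z (\<xi>' z) = dG \<kappa> z (\<xi>' z) (\<eta>' z) (\<zeta>' z)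
        + G \<kappa> z (fd \<eta>' z (\<xi>' z)) (\<zeta>' z) + G \<kappa> z (\<eta>' z) (fd \<zeta>' z (\<xi>' z))"
      by (subst fd_eq[OF G_has_derivative[OF z(1) smooth_onD[OF representsD(6)[OF Y'] z(2)]
            smooth_onD[OF representsD(6)[OF Q'] z(2)]]]) simp
    finally show ?thesis .
  qed
  have **: "g p (lie_bracket A X' Y' p) (Q' p) = G \<kappa> z (fd \<eta>' z (\<xi>' z)) (\<zeta>' z) - G \<kappa> z (fd \<xi>' z (\<eta>' z)) (\<zeta>' z)"
    if X': "represents \<kappa> W X' \<xi>'" and Y': "represents \<kappa> W Y' \<eta>'" and Q': "represents \<kappa> W Q' \<zeta>'"
    for X' Y' Q' \<xi>' \<eta>' \<zeta>'
    using representsD(7)[OF represents_bracket[OF X' Y'] p] representsD(7)[OF Q' p] G_chart_map[OF cs W(4)[OF p]]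
      linear_diff[OF G_linear_left[OF z(1)]]
    by (simp add: z_def)
  have s: "G \<kappa> z u v = G \<kappa> z v u" for u v by (rule G_sym[OF z(1)])
  show ?thesis
    unfolding koszul_def *[OF X Y Q] *[OF Y X Q] *[OF Q X Y] **[OF X Y Q] **[OF X Q Y] **[OF Y Q X]
    using s[of "\<xi> z"] s[of "\<eta> z"] s[of "\<zeta> z"] by (simp add: algebra_simps)
qed

text \<open>\<open>d\<close> is the Christoffel term. The definite description is resolved by
  existence, checked against an arbitrary test field on a common domain, and uniqueness, where
  constant test fields and nondegeneracy suffice.\<close>

lemma levi_civita_chart:
  assumes X: "represents \<kappa> W X \<xi>" and Y: "represents \<kappa> W Y \<eta>" and p: "p \<in> W"
  defines "z \<equiv> chart_map \<kappa> p"
  assumes d: "\<And>w. 2 * G \<kappa> z d w = dG \<kappa> z (\<xi> z) (\<eta> z) w + dG \<kappa> z (\<eta> z) (\<xi> z) w - dG \<kappa> z w (\<xi> z) (\<eta> z)"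
  shows "levi_civita A g X Y p = coord_tangent A \<kappa> p (fd \<eta> z (\<xi> z) + d)"
  unfolding levi_civita_def
proof (rule the_equality)
  note W = representsD(3-5,8)[OF X]
  have pd: "p \<in> chart_dom \<kappa>" by (rule W(4)[OF p])
  have z: "z \<in> Z" using pd by (auto simp: z_def)
  let ?d = "fd \<eta> z (\<xi> z) + d"
  have k: "koszul A g X Y Q p = 2 * G \<kappa> z ?d (\<zeta> z)" if Q: "represents \<kappa> W' Q \<zeta>" and p': "p \<in> W'" for Q \<zeta> W'
  proof -
    have o: "open (W \<inter> W')" "W \<inter> W' \<subseteq> W" "W \<inter> W' \<subseteq> W'" using W(1) representsD(3)[OF Q] by auto
    have "koszul A g X Y Q p = 2 * G \<kappa> z (fd \<eta> z (\<xi> z)) (\<zeta> z)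
        + dG \<kappa> z (\<xi> z) (\<eta> z) (\<zeta> z) + dG \<kappa> z (\<eta> z) (\<xi> z) (\<zeta> z) - dG \<kappa> z (\<zeta> z) (\<xi> z) (\<eta> z)"
      unfolding z_def
      by (rule koszul_chart[OF represents_subset[OF X o(1,2)] represents_subset[OF Y o(1,2)] represents_subset[OF Q o(1,3)]])
        (use p p' in simp)
    then show ?thesis using d[of "\<zeta> z"] linear_add[OF G_linear_left[OF z]] by simp
  qed
  show "coord_tangent A \<kappa> p ?d \<in> tangent_space A p \<and>
      (\<forall>Q. smooth_vfield_at A p Q \<longrightarrow> 2 * g p (coord_tangent A \<kappa> p ?d) (Q p) = koszul A g X Y Q p)"
  proof (intro conjI allI impI)
    show "coord_tangent A \<kappa> p ?d \<in> tangent_space A p" by (rule coord_tangent_in[OF cs pd])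
    fix Q assume "smooth_vfield_at A p Q"
    then obtain W' \<zeta> where Q: "represents \<kappa> W' Q \<zeta>" "p \<in> W'"
      by (rule smooth_vfield_at_represents[OF _ cs pd])
    show "2 * g p (coord_tangent A \<kappa> p ?d) (Q p) = koszul A g X Y Q p"
      unfolding k[OF Q] representsD(7)[OF Q] unfolding z_def G_chart_map[OF cs pd] ..
  qed
  fix D assume D: "D \<in> tangent_space A p \<and>
      (\<forall>Q. smooth_vfield_at A p Q \<longrightarrow> 2 * g p D (Q p) = koszul A g X Y Q p)"
  then obtain d' where d': "D = coord_tangent A \<kappa> p d'" using tangent_space_eq[OF cs pd] by auto
  have "d' - ?d = 0"
  proof (rule G_nondegenerate[OF z])
    fix w
    note C = represents_const[OF cs, of w]
    have "2 * G \<kappa> z d' w = koszul A g X Y (\<lambda>q. coord_tangent A \<kappa> q w) p"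
      using conjunct2[OF D, rule_format, OF represents_smooth_vfield_at[OF C pd]]
      unfolding d' z_def G_chart_map[OF cs pd] .
    also have "\<dots> = 2 * G \<kappa> z ?d w" by (rule k[OF C pd])
    finally show "G \<kappa> z (d' - ?d) w = 0" using linear_diff[OF G_linear_left[OF z]] by simp
  qed
  then show "D = coord_tangent A \<kappa> p ?d" by (simp add: d')
qed

text \<open>For a parallel field the Koszul formula with constant test fields says that its dual form is
  closed (antisymmetric part) and that it is Killing (symmetric part).\<close>

lemma parallel_chart:
  assumes V: "represents \<kappa> W V \<eta>" and p: "p \<in> W"
    and par: "\<And>X. smooth_vfield_at A p X \<Longrightarrow> levi_civita A g X V p = (\<lambda>h. 0)"
  defines "z \<equiv> chart_map \<kappa> p"
  shows "2 * G \<kappa> z (fd \<eta> z u) w + dG \<kappa> z u (\<eta> z) w + dG \<kappa> z (\<eta> z) u w - dG \<kappa> z w u (\<eta> z) = 0"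
proof -
  note W = representsD(3-5,8)[OF V]
  have pd: "p \<in> chart_dom \<kappa>" by (rule W(4)[OF p])
  have z: "z \<in> Z" using pd by (auto simp: z_def)
  note C = represents_const[OF cs, of u]
  \<comment> \<open>The right side of the Christoffel formula. Once it is represented by a vector d,
    parallelism along the constant field u reads fd \<eta> z u + d = 0.\<close>
  let ?K = "\<lambda>w. (dG \<kappa> z u (\<eta> z) w + dG \<kappa> z (\<eta> z) u w - dG \<kappa> z w u (\<eta> z)) / 2"
  have "linear ?K"
    using linear_add[OF dG_linear(1)[OF z]] linear_add[OF dG_linear(3)[OF z]]
      linear_scale[OF dG_linear(1)[OF z]] linear_scale[OF dG_linear(3)[OF z]]
    by (intro linearI) (simp_all add: field_simps)
  then obtain d where d: "\<And>w. G \<kappa> z d w = ?K w" using G_riesz[OF z] by blast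
  have d2: "2 * G \<kappa> z d w = dG \<kappa> z u (\<eta> z) w + dG \<kappa> z (\<eta> z) u w - dG \<kappa> z w u (\<eta> z)" for w
    using d[of w] by simp
  have "levi_civita A g (\<lambda>q. coord_tangent A \<kappa> q u) V p = coord_tangent A \<kappa> p (fd \<eta> z u + d)"
    unfolding z_def
    by (rule levi_civita_chart[OF represents_subset[OF C W(1,2)] V p d2[unfolded z_def]])
  then have "coord_tangent A \<kappa> p (fd \<eta> z u + d) = coord_tangent A \<kappa> p 0"
    using par[OF represents_smooth_vfield_at[OF C pd]] by (simp add: coord_tangent_0[OF cs pd])
  then have "fd \<eta> z u + d = 0" by (rule coord_tangent_inject[OF cs pd])
  then have "G \<kappa> z (fd \<eta> z u + d) w = 0" using linear_0[OF G_linear_left[OF z]] by simp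
  then have "G \<kappa> z (fd \<eta> z u) w + G \<kappa> z d w = 0" unfolding linear_add[OF G_linear_left[OF z]] .
  then show ?thesis using d2[of w] by linarith
qed

end

end

section \<open>Geometry in Walker coordinates\<close>

locale lorentz3 = lorentz A g
  for A :: "('a::topological_space, 3) chart set" and g :: "'a metric_field"

abbreviation e\<^sub>t :: "real^3" where "e\<^sub>t \<equiv> axis 1 1"
abbreviation e\<^sub>x :: "real^3" where "e\<^sub>x \<equiv> axis 2 1"
abbreviation e\<^sub>y :: "real^3" where "e\<^sub>y \<equiv> axis 3 1"

lemma axis3_simps [simp]:
  "e\<^sub>t $ 1 = 1" "e\<^sub>t $ 2 = 0" "e\<^sub>t $ 3 = 0" "e\<^sub>x $ 1 = 0" "e\<^sub>x $ 2 = 1" "e\<^sub>x $ 3 = 0" "e\<^sub>y $ 1 = 0" "e\<^sub>y $ 2 = 0" "e\<^sub>y $ 3 = 1"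
  by (simp_all add: axis_def)

lemma expand3: "(u :: real^3) = u $ 1 *\<^sub>R e\<^sub>t + u $ 2 *\<^sub>R e\<^sub>x + u $ 3 *\<^sub>R e\<^sub>y"
  by (simp add: vec_eq_iff forall_3)

lemma linear_expand3:
  assumes "linear (f :: real^3 \<Rightarrow> 'b::real_vector)"
  shows "f u = u $ 1 *\<^sub>R f e\<^sub>t + u $ 2 *\<^sub>R f e\<^sub>x + u $ 3 *\<^sub>R f e\<^sub>y"
  using arg_cong[OF expand3[of u], of f]
  by (simp only: linear_add[OF assms] linear_scale[OF assms])

locale walker_chart = lorentz3 A g
  for A :: "('a::topological_space, 3) chart set" and g :: "'a metric_field" +
  fixes \<kappa> :: "('a, 3) chart" and \<phi> :: "real \<Rightarrow> real \<Rightarrow> real"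
  assumes cs: "\<kappa> \<in> CS" and walker: "walker_form A g \<kappa> \<phi>"
begin

sublocale chart \<kappa> by (rule cs_chart[OF cs])


abbreviation "\<Omega> \<equiv> chart_map \<kappa> ` chart_dom \<kappa>"

definition \<Phi> :: "real^3 \<Rightarrow> real" where "\<Phi> z = \<phi> (z $ 2) (z $ 3)"

lemma openZ: "open \<Omega>" by (rule open_image_dom)

lemma G_walker:
  assumes z: "z \<in> \<Omega>"
  shows "G \<kappa> z u v = u $ 1 * v $ 3 + u $ 3 * v $ 1 + u $ 2 * v $ 2 + \<Phi> z * u $ 3 * v $ 3"
proof -
  obtain p where p: "p \<in> chart_dom \<kappa>" "z = chart_map \<kappa> p" using z by auto
  show ?thesis
    unfolding p(2) G_chart_map[OF cs p(1)]
    using walker[unfolded walker_form_def, rule_format, OF p(1) coord_tangent_in[OF cs p(1)] coord_tangent_in[OF cs p(1)], of u v]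
    by (simp add: coord_tangent_coordinate[OF cs p(1)] \<Phi>_def)
qed

lemma \<Phi>_smooth: "smooth_on \<Omega> \<Phi>"
  by (rule smooth_on_cong[OF openZ G_smooth[OF cs, of e\<^sub>y e\<^sub>y]]) (simp add: G_walker)

text \<open>\<phi> is a bare function of two reals, without a smoothness hypothesis of its own, so
  no chain rule through it is available. Instead \<Phi> is constant on the whole line through z in
  direction t, and derivatives are unique.\<close>

lemma fd_\<Phi>_t: "z \<in> \<Omega> \<Longrightarrow> fd \<Phi> z e\<^sub>t = 0"
proof -
  assume z: "z \<in> \<Omega>"
  have "((\<lambda>s. \<Phi> (z + s *\<^sub>R e\<^sub>t)) has_derivative (\<lambda>h. fd \<Phi> z (h *\<^sub>R e\<^sub>t))) (at 0)"
  proof (rule has_derivative_compose[where f="\<lambda>s. z + s *\<^sub>R e\<^sub>t" and g=\<Phi>])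
    show "((\<lambda>s. z + s *\<^sub>R e\<^sub>t) has_derivative (\<lambda>h. h *\<^sub>R e\<^sub>t)) (at 0)"
      by (auto intro!: derivative_eq_intros)
    show "(\<Phi> has_derivative fd \<Phi> z) (at (z + 0 *\<^sub>R e\<^sub>t))"
      using smooth_on_has_derivative[OF \<Phi>_smooth z] by simp
  qed
  moreover have "(\<lambda>s. \<Phi> (z + s *\<^sub>R e\<^sub>t)) = (\<lambda>s. \<Phi> z)" by (simp add: \<Phi>_def)
  ultimately have "(\<lambda>h. fd \<Phi> z (h *\<^sub>R e\<^sub>t)) = (\<lambda>h. 0)"
    using has_derivative_unique has_derivative_const by metis
  from fun_cong[OF this, of 1] show ?thesis by simp
qed

abbreviation "\<Phi>x \<equiv> \<lambda>z. fd \<Phi> z e\<^sub>x"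
abbreviation "\<Phi>y \<equiv> \<lambda>z. fd \<Phi> z e\<^sub>y"
abbreviation "\<Phi>xx \<equiv> \<lambda>z. fd \<Phi>x z e\<^sub>x"

lemma fd_\<Phi>: "z \<in> \<Omega> \<Longrightarrow> fd \<Phi> z v = v $ 2 * \<Phi>x z + v $ 3 * \<Phi>y z"
  using linear_expand3[OF linear_fd[OF smooth_onD[OF \<Phi>_smooth]], of z v] by (simp add: fd_\<Phi>_t)

lemma fd_fd_\<Phi>:
  assumes z: "z \<in> \<Omega>"
  shows "fd \<Phi>x z v = v $ 2 * \<Phi>xx z + v $ 3 * fd \<Phi>x z e\<^sub>y"
    and "fd \<Phi>y z v = v $ 2 * fd \<Phi>x z e\<^sub>y + v $ 3 * fd \<Phi>y z e\<^sub>y"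
proof -
  have 0: "fd (\<lambda>z. fd \<Phi> z w) z e\<^sub>t = 0" for w
  proof -
    have "fd (\<lambda>z. fd \<Phi> z w) z e\<^sub>t = fd (\<lambda>z. fd \<Phi> z e\<^sub>t) z w"
      by (rule fd_fd_commute[OF openZ z \<Phi>_smooth])
    also have "fd (\<lambda>z. fd \<Phi> z e\<^sub>t) z = fd (\<lambda>z. 0) z"
      by (rule fd_cong[OF openZ z]) (rule fd_\<Phi>_t)
    finally show ?thesis by simp
  qed
  have c: "fd \<Phi>y z e\<^sub>x = fd \<Phi>x z e\<^sub>y" by (rule fd_fd_commute[OF openZ z \<Phi>_smooth])
  have l: "linear (fd (\<lambda>z. fd \<Phi> z w) z)" for w
    by (rule linear_fd[OF smooth_onD[OF smooth_on_fd[OF \<Phi>_smooth] z]])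
  show "fd \<Phi>x z v = v $ 2 * \<Phi>xx z + v $ 3 * fd \<Phi>x z e\<^sub>y"
    using linear_expand3[OF l, of e\<^sub>x v] by (simp add: 0)
  show "fd \<Phi>y z v = v $ 2 * fd \<Phi>x z e\<^sub>y + v $ 3 * fd \<Phi>y z e\<^sub>y"
    using linear_expand3[OF l, of e\<^sub>y v] by (simp add: 0 c)
qed

lemma dG_walker:
  assumes z: "z \<in> \<Omega>"
  shows "dG \<kappa> z w u v = fd \<Phi> z w * u $ 3 * v $ 3"
proof -
  let ?c = "u $ 1 * v $ 3 + u $ 3 * v $ 1 + u $ 2 * v $ 2"
  have "fd (\<lambda>z. G \<kappa> z u v) z = fd (\<lambda>z. ?c + \<Phi> z * u $ 3 * v $ 3) z"
    by (rule fd_cong[OF openZ z]) (rule G_walker)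
  also have "\<dots> = (\<lambda>w. fd \<Phi> z w * u $ 3 * v $ 3)"
    by (rule fd_eq) (auto intro!: derivative_eq_intros smooth_on_has_derivative[OF \<Phi>_smooth z])
  finally show ?thesis by simp
qed

text \<open>The Christoffel symbols of the Walker metric as a bilinear map: up to symmetry the
  nonzero ones are \<Phi>x/2 in the t-component for (x, y), \<Phi>y/2 in the t-component for (y, y),
  and -\<Phi>x/2 in the x-component for (y, y).\<close>

definition \<Gamma> :: "real^3 \<Rightarrow> real^3 \<Rightarrow> real^3 \<Rightarrow> real^3"
  where "\<Gamma> z u v = (1/2 * (\<Phi>x z * (u $ 2 * v $ 3 + u $ 3 * v $ 2) + \<Phi>y z * (u $ 3 * v $ 3))) *\<^sub>R e\<^sub>t
    - (1/2 * (\<Phi>x z * (u $ 3 * v $ 3))) *\<^sub>R e\<^sub>x"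

lemma \<Gamma>_nth [simp]:
  "\<Gamma> z u v $ 1 = 1/2 * (\<Phi>x z * (u $ 2 * v $ 3 + u $ 3 * v $ 2) + \<Phi>y z * (u $ 3 * v $ 3))"
  "\<Gamma> z u v $ 2 = - (1/2 * (\<Phi>x z * (u $ 3 * v $ 3)))" "\<Gamma> z u v $ 3 = 0"
  by (simp_all add: \<Gamma>_def)

lemma linear_\<Gamma>: "linear (\<Gamma> z u)" "linear (\<lambda>u. \<Gamma> z u v)"
  by (rule linearI; simp add: vec_eq_iff forall_3 algebra_simps)+

lemma \<Gamma>_smooth:
  assumes "open U" "U \<subseteq> \<Omega>" "smooth_on U \<xi>" "smooth_on U \<eta>"
  shows "smooth_on U (\<lambda>z. \<Gamma> z (\<xi> z) (\<eta> z))"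
  unfolding \<Gamma>_def
  by (intro smooth_intros assms smooth_on_subset[OF \<Phi>_smooth])

text \<open>The covariant derivative again comes with smooth components, so that it can be iterated
  in the curvature.\<close>

lemma represents_levi_civita:
  assumes X: "represents \<kappa> W X \<xi>" and Y: "represents \<kappa> W Y \<eta>"
  shows "represents \<kappa> W (levi_civita A g X Y) (\<lambda>z. fd \<eta> z (\<xi> z) + \<Gamma> z (\<xi> z) (\<eta> z))"
proof -
  note rX = representsD[OF X] and rY = representsD[OF Y]
  have "levi_civita A g X Y q = coord_tangent A \<kappa> q (fd \<eta> (chart_map \<kappa> q) (\<xi> (chart_map \<kappa> q))
      + \<Gamma> (chart_map \<kappa> q) (\<xi> (chart_map \<kappa> q)) (\<eta> (chart_map \<kappa> q)))" if q: "q \<in> W" for q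
  proof (rule levi_civita_chart[OF cs X Y q])
    let ?z = "chart_map \<kappa> q"
    have z: "?z \<in> \<Omega>" using rX(8)[OF q] by simp
    show "2 * G \<kappa> ?z (\<Gamma> ?z (\<xi> ?z) (\<eta> ?z)) w = dG \<kappa> ?z (\<xi> ?z) (\<eta> ?z) w + dG \<kappa> ?z (\<eta> ?z) (\<xi> ?z) w - dG \<kappa> ?z w (\<xi> ?z) (\<eta> ?z)" for w
      unfolding dG_walker[OF z] G_walker[OF z] fd_\<Phi>[OF z, of "\<xi> ?z"] fd_\<Phi>[OF z, of "\<eta> ?z"] fd_\<Phi>[OF z, of w]
      by (simp add: algebra_simps)
  qed
  moreover have "smooth_on (chart_map \<kappa> ` W) (\<lambda>z. fd \<eta> z (\<xi> z) + \<Gamma> z (\<xi> z) (\<eta> z))"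
    by (intro smooth_on_add smooth_on_fd_apply \<Gamma>_smooth rX rY image_mono)
  ultimately show ?thesis unfolding represents_def using rX(1,3,4) by simp
qed

lemma fd_\<Gamma>:
  assumes z: "z \<in> \<Omega>" and d: "\<xi> differentiable (at z)" "\<eta> differentiable (at z)"
  shows "fd (\<lambda>z. \<Gamma> z (\<xi> z) (\<eta> z)) z w = fd (\<lambda>z'. \<Gamma> z' (\<xi> z) (\<eta> z)) z w + \<Gamma> z (fd \<xi> z w) (\<eta> z) + \<Gamma> z (\<xi> z) (fd \<eta> z w)"
proof -
  have 0: "(\<lambda>z. \<Gamma> z u v) differentiable (at z)" for u v
    by (rule smooth_onD[OF \<Gamma>_smooth[OF openZ order_refl] z]) auto
  have 1: "((\<lambda>z. \<Gamma> z u (\<eta> z)) has_derivative (\<lambda>w. fd (\<lambda>z'. \<Gamma> z' u (\<eta> z)) z w + \<Gamma> z u (fd \<eta> z w))) (at z)" for u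
    by (rule linear_family_derivative[OF openZ z linear_\<Gamma>(1) 0 d(2)])
  have 2: "((\<lambda>z. \<Gamma> z (\<xi> z) (\<eta> z)) has_derivative
      (\<lambda>w. fd (\<lambda>z'. \<Gamma> z' (\<xi> z) (\<eta> z')) z w + \<Gamma> z (fd \<xi> z w) (\<eta> z))) (at z)"
    by (rule linear_family_derivative[OF openZ z linear_\<Gamma>(2) _ d(1)])
      (use 1 in \<open>auto simp: differentiable_def\<close>)
  show ?thesis unfolding fd_eq[OF 2] fd_eq[OF 1] by simp
qed

lemma fd_\<Gamma>_const:
  assumes z: "z \<in> \<Omega>"
  shows "fd (\<lambda>z. \<Gamma> z u v) z w = (1/2 * (fd \<Phi>x z w * (u $ 2 * v $ 3 + u $ 3 * v $ 2) + fd \<Phi>y z w * (u $ 3 * v $ 3))) *\<^sub>R e\<^sub>t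
    - (1/2 * (fd \<Phi>x z w * (u $ 3 * v $ 3))) *\<^sub>R e\<^sub>x"
proof -
  note d = smooth_on_has_derivative[OF smooth_on_fd[OF \<Phi>_smooth] z]
  have "((\<lambda>z. \<Gamma> z u v) has_derivative (\<lambda>w. (1/2 * (fd \<Phi>x z w * (u $ 2 * v $ 3 + u $ 3 * v $ 2) + fd \<Phi>y z w * (u $ 3 * v $ 3))) *\<^sub>R e\<^sub>t
    - (1/2 * (fd \<Phi>x z w * (u $ 3 * v $ 3))) *\<^sub>R e\<^sub>x)) (at z)"
    unfolding \<Gamma>_def
    by (intro has_derivative_diff has_derivative_scaleR_left has_derivative_mult_right has_derivative_add has_derivative_mult_left d)
  from fd_eq[OF this] show ?thesis by simp
qed

lemma coord_tangent_diff:
  assumes "p \<in> chart_dom \<kappa>"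
  shows "coord_tangent A \<kappa> p (u - v) = (\<lambda>h. coord_tangent A \<kappa> p u h - coord_tangent A \<kappa> p v h)"
  using coord_tangent_linear[OF cs assms, of 1 u "-1" v] by simp

text \<open>The curvature tensor of the Walker metric: R(\<partial>x, \<partial>y) sends \<partial>x
  to (\<Phi>xx/2) \<partial>t and \<partial>y to -(\<Phi>xx/2) \<partial>x, and all other components
  vanish up to antisymmetry. In particular \<Phi>xx alone measures the failure of flatness.\<close>

definition curv :: "real^3 \<Rightarrow> real^3 \<Rightarrow> real^3 \<Rightarrow> real^3 \<Rightarrow> real^3"
  where "curv z u v w = (1/2 * \<Phi>xx z * (u $ 2 * v $ 3 - u $ 3 * v $ 2)) *\<^sub>R (w $ 2 *\<^sub>R e\<^sub>t - w $ 3 *\<^sub>R e\<^sub>x)"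

text \<open>Second derivatives of \<zeta> cancel by symmetry, and the bracket term removes the
  derivatives of \<xi> and \<eta>. The products of two Christoffel terms are symmetric in \<xi> and
  \<eta>, so they cancel as well, and antisymmetrising the derivative of \<Gamma> leaves only
  \<Phi>xx.\<close>

lemma curvature_chart:
  assumes X: "represents \<kappa> W X \<xi>" and Y: "represents \<kappa> W Y \<eta>" and Q: "represents \<kappa> W Q \<zeta>" and p: "p \<in> W"
  defines "z \<equiv> chart_map \<kappa> p"
  shows "curvature A g X Y Q p = coord_tangent A \<kappa> p (curv z (\<xi> z) (\<eta> z) (\<zeta> z))"
proof -
  have pd: "p \<in> chart_dom \<kappa>" by (rule representsD(8)[OF X p])
  have z: "z \<in> \<Omega>" using pd by (auto simp: z_def)
  have zW: "z \<in> chart_map \<kappa> ` W" using p by (auto simp: z_def)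
  note oW = representsD(5)[OF X]
  note sX = representsD(6)[OF X] and sY = representsD(6)[OF Y] and sQ = representsD(6)[OF Q]
  have T: "fd (\<lambda>z. fd \<zeta> z (\<eta>' z) + \<Gamma> z (\<eta>' z) (\<zeta> z)) z w
      = fd (\<lambda>z'. fd \<zeta> z' (\<eta>' z)) z w + fd \<zeta> z (fd \<eta>' z w)
        + (fd (\<lambda>z'. \<Gamma> z' (\<eta>' z) (\<zeta> z)) z w + \<Gamma> z (fd \<eta>' z w) (\<zeta> z) + \<Gamma> z (\<eta>' z) (fd \<zeta> z w))"
    if s: "smooth_on (chart_map \<kappa> ` W) \<eta>'" for \<eta>' w
  proof -
    have W: "chart_map \<kappa> ` W \<subseteq> \<Omega>" using representsD(4)[OF X] by auto
    have "((\<lambda>z. fd \<zeta> z (\<eta>' z) + \<Gamma> z (\<eta>' z) (\<zeta> z)) has_derivative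
        (\<lambda>w. fd (\<lambda>z. fd \<zeta> z (\<eta>' z)) z w + fd (\<lambda>z. \<Gamma> z (\<eta>' z) (\<zeta> z)) z w)) (at z)"
      by (intro has_derivative_add smooth_on_has_derivative[OF smooth_on_fd_apply[OF oW sQ s] zW]
          smooth_on_has_derivative[OF \<Gamma>_smooth[OF oW W s sQ] zW])
    from fd_eq[OF this] show ?thesis
      by (simp add: fd_fd_apply[OF oW zW sQ smooth_onD[OF s zW]] fd_\<Gamma>[OF z smooth_onD[OF s zW] smooth_onD[OF sQ zW]])
  qed
  note lin\<zeta> = linear_fd[OF smooth_onD[OF sQ zW]]
  let ?b = "fd \<eta> z (\<xi> z) - fd \<xi> z (\<eta> z)"
  let ?a1 = "fd (\<lambda>z. fd \<zeta> z (\<eta> z) + \<Gamma> z (\<eta> z) (\<zeta> z)) z (\<xi> z) + \<Gamma> z (\<xi> z) (fd \<zeta> z (\<eta> z) + \<Gamma> z (\<eta> z) (\<zeta> z))"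
  let ?a2 = "fd (\<lambda>z. fd \<zeta> z (\<xi> z) + \<Gamma> z (\<xi> z) (\<zeta> z)) z (\<eta> z) + \<Gamma> z (\<eta> z) (fd \<zeta> z (\<xi> z) + \<Gamma> z (\<xi> z) (\<zeta> z))"
  let ?a3 = "fd \<zeta> z ?b + \<Gamma> z ?b (\<zeta> z)"
  have 1: "levi_civita A g X (levi_civita A g Y Q) p = coord_tangent A \<kappa> p ?a1"
    unfolding z_def by (rule representsD(7)[OF represents_levi_civita[OF X represents_levi_civita[OF Y Q]] p])
  have 2: "levi_civita A g Y (levi_civita A g X Q) p = coord_tangent A \<kappa> p ?a2"
    unfolding z_def by (rule representsD(7)[OF represents_levi_civita[OF Y represents_levi_civita[OF X Q]] p])
  have 3: "levi_civita A g (lie_bracket A X Y) Q p = coord_tangent A \<kappa> p ?a3"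
    unfolding z_def by (rule representsD(7)[OF represents_levi_civita[OF represents_bracket[OF X Y] Q] p])
  have "curvature A g X Y Q p = coord_tangent A \<kappa> p (?a1 - ?a2 - ?a3)"
    unfolding curvature_def 1 2 3 coord_tangent_diff[OF pd] ..
  also have "?a1 - ?a2 - ?a3 = fd (\<lambda>z'. \<Gamma> z' (\<eta> z) (\<zeta> z)) z (\<xi> z) - fd (\<lambda>z'. \<Gamma> z' (\<xi> z) (\<zeta> z)) z (\<eta> z)
      + \<Gamma> z (\<xi> z) (\<Gamma> z (\<eta> z) (\<zeta> z)) - \<Gamma> z (\<eta> z) (\<Gamma> z (\<xi> z) (\<zeta> z))"
    unfolding T[OF sX] T[OF sY] linear_diff[OF lin\<zeta>] linear_diff[OF linear_\<Gamma>(2)] linear_add[OF linear_\<Gamma>(1)]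
      fd_fd_commute[OF oW zW sQ, of "\<eta> z" "\<xi> z"]
    by simp
  also have "\<dots> = curv z (\<xi> z) (\<eta> z) (\<zeta> z)"
    unfolding fd_\<Gamma>_const[OF z] fd_fd_\<Phi>[OF z, of "\<xi> z"] fd_fd_\<Phi>[OF z, of "\<eta> z"] curv_def
    by (simp add: vec_eq_iff forall_3) (simp add: algebra_simps)
  finally show ?thesis .
qed

lemma represents_common:
  assumes p: "p \<in> chart_dom \<kappa>" and X: "smooth_vfield_at A p X" and Y: "smooth_vfield_at A p Y"
  obtains W \<xi> \<eta> where "represents \<kappa> W X \<xi>" "represents \<kappa> W Y \<eta>" "p \<in> W"
proof -
  obtain W1 \<xi> where 1: "represents \<kappa> W1 X \<xi>" "p \<in> W1" by (rule smooth_vfield_at_represents[OF X cs p])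
  obtain W2 \<eta> where 2: "represents \<kappa> W2 Y \<eta>" "p \<in> W2" by (rule smooth_vfield_at_represents[OF Y cs p])
  have o: "open (W1 \<inter> W2)" using representsD(3)[OF 1(1)] representsD(3)[OF 2(1)] by (rule open_Int)
  show thesis
    by (rule that[OF represents_subset[OF 1(1) o] represents_subset[OF 2(1) o]]) (use 1 2 in auto)
qed

lemma represents_common3:
  assumes p: "p \<in> chart_dom \<kappa>" and X: "smooth_vfield_at A p X" and Y: "smooth_vfield_at A p Y" and Q: "smooth_vfield_at A p Q"
  obtains W \<xi> \<eta> \<zeta> where "represents \<kappa> W X \<xi>" "represents \<kappa> W Y \<eta>" "represents \<kappa> W Q \<zeta>" "p \<in> W"
proof -
  obtain W1 \<xi> \<eta> where 1: "represents \<kappa> W1 X \<xi>" "represents \<kappa> W1 Y \<eta>" "p \<in> W1" by (rule represents_common[OF p X Y])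
  obtain W2 \<zeta> where 2: "represents \<kappa> W2 Q \<zeta>" "p \<in> W2" by (rule smooth_vfield_at_represents[OF Q cs p])
  have o: "open (W1 \<inter> W2)" using representsD(3)[OF 1(1)] representsD(3)[OF 2(1)] by (rule open_Int)
  show thesis
    by (rule that[OF represents_subset[OF 1(1) o] represents_subset[OF 1(2) o] represents_subset[OF 2(1) o]])
      (use 1 2 in auto)
qed

lemma curvature_zero:
  assumes p: "p \<in> chart_dom \<kappa>" and "\<Phi>xx (chart_map \<kappa> p) = 0"
    and X: "smooth_vfield_at A p X" and Y: "smooth_vfield_at A p Y" and Q: "smooth_vfield_at A p Q"
  shows "curvature A g X Y Q p = (\<lambda>h. 0)"
proof -
  obtain W \<xi> \<eta> \<zeta> where "represents \<kappa> W X \<xi>" "represents \<kappa> W Y \<eta>" "represents \<kappa> W Q \<zeta>" "p \<in> W"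
    by (rule represents_common3[OF p X Y Q])
  from curvature_chart[OF this] show ?thesis
    using assms(2) by (simp add: curv_def coord_tangent_0[OF cs p])
qed

text \<open>The trace is defined in a chart \<mu> picked by choice, which need not be \<kappa>.
  Invariance of the trace is proved only for the map at hand: Z \<mapsto> R(Z, X) Y has the rank-one
  form c(Z) w, so its trace in any basis is c(w). Here \<open>B\<close> and \<open>J\<close> are the
  changes between the two coordinate bases.\<close>

lemma ricci_chart:
  assumes X: "represents \<kappa> W X \<xi>" and Y: "represents \<kappa> W Y \<eta>" and p: "p \<in> W"
  defines "z \<equiv> chart_map \<kappa> p"
  shows "ricci A g X Y p = - (1/2) * \<Phi>xx z * \<xi> z $ 3 * \<eta> z $ 3"
proof -
  have pd: "p \<in> chart_dom \<kappa>" by (rule representsD(8)[OF X p])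
  define \<mu> where "\<mu> = (SOME \<mu>. \<mu> \<in> CS \<and> p \<in> chart_dom \<mu>)"
  have "\<mu> \<in> CS \<and> p \<in> chart_dom \<mu>"
    unfolding \<mu>_def by (rule someI[of _ \<kappa>]) (use cs pd in simp)
  then have \<mu>: "\<mu> \<in> CS" "p \<in> chart_dom \<mu>" by auto
  define B where "B = fd (chart_map \<kappa> \<circ> chart_inv \<mu>) (chart_map \<mu> p)"
  define J where "J = fd (chart_map \<mu> \<circ> chart_inv \<kappa>) (chart_map \<kappa> p)"
  have B: "coord_tangent A \<mu> p v = coord_tangent A \<kappa> p (B v)" for v
    unfolding B_def by (rule coord_tangent_change[OF cs \<mu>(1) pd \<mu>(2)])
  have J: "coord_tangent A \<kappa> p v = coord_tangent A \<mu> p (J v)" for v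
    unfolding J_def by (rule coord_tangent_change[OF \<mu>(1) cs \<mu>(2) pd])
  have BJ: "B (J v) = v" for v
    by (rule coord_tangent_inject[OF cs pd]) (simp only: B[symmetric] J[symmetric])
  have linB: "linear B"
    unfolding B_def using transition_has_derivative[OF cs \<mu>(1) pd \<mu>(2)] by (rule has_derivative_linear)
  define w where "w = \<eta> z $ 2 *\<^sub>R e\<^sub>t - \<eta> z $ 3 *\<^sub>R e\<^sub>x"
  define k where "k = 1/2 * \<Phi>xx z"
  define c where "c = (\<lambda>u::real^3. k * (u $ 2 * \<xi> z $ 3 - u $ 3 * \<xi> z $ 2))"
  have linc: "linear c" unfolding c_def by (intro linearI) (simp_all add: algebra_simps)
  have "curvature A g (coord_field A \<mu> k) X Y p (\<lambda>q. chart_map \<mu> q $ k) = c (B (axis k 1)) * J w $ k" for k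
  proof -
    have F: "smooth_vfield_at A p (coord_field A \<mu> k)"
      unfolding coord_field_def by (rule represents_smooth_vfield_at[OF represents_const[OF \<mu>(1)] \<mu>(2)])
    obtain W' \<zeta> where W': "represents \<kappa> W' (coord_field A \<mu> k) \<zeta>" "p \<in> W'"
      by (rule smooth_vfield_at_represents[OF F cs pd])
    have o: "open (W \<inter> W')" "W \<inter> W' \<subseteq> W" "W \<inter> W' \<subseteq> W'" "p \<in> W \<inter> W'"
      using representsD(3)[OF X] representsD(3)[OF W'(1)] p W'(2) by auto
    have "coord_tangent A \<kappa> p (\<zeta> z) = coord_tangent A \<kappa> p (B (axis k 1))"
      using representsD(7)[OF W'] unfolding coord_field_def B z_def by simp
    then have \<zeta>: "\<zeta> z = B (axis k 1)" by (rule coord_tangent_inject[OF cs pd])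
    have "curvature A g (coord_field A \<mu> k) X Y p = coord_tangent A \<kappa> p (curv z (\<zeta> z) (\<xi> z) (\<eta> z))"
      unfolding z_def
      by (rule curvature_chart[OF represents_subset[OF W'(1) o(1,3)] represents_subset[OF X o(1,2)] represents_subset[OF Y o(1,2)] o(4)])
    also have "curv z (\<zeta> z) (\<xi> z) (\<eta> z) = c (B (axis k 1)) *\<^sub>R w"
      by (simp add: curv_def c_def k_def w_def \<zeta>)
    finally have "curvature A g (coord_field A \<mu> k) X Y p (\<lambda>q. chart_map \<mu> q $ k)
        = coord_tangent A \<kappa> p (c (B (axis k 1)) *\<^sub>R w) (\<lambda>q. chart_map \<mu> q $ k)" by simp
    also have "coord_tangent A \<kappa> p (c (B (axis k 1)) *\<^sub>R w) (\<lambda>q. chart_map \<mu> q $ k)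
        = c (B (axis k 1)) * coord_tangent A \<kappa> p w (\<lambda>q. chart_map \<mu> q $ k)"
      using coord_tangent_linear[OF cs pd, of "c (B (axis k 1))" w 0 0] by simp
    also have "coord_tangent A \<kappa> p w (\<lambda>q. chart_map \<mu> q $ k) = J w $ k"
      unfolding J by (rule coord_tangent_coordinate[OF \<mu>])
    finally show ?thesis .
  qed
  then have "ricci A g X Y p = (\<Sum>k\<in>UNIV. c (B (axis k 1)) * J w $ k)"
    by (simp add: ricci_def Let_def \<mu>_def)
  \<comment> \<open>The sum over k is the expansion of the linear form c o B at the vector
    \<open>J w\<close>, and \<open>B\<close> undoes \<open>J\<close>.\<close>
  also have "\<dots> = c (B (J w))"
    using linear_expand3[OF linear_compose[OF linB linc], of "J w"] by (simp add: sum_3 o_def mult.commute)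
  also have "\<dots> = - (1/2) * \<Phi>xx z * \<xi> z $ 3 * \<eta> z $ 3"
    by (simp add: BJ) (simp add: c_def k_def w_def)
  finally show ?thesis .
qed

section \<open>The Hessian, the gradient and the soliton equation in a Walker chart\<close>

context
  fixes f :: "'a \<Rightarrow> real"
  assumes f: "smooth_fun_on A UNIV f"
begin

definition F :: "real^3 \<Rightarrow> real" where "F = f \<circ> chart_inv \<kappa>"

lemma F_smooth: "smooth_on \<Omega> F"
  unfolding F_def by (rule smooth_fun_onD[OF f cs]) simp

lemma f_at: "smooth_fun_at A p f"
  by (rule smooth_fun_atI[OF f]) auto

text \<open>The derivatives of the components \<eta> occur in both terms of the Hessian and cancel,
  so it depends only on the values of the two fields at the point.\<close>

lemma hessian_chart:
  assumes X: "represents \<kappa> W X \<xi>" and Y: "represents \<kappa> W Y \<eta>" and p: "p \<in> W"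
  defines "z \<equiv> chart_map \<kappa> p"
  shows "hessian A g f X Y p = fd (\<lambda>z'. fd F z' (\<eta> z)) z (\<xi> z) - fd F z (\<Gamma> z (\<xi> z) (\<eta> z))"
proof -
  note rX = representsD[OF X]
  have zW: "z \<in> chart_map \<kappa> ` W" using p by (auto simp: z_def)
  have W: "chart_map \<kappa> ` W \<subseteq> \<Omega>" using rX(4) by auto
  note sF = smooth_on_subset[OF F_smooth W]
  have "smooth_fun_on A W (\<lambda>q. Y q f)"
    by (rule represents_smooth_apply[OF Y rX(3) order_refl smooth_fun_on_subset[OF f]]) simp
  from represents_apply[OF X p smooth_fun_atI[OF this rX(3) p]]
  have "X p (\<lambda>q. Y q f) = fd ((\<lambda>q. Y q f) \<circ> chart_inv \<kappa>) z (\<xi> z)" by (simp add: z_def)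
  also have "fd ((\<lambda>q. Y q f) \<circ> chart_inv \<kappa>) z = fd (\<lambda>z. fd F z (\<eta> z)) z"
    by (rule fd_cong[OF rX(5) zW])
      (use inv_map'[OF rX(4)] represents_apply[OF Y _ f_at] in \<open>auto simp: F_def\<close>)
  also have "fd (\<lambda>z. fd F z (\<eta> z)) z (\<xi> z) = fd (\<lambda>z'. fd F z' (\<eta> z)) z (\<xi> z) + fd F z (fd \<eta> z (\<xi> z))"
    by (rule fd_fd_apply[OF rX(5) zW sF smooth_onD[OF representsD(6)[OF Y] zW]])
  moreover have "levi_civita A g X Y p f = fd F z (fd \<eta> z (\<xi> z) + \<Gamma> z (\<xi> z) (\<eta> z))"
    using represents_apply[OF represents_levi_civita[OF X Y] p f_at] by (simp add: F_def z_def)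
  ultimately show ?thesis
    unfolding hessian_def by (simp add: linear_add[OF linear_fd[OF smooth_onD[OF sF zW]]])
qed

definition soliton_eq :: "real \<Rightarrow> real^3 \<Rightarrow> real^3 \<Rightarrow> real^3 \<Rightarrow> bool"
  where "soliton_eq l z u v \<longleftrightarrow> fd (\<lambda>z'. fd F z' v) z u - fd F z (\<Gamma> z u v) - 1/2 * \<Phi>xx z * u $ 3 * v $ 3 = l * G \<kappa> z u v"

text \<open>All three tensors depend only on the values of the fields at p, and every pair of
  vectors is attained by constant coordinate fields. The quantifier over fields thus becomes one
  over vectors.\<close>

lemma soliton_chart:
  assumes p: "p \<in> chart_dom \<kappa>"
  shows "(\<forall>X Y. smooth_vfield_at A p X \<longrightarrow> smooth_vfield_at A p Y \<longrightarrow>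
       hessian A g f X Y p + ricci A g X Y p = l * g p (X p) (Y p)) \<longleftrightarrow> (\<forall>u v. soliton_eq l (chart_map \<kappa> p) u v)"
proof -
  let ?z = "chart_map \<kappa> p"
  have *: "hessian A g f X Y p + ricci A g X Y p = l * g p (X p) (Y p) \<longleftrightarrow> soliton_eq l ?z (\<xi> ?z) (\<eta> ?z)"
    if "represents \<kappa> W X \<xi>" "represents \<kappa> W Y \<eta>" "p \<in> W" for W X Y \<xi> \<eta>
    unfolding soliton_eq_def hessian_chart[OF that] ricci_chart[OF that]
      representsD(7)[OF that(1,3)] representsD(7)[OF that(2,3)] G_chart_map[OF cs p]
    by simp
  show ?thesis
  proof (intro iffI allI impI)
    fix u v assume L: "\<forall>X Y. smooth_vfield_at A p X \<longrightarrow> smooth_vfield_at A p Y \<longrightarrow>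
       hessian A g f X Y p + ricci A g X Y p = l * g p (X p) (Y p)"
    note c = represents_const[OF cs]
    show "soliton_eq l ?z u v"
      using L[rule_format, OF represents_smooth_vfield_at[OF c p] represents_smooth_vfield_at[OF c p]]
        *[OF c c p, of u v] by simp
  next
    fix X Y assume R: "\<forall>u v. soliton_eq l ?z u v" and X: "smooth_vfield_at A p X" and Y: "smooth_vfield_at A p Y"
    obtain W \<xi> \<eta> where r: "represents \<kappa> W X \<xi>" "represents \<kappa> W Y \<eta>" "p \<in> W" by (rule represents_common[OF p X Y])
    show "hessian A g f X Y p + ricci A g X Y p = l * g p (X p) (Y p)"
      unfolding *[OF r] using R by simp
  qed
qed

text \<open>The inverse Walker metric has the entries -\<Phi> at (t, t), 1 at (t, y) and 1 at (x,
  x); this raises the index of df.\<close>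

lemma gradient_chart:
  assumes p: "p \<in> chart_dom \<kappa>"
  defines "z \<equiv> chart_map \<kappa> p"
  shows "gradient A g f p = coord_tangent A \<kappa> p ((fd F z e\<^sub>y - \<Phi> z * fd F z e\<^sub>t) *\<^sub>R e\<^sub>t + fd F z e\<^sub>x *\<^sub>R e\<^sub>x + fd F z e\<^sub>t *\<^sub>R e\<^sub>y)"
    (is "_ = coord_tangent A \<kappa> p ?d")
  unfolding gradient_def
proof (rule the_equality)
  have z: "z \<in> \<Omega>" using p by (auto simp: z_def)
  have ap: "coord_tangent A \<kappa> p e f = fd F z e" for e
    using coord_tangent_apply[OF f_at] by (simp add: F_def z_def)
  have G: "G \<kappa> z ?d e = fd F z e" for e
    using linear_expand3[OF linear_fd[OF smooth_onD[OF F_smooth z]], of e]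
    unfolding G_walker[OF z] by (simp add: algebra_simps)
  show "coord_tangent A \<kappa> p ?d \<in> tangent_space A p \<and> (\<forall>E\<in>tangent_space A p. g p (coord_tangent A \<kappa> p ?d) E = E f)"
    using G ap G_chart_map[OF cs p] unfolding tangent_space_eq[OF cs p] z_def by auto
  fix D assume D: "D \<in> tangent_space A p \<and> (\<forall>E\<in>tangent_space A p. g p D E = E f)"
  then obtain d where d: "D = coord_tangent A \<kappa> p d" unfolding tangent_space_eq[OF cs p] by auto
  have "d - ?d = 0"
  proof (rule G_nondegenerate[OF cs z])
    fix w
    have "G \<kappa> z d w = fd F z w"
      using conjunct2[OF D, rule_format, OF coord_tangent_in[OF cs p, of w]]
      unfolding d ap z_def G_chart_map[OF cs p] by (simp add: z_def)
    then show "G \<kappa> z (d - ?d) w = 0" by (simp only: linear_diff[OF G_linear_left[OF cs z]] G)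
  qed
  then show "D = coord_tangent A \<kappa> p ?d" by (simp add: d)
qed

end

end

section \<open>Existence of Walker coordinates\<close>

lemma fd_nth:
  fixes f :: "'e::real_normed_vector \<Rightarrow> real^'n"
  assumes "f differentiable (at x)"
  shows "fd (\<lambda>z. f z $ i) x v = fd f x v $ i"
  using fd_eq[OF bounded_linear.has_derivative[OF bounded_linear_vec_nth has_derivative_fd[OF assms]]] by simp

lemma fd_mult:
  fixes f g :: "'e::real_normed_vector \<Rightarrow> real"
  assumes "f differentiable (at x)" "g differentiable (at x)"
  shows "fd (\<lambda>z. f z * g z) x v = f x * fd g x v + fd f x v * g x"
  using fd_eq[OF has_derivative_mult[OF has_derivative_fd[OF assms(1)] has_derivative_fd[OF assms(2)]]] by simp

lemma fd_fun_cong: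
  assumes "open S" "x \<in> S" "\<And>y. y \<in> S \<Longrightarrow> f y = g y"
  shows "fd f x v = fd g x v"
  using fd_cong[OF assms] by simp

lemma constant_along:
  fixes f :: "'e::euclidean_space \<Rightarrow> real"
  assumes f: "\<And>z. z \<in> S \<Longrightarrow> f differentiable (at z)" and S: "convex S"
    and 0: "\<And>z. z \<in> S \<Longrightarrow> fd f z v = 0" and z: "z \<in> S" "z + h *\<^sub>R v \<in> S"
  shows "f (z + h *\<^sub>R v) = f z"
proof -
  have in_S: "z + (s * h) *\<^sub>R v \<in> S" if "0 \<le> s" "s \<le> 1" for s
  proof -
    have "(1 - s) *\<^sub>R z + s *\<^sub>R (z + h *\<^sub>R v) \<in> S"
      by (rule convexD[OF S z]) (use that in auto)
    then show ?thesis by (simp add: algebra_simps)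
  qed
  have "((\<lambda>s. f (z + (s * h) *\<^sub>R v)) has_derivative (\<lambda>k. fd f (z + (s * h) *\<^sub>R v) ((k * h) *\<^sub>R v))) (at s within {0..1})"
    if "0 \<le> s" "s \<le> 1" for s
  proof (rule has_derivative_compose[where f="\<lambda>s. z + (s * h) *\<^sub>R v" and g=f])
    show "((\<lambda>s. z + (s * h) *\<^sub>R v) has_derivative (\<lambda>k. (k * h) *\<^sub>R v)) (at s within {0..1})"
      by (auto intro!: derivative_eq_intros)
    show "(f has_derivative fd f (z + (s * h) *\<^sub>R v)) (at (z + (s * h) *\<^sub>R v))"
      by (rule has_derivative_fd[OF f[OF in_S[OF that]]])
  qed
  from mvt_simple[OF zero_less_one this]
  obtain s where s: "s \<in> {0<..<1}" "f (z + h *\<^sub>R v) - f z = fd f (z + (s * h) *\<^sub>R v) (h *\<^sub>R v)"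
    by auto
  have in_s: "z + (s * h) *\<^sub>R v \<in> S" using s by (intro in_S) auto
  show ?thesis using s(2) linear_scale[OF linear_fd[OF f[OF in_s]]] 0[OF in_s] by simp
qed

section \<open>New charts from local diffeomorphisms\<close>

context smooth_manifold
begin

text \<open>The inverse function theorem makes \<Psi> a diffeomorphism near the point. The domain is
  then cut down until the image is a ball, the shape needed for potentials and for moving points
  along coordinate directions.\<close>

lemma new_chart:
  fixes \<kappa> :: "('a, 'n) chart" and \<Psi> :: "real^'n \<Rightarrow> real^'n"
  assumes cs: "\<kappa> \<in> CS" and p: "p \<in> chart_dom \<kappa>" "chart_map \<kappa> p \<in> U"
    and U: "open U" and \<Psi>: "smooth_on U \<Psi>"
    and inj: "\<And>v. fd \<Psi> (chart_map \<kappa> p) v = 0 \<Longrightarrow> v = 0"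
  obtains \<mu> r where "\<mu> \<in> CS" "p \<in> chart_dom \<mu>" "chart_dom \<mu> \<subseteq> chart_dom \<kappa>"
    "chart_map \<kappa> ` chart_dom \<mu> \<subseteq> U" "\<And>q. chart_map \<mu> q = \<Psi> (chart_map \<kappa> q)"
    "r > 0" "chart_map \<mu> ` chart_dom \<mu> = ball (chart_map \<mu> p) r"
proof -
  interpret k: chart \<kappa> by (rule cs_chart[OF cs])
  let ?Z = "chart_map \<kappa> ` chart_dom \<kappa>"
  let ?z = "chart_map \<kappa> p"
  have oU: "open (U \<inter> ?Z)" using U k.open_image_dom by blast
  have zU: "?z \<in> U \<inter> ?Z" using p by auto
  obtain U' V h where 1: "open U'" "U' \<subseteq> U \<inter> ?Z" "?z \<in> U'" "open V" "homeomorphism U' V \<Psi> h" "smooth_on V h"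
    by (rule smooth_inverse_function[OF oU zU smooth_on_subset[OF \<Psi>] inj]) auto
  have hV: "h y \<in> U'" "\<Psi> (h y) = y" if "y \<in> V" for y using 1(5) that by (auto simp: homeomorphism_def)
  have \<Psi>U: "\<Psi> z \<in> V" "h (\<Psi> z) = z" if "z \<in> U'" for z using 1(5) that by (auto simp: homeomorphism_def)
  obtain r where r: "r > 0" "ball (\<Psi> ?z) r \<subseteq> V" using 1(4) \<Psi>U(1)[OF 1(3)] open_contains_ball by blast
  let ?B = "ball (\<Psi> ?z) r"
  define M where "M = {q \<in> chart_dom \<kappa>. chart_map \<kappa> q \<in> U' \<inter> \<Psi> -` ?B}"
  define \<mu> :: "('a, 'n) chart" where "\<mu> = (M, \<lambda>q. \<Psi> (chart_map \<kappa> q))"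
  have \<mu>s: "chart_dom \<mu> = M" "chart_map \<mu> = (\<lambda>q. \<Psi> (chart_map \<kappa> q))" by (simp_all add: \<mu>_def)
  have c\<Psi>: "continuous_on U' \<Psi>" "continuous_on V h" using 1(5) by (auto simp: homeomorphism_def)
  have "open (U' \<inter> \<Psi> -` ?B)"
    using continuous_open_preimage[OF c\<Psi>(1) 1(1) open_ball] by simp
  then have oM: "open M" unfolding M_def by (rule k.open_vimage)
  have MK: "M \<subseteq> chart_dom \<kappa>" "chart_map \<kappa> ` M \<subseteq> U'" by (auto simp: M_def)
  have MU: "chart_map \<kappa> q \<in> U" if "q \<in> M" for q
    using imageI[OF that, of "chart_map \<kappa>"] MK(2) 1(2) by blast
  have inv: "chart_inv \<kappa> (h y) \<in> M" "\<Psi> (chart_map \<kappa> (chart_inv \<kappa> (h y))) = y" if "y \<in> ?B" for y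
  proof -
    have y: "y \<in> V" using that r by auto
    obtain q where q: "q \<in> chart_dom \<kappa>" "h y = chart_map \<kappa> q" using hV(1)[OF y] 1(2) by auto
    then show "\<Psi> (chart_map \<kappa> (chart_inv \<kappa> (h y))) = y" using hV[OF y] by simp
    then show "chart_inv \<kappa> (h y) \<in> M" using q hV[OF y] that by (simp add: M_def)
  qed
  have img: "chart_map \<mu> ` M = ?B"
  proof
    show "chart_map \<mu> ` M \<subseteq> ?B" by (auto simp: \<mu>s M_def)
    show "?B \<subseteq> chart_map \<mu> ` M" using inv by (metis \<mu>s(2) image_eqI subsetI)
  qed
  have injM: "inj_on (chart_map \<mu>) M"
  proof (rule inj_onI)
    fix a b assume ab: "a \<in> M" "b \<in> M" "chart_map \<mu> a = chart_map \<mu> b"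
    then have "chart_map \<kappa> a = chart_map \<kappa> b" using \<Psi>U(2) unfolding \<mu>s M_def
      by (metis (no_types, lifting) IntD1 mem_Collect_eq)
    then show "a = b" using ab MK(1) by (metis k.inv_map subsetD)
  qed
  have inv_eq: "chart_inv \<mu> y = chart_inv \<kappa> (h y)" if "y \<in> ?B" for y
  proof -
    have "chart_inv \<mu> (chart_map \<mu> (chart_inv \<kappa> (h y))) = chart_inv \<kappa> (h y)"
      by (rule chart_inv_eq) (use injM inv(1)[OF that] in \<open>simp_all add: \<mu>s(1)\<close>)
    then show ?thesis using inv(2)[OF that] by (simp add: \<mu>s(2))
  qed
  have "homeomorphism M ?B (chart_map \<mu>) (chart_inv \<mu>)"
    unfolding homeomorphism_def
  proof (intro conjI ballI)
    show "continuous_on M (chart_map \<mu>)" unfolding \<mu>s(2)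
      by (rule continuous_on_compose2[OF c\<Psi>(1) continuous_on_subset[OF _ MK(1)] MK(2)])
        (use k.homeo in \<open>simp add: homeomorphism_def\<close>)
    have ck: "continuous_on ?Z (chart_inv \<kappa>)" using k.homeo by (simp add: homeomorphism_def)
    have hZ: "h ` ?B \<subseteq> ?Z" using hV(1) r(2) 1(2) by (meson Int_iff image_subsetI subsetD)
    have "continuous_on ?B (\<lambda>y. chart_inv \<kappa> (h y))"
      by (rule continuous_on_compose2[OF ck continuous_on_subset[OF c\<Psi>(2) r(2)] hZ])
    then show "continuous_on ?B (chart_inv \<mu>)"
      by (rule continuous_on_eq) (simp add: inv_eq)
    show "chart_map \<mu> ` M = ?B" by (rule img)
    show inv1: "chart_inv \<mu> (chart_map \<mu> q) = q" if "q \<in> M" for q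
      by (rule chart_inv_eq) (use injM that in \<open>simp_all add: \<mu>s(1)\<close>)
    show "chart_inv \<mu> ` ?B = M" unfolding img[symmetric] image_image using inv1 by simp
    show "chart_map \<mu> (chart_inv \<mu> y) = y" if "y \<in> ?B" for y
      using inv_eq[OF that] inv(2)[OF that] by (simp add: \<mu>s(2))
  qed
  then have is_chart: "is_chart \<mu>" unfolding is_chart_def \<mu>s(1) img using oM by simp
  interpret m: chart \<mu> by unfold_locales (rule is_chart)
  have compat: "smoothly_compatible \<mu> \<nu>" if "\<nu> \<in> A" for \<nu>
  proof -
    have \<nu>: "\<nu> \<in> CS" using that atlas_cs by blast
    interpret n: chart \<nu> by (rule cs_chart[OF \<nu>])
    let ?I = "M \<inter> chart_dom \<nu>"
    have oI: "open ?I" using oM n.open_dom by blast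
    have "smooth_on (chart_map \<mu> ` ?I) (chart_map \<nu> \<circ> chart_inv \<mu>)"
    proof (rule smooth_on_cong)
      show "open (chart_map \<mu> ` ?I)" by (rule m.open_image[OF oI]) (simp add: \<mu>s(1))
      have "smooth_on (chart_map \<kappa> ` ?I) (chart_map \<nu> \<circ> chart_inv \<kappa>)"
        by (rule smooth_on_subset[OF transition_smooth[OF cs \<nu>]]) (use MK in auto)
      then show "smooth_on (chart_map \<mu> ` ?I) (\<lambda>y. (chart_map \<nu> \<circ> chart_inv \<kappa>) (h y))"
      proof (rule smooth_on_compose[OF _ \<open>open (chart_map \<mu> ` ?I)\<close>])
        show "open (chart_map \<kappa> ` ?I)" by (rule k.open_image[OF oI]) (use MK in auto)
        show "smooth_on (chart_map \<mu> ` ?I) h"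
          by (rule smooth_on_subset[OF 1(6)]) (use img r in auto)
        show "h y \<in> chart_map \<kappa> ` ?I" if y: "y \<in> chart_map \<mu> ` ?I" for y
        proof -
          obtain q where q: "q \<in> ?I" "y = \<Psi> (chart_map \<kappa> q)" using y by (auto simp: \<mu>s(2))
          then have "h y = chart_map \<kappa> q" using \<Psi>U(2) MK(2) by auto
          then show ?thesis using q by auto
        qed
      qed
      show "(chart_map \<nu> \<circ> chart_inv \<kappa>) (h y) = (chart_map \<nu> \<circ> chart_inv \<mu>) y" if "y \<in> chart_map \<mu> ` ?I" for y
      proof -
        have "y \<in> ?B" using that img by blast
        from inv_eq[OF this] show ?thesis by simp
      qed
    qed
    moreover have "smooth_on (chart_map \<nu> ` ?I) (chart_map \<mu> \<circ> chart_inv \<nu>)"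
    proof (rule smooth_on_cong)
      show o: "open (chart_map \<nu> ` ?I)" by (rule n.open_image[OF oI]) auto
      show "smooth_on (chart_map \<nu> ` ?I) (\<lambda>y. \<Psi> ((chart_map \<kappa> \<circ> chart_inv \<nu>) y))"
      proof (rule smooth_on_compose[OF \<Psi> o U])
        show "smooth_on (chart_map \<nu> ` ?I) (chart_map \<kappa> \<circ> chart_inv \<nu>)"
          by (rule smooth_on_subset[OF transition_smooth[OF \<nu> cs]]) (use MK in auto)
        show "(chart_map \<kappa> \<circ> chart_inv \<nu>) y \<in> U" if "y \<in> chart_map \<nu> ` ?I" for y
          using that MU by auto
      qed
    qed (simp add: \<mu>s(2))
    ultimately show ?thesis unfolding smoothly_compatible_def \<mu>s(1) by simp
  qed
  show thesis
  proof (rule that[of \<mu> r])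
    show "\<mu> \<in> CS" using is_chart compat by (simp add: coordinate_systems_def)
    show "p \<in> chart_dom \<mu>" using p 1(3) r(1) by (simp add: \<mu>s(1) M_def)
    show "chart_map \<kappa> ` chart_dom \<mu> \<subseteq> U" using MU by (auto simp: \<mu>s(1))
    show "chart_map \<mu> ` chart_dom \<mu> = ball (chart_map \<mu> p) r" unfolding \<mu>s(1) img by (simp add: \<mu>s(2))
  qed (use MK(1) r(1) in \<open>simp_all add: \<mu>s\<close>)
qed

lemma coord_tangent_new_coordinate:
  assumes cs: "\<kappa> \<in> CS" and \<mu>: "\<mu> \<in> CS" and q: "q \<in> chart_dom \<mu>" and sub: "chart_dom \<mu> \<subseteq> chart_dom \<kappa>"
    and map: "\<And>q. q \<in> chart_dom \<mu> \<Longrightarrow> chart_map \<mu> q = \<Psi> (chart_map \<kappa> q)"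
    and \<Psi>: "\<Psi> differentiable (at (chart_map \<kappa> q))"
  shows "coord_tangent A \<kappa> q v (\<lambda>q. chart_map \<mu> q $ i) = fd \<Psi> (chart_map \<kappa> q) v $ i"
proof -
  interpret k: chart \<kappa> by (rule cs_chart[OF cs])
  interpret m: chart \<mu> by (rule cs_chart[OF \<mu>])
  have "fd ((\<lambda>q. chart_map \<mu> q $ i) \<circ> chart_inv \<kappa>) (chart_map \<kappa> q) v = fd (\<lambda>z. \<Psi> z $ i) (chart_map \<kappa> q) v"
    by (rule fd_fun_cong[OF k.open_image[OF m.open_dom sub]]) (use q k.inv_map'[OF sub] map in auto)
  then show ?thesis
    using coord_tangent_apply[OF smooth_fun_atI[OF coordinate_smooth[OF \<mu>] m.open_dom q]] fd_nth[OF \<Psi>] by simp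
qed

end

section \<open>The parallel null field and charts adapted to it\<close>

locale parallel_null = lorentz3 A g
  for A :: "('a::topological_space, 3) chart set" and g :: "'a metric_field" +
  fixes V :: "'a vfield"
  assumes V_smooth: "smooth_vfield_on A UNIV V"
    and V_nonzero: "V p \<noteq> (\<lambda>h. 0)"
    and V_null: "g p (V p) (V p) = 0"
    and V_parallel: "smooth_vfield_at A p X \<Longrightarrow> levi_civita A g X V p = (\<lambda>h. 0)"
begin

definition \<eta> :: "('a, 3) chart \<Rightarrow> real^3 \<Rightarrow> real^3"
  where "\<eta> \<kappa> z = (\<chi> i. V (chart_inv \<kappa> z) (\<lambda>q. chart_map \<kappa> q $ i))"

context
  fixes \<kappa> assumes cs: "\<kappa> \<in> CS"
begin

interpretation chart \<kappa> by (rule cs_chart[OF cs])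

abbreviation "\<Omega> \<equiv> chart_map \<kappa> ` chart_dom \<kappa>"

lemma represents_V: "represents \<kappa> (chart_dom \<kappa>) V (\<eta> \<kappa>)"
  using smooth_vfield_represents[OF V_smooth open_UNIV cs] by (simp add: \<eta>_def[abs_def])

lemma \<eta>_smooth: "smooth_on \<Omega> (\<eta> \<kappa>)"
  by (rule representsD(6)[OF represents_V])

lemma V_eq: "p \<in> chart_dom \<kappa> \<Longrightarrow> V p = coord_tangent A \<kappa> p (\<eta> \<kappa> (chart_map \<kappa> p))"
  by (rule representsD(7)[OF represents_V])

lemma \<eta>_nonzero: "z \<in> \<Omega> \<Longrightarrow> \<eta> \<kappa> z \<noteq> 0"
proof
  assume "z \<in> \<Omega>" "\<eta> \<kappa> z = 0"
  then obtain p where p: "p \<in> chart_dom \<kappa>" "\<eta> \<kappa> (chart_map \<kappa> p) = 0" by auto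
  show False using V_eq[OF p(1)] coord_tangent_0[OF cs p(1)] V_nonzero[of p] unfolding p(2) by simp
qed

lemma \<eta>_null: "z \<in> \<Omega> \<Longrightarrow> G \<kappa> z (\<eta> \<kappa> z) (\<eta> \<kappa> z) = 0"
proof -
  assume "z \<in> \<Omega>"
  then obtain p where p: "p \<in> chart_dom \<kappa>" "z = chart_map \<kappa> p" by auto
  show ?thesis unfolding p(2) G_chart_map[OF cs p(1)] V_eq[OF p(1), symmetric] by (rule V_null)
qed

lemma \<eta>_parallel:
  "z \<in> \<Omega> \<Longrightarrow> 2 * G \<kappa> z (fd (\<eta> \<kappa>) z u) w + dG \<kappa> z u (\<eta> \<kappa> z) w + dG \<kappa> z (\<eta> \<kappa> z) u w - dG \<kappa> z w u (\<eta> \<kappa> z) = 0"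
proof (erule imageE)
  fix p assume p: "z = chart_map \<kappa> p" "p \<in> chart_dom \<kappa>"
  show "2 * G \<kappa> z (fd (\<eta> \<kappa>) z u) w + dG \<kappa> z u (\<eta> \<kappa> z) w + dG \<kappa> z (\<eta> \<kappa> z) u w - dG \<kappa> z w u (\<eta> \<kappa> z) = 0"
    unfolding p(1) by (rule parallel_chart[OF cs represents_V p(2) V_parallel])
qed

text \<open>The Koszul identities for (u, w) and (w, u) are added; the metric derivatives in the
  directions u and w then cancel. Their difference gives \<open>\<eta>_closed\<close>.\<close>

lemma \<eta>_killing:
  assumes z: "z \<in> \<Omega>"
  shows "G \<kappa> z (fd (\<eta> \<kappa>) z u) w + G \<kappa> z (fd (\<eta> \<kappa>) z w) u + dG \<kappa> z (\<eta> \<kappa> z) u w = 0"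
  using \<eta>_parallel[OF z, of u w] \<eta>_parallel[OF z, of w u]
    dG_sym[OF cs z, of "\<eta> \<kappa> z" w u] dG_sym[OF cs z, of "\<eta> \<kappa> z" u w] dG_sym[OF cs z, of u w "\<eta> \<kappa> z"]
  by linarith

lemma \<eta>_closed:
  assumes z: "z \<in> \<Omega>"
  shows "G \<kappa> z (fd (\<eta> \<kappa>) z u) w + dG \<kappa> z u (\<eta> \<kappa> z) w = G \<kappa> z (fd (\<eta> \<kappa>) z w) u + dG \<kappa> z w (\<eta> \<kappa> z) u"
  using \<eta>_parallel[OF z, of u w] \<eta>_parallel[OF z, of w u]
    dG_sym[OF cs z, of "\<eta> \<kappa> z" w u] dG_sym[OF cs z, of "\<eta> \<kappa> z" u w] dG_sym[OF cs z, of u w "\<eta> \<kappa> z"]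
  by linarith

text \<open>A nonzero null vector has a nonzero timelike component, as otherwise its square would be
  a positive sum of squares. Subtracting a multiple of it removes the timelike component of v
  without changing G v v, since it is null and orthogonal to v. What is left is a sum of squares,
  zero only if v is that multiple.\<close>

lemma \<eta>_orthogonal_pos:
  assumes z: "z \<in> \<Omega>" and orth: "G \<kappa> z (\<eta> \<kappa> z) v = 0" and indep: "\<And>c. v \<noteq> c *\<^sub>R \<eta> \<kappa> z"
  shows "G \<kappa> z v v > 0"
proof -
  obtain p where p: "p \<in> chart_dom \<kappa>" "z = chart_map \<kappa> p" using z by auto
  let ?n = "\<eta> \<kappa> z"
  show ?thesis
  proof (rule orthonormal_frame[OF cs p(1), folded p(2)])
    fix e :: "3 \<Rightarrow> real^3" and i0
    assume e: "\<And>i j. G \<kappa> z (e i) (e j) = (if i \<noteq> j then 0 else if i = i0 then -1 else 1)"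
      "\<And>u. \<exists>c. u = (\<Sum>i\<in>UNIV. c i *\<^sub>R e i)"
    have GG: "G \<kappa> z (\<Sum>i\<in>UNIV. c i *\<^sub>R e i) (\<Sum>i\<in>UNIV. c i *\<^sub>R e i)
        = (\<Sum>i\<in>UNIV. (c i)\<^sup>2 * (if i = i0 then -1 else 1))" for c
    proof -
      have "G \<kappa> z (\<Sum>i\<in>UNIV. c i *\<^sub>R e i) (\<Sum>i\<in>UNIV. c i *\<^sub>R e i)
          = (\<Sum>i\<in>UNIV. c i *\<^sub>R (\<Sum>j\<in>UNIV. c j *\<^sub>R G \<kappa> z (e i) (e j)))"
        by (simp only: linear_sum[OF G_linear_left[OF cs z]] linear_scale[OF G_linear_left[OF cs z]])
          (simp only: linear_sum[OF G_linear_right[OF cs z]] linear_scale[OF G_linear_right[OF cs z]])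
      also have "\<dots> = (\<Sum>i\<in>UNIV. (c i)\<^sup>2 * (if i = i0 then -1 else 1))"
      proof (rule sum.cong[OF refl])
        fix i
        have "(\<Sum>j\<in>UNIV. c j *\<^sub>R G \<kappa> z (e i) (e j)) = (\<Sum>j\<in>UNIV. if j = i then c i * (if i = i0 then -1 else 1) else 0)"
          by (rule sum.cong) (auto simp: e(1))
        then show "c i *\<^sub>R (\<Sum>j\<in>UNIV. c j *\<^sub>R G \<kappa> z (e i) (e j)) = (c i)\<^sup>2 * (if i = i0 then -1 else 1)"
          by (simp add: power2_eq_square)
      qed
      finally show ?thesis .
    qed
    obtain c where c: "?n = (\<Sum>i\<in>UNIV. c i *\<^sub>R e i)" using e(2) by blast
    have c0: "c i0 \<noteq> 0"
    proof
      assume 0: "c i0 = 0"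
      have "(\<Sum>i\<in>UNIV. (c i)\<^sup>2) = (\<Sum>i\<in>UNIV. (c i)\<^sup>2 * (if i = i0 then -1 else 1))"
        by (rule sum.cong) (auto simp: 0)
      also have "\<dots> = 0" using \<eta>_null[OF z] GG[of c] unfolding c by simp
      finally have "c i = 0" for i by (simp add: sum_nonneg_eq_0_iff)
      then show False using \<eta>_nonzero[OF z] unfolding c by simp
    qed
    obtain d where d: "v = (\<Sum>i\<in>UNIV. d i *\<^sub>R e i)" using e(2) by blast
    define k where "k = d i0 / c i0"
    define b where "b = (\<lambda>i. d i - k * c i)"
    have b0: "b i0 = 0" using c0 by (simp add: b_def k_def)
    have vb: "v - k *\<^sub>R ?n = (\<Sum>i\<in>UNIV. b i *\<^sub>R e i)"
      unfolding c d b_def by (simp add: scaleR_left_diff_distrib sum_subtractf scaleR_sum_right)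
    have "G \<kappa> z (v - k *\<^sub>R ?n) (v - k *\<^sub>R ?n) = G \<kappa> z v v"
      unfolding linear_diff[OF G_linear_left[OF cs z]] linear_diff[OF G_linear_right[OF cs z]]
        linear_scale[OF G_linear_left[OF cs z]] linear_scale[OF G_linear_right[OF cs z]]
      using orth G_sym[OF cs z, of v ?n] \<eta>_null[OF z] by simp
    then have "G \<kappa> z v v = (\<Sum>i\<in>UNIV. (b i)\<^sup>2 * (if i = i0 then -1 else 1))"
      unfolding vb GG by simp
    also have "\<dots> = (\<Sum>i\<in>UNIV. (b i)\<^sup>2)" by (rule sum.cong) (auto simp: b0)
    finally have Gv: "G \<kappa> z v v = (\<Sum>i\<in>UNIV. (b i)\<^sup>2)" .
    have "\<exists>i. b i \<noteq> 0"
    proof (rule ccontr)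
      assume "\<not> (\<exists>i. b i \<noteq> 0)"
      then have "v - k *\<^sub>R ?n = 0" unfolding vb by simp
      then show False using indep[of k] by simp
    qed
    then have "(\<Sum>i\<in>UNIV. (b i)\<^sup>2) \<noteq> 0" by (simp add: sum_nonneg_eq_0_iff)
    moreover have "(\<Sum>i\<in>UNIV. (b i)\<^sup>2) \<ge> 0" by (simp add: sum_nonneg)
    ultimately show ?thesis using Gv by simp
  qed
qed

end

lemma ball_in_image:
  assumes "\<kappa> \<in> CS" "p \<in> chart_dom \<kappa>"
  obtains r where "r > 0" "ball (chart_map \<kappa> p) r \<subseteq> chart_map \<kappa> ` chart_dom \<kappa>"
proof -
  interpret chart \<kappa> by (rule cs_chart[OF assms(1)])
  have "chart_map \<kappa> p \<in> chart_map \<kappa> ` chart_dom \<kappa>" using assms(2) by simp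
  then show thesis using open_contains_ball open_image_dom that by blast
qed

text \<open>The third coordinate is a potential of the closed form dual to \<open>V\<close>.\<close>

lemma adapted_chart:
  obtains \<kappa> r where "\<kappa> \<in> CS" "p \<in> chart_dom \<kappa>" "r > 0" "chart_map \<kappa> ` chart_dom \<kappa> = ball (chart_map \<kappa> p) r"
    "\<And>z. z \<in> chart_map \<kappa> ` chart_dom \<kappa> \<Longrightarrow> \<eta> \<kappa> z $ 1 \<noteq> 0"
    "\<And>z w. z \<in> chart_map \<kappa> ` chart_dom \<kappa> \<Longrightarrow> G \<kappa> z (\<eta> \<kappa> z) w = w $ 3"
proof -
  obtain \<kappa> where cs: "\<kappa> \<in> CS" and p: "p \<in> chart_dom \<kappa>" using atlas_at atlas_cs by blast
  interpret k: chart \<kappa> by (rule cs_chart[OF cs])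
  let ?Z = "chart_map \<kappa> ` chart_dom \<kappa>"
  let ?z = "chart_map \<kappa> p"
  obtain r where r: "r > 0" "ball ?z r \<subseteq> ?Z" by (rule ball_in_image[OF cs p])
  let ?B = "ball ?z r"
  have zB: "?z \<in> ?B" using r by simp
  have inZ: "z \<in> ?Z" if "z \<in> ?B" for z using that r by blast
  define \<omega> where "\<omega> = (\<lambda>z. \<chi> i. G \<kappa> z (\<eta> \<kappa> z) (axis i 1))"
  have \<omega>: "\<omega> z \<bullet> w = G \<kappa> z (\<eta> \<kappa> z) w" if "z \<in> ?Z" for z w
    using linear_expand3[OF G_linear_right[OF cs that], of "\<eta> \<kappa> z" w]
    by (simp add: \<omega>_def inner_vec_def sum_3 mult.commute)
  note s\<eta> = smooth_on_subset[OF \<eta>_smooth[OF cs] r(2)]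
  have s\<omega>: "smooth_on ?B \<omega>"
    unfolding \<omega>_def
    by (intro smooth_on_vec_lambda open_ball G_smooth_apply[OF cs open_ball r(2) s\<eta>] smooth_on_const)
  have d\<omega>: "fd \<omega> z u \<bullet> w = dG \<kappa> z u (\<eta> \<kappa> z) w + G \<kappa> z (fd (\<eta> \<kappa>) z u) w" if z: "z \<in> ?B" for z u w
  proof -
    have "fd \<omega> z u \<bullet> w = fd (\<lambda>z. \<omega> z \<bullet> w) z u"
      by (rule fd_inner_left[OF smooth_onD[OF s\<omega> z], symmetric])
    also have "\<dots> = fd (\<lambda>z. G \<kappa> z (\<eta> \<kappa> z) w) z u"
      by (rule fd_fun_cong[OF open_ball z]) (rule \<omega>[OF inZ])
    also have "\<dots> = dG \<kappa> z u (\<eta> \<kappa> z) w + G \<kappa> z (fd (\<eta> \<kappa>) z u) w"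
      using fd_eq[OF G_has_derivative[OF cs inZ[OF z] smooth_onD[OF s\<eta> z], of "\<lambda>z. w"]]
        linear_0[OF G_linear_right[OF cs inZ[OF z]]] by simp
    finally show ?thesis .
  qed
  have "fd \<omega> z u \<bullet> v = fd \<omega> z v \<bullet> u" if z: "z \<in> ?B" for z u v
    unfolding d\<omega>[OF z] using \<eta>_closed[OF cs inZ[OF z], of u v] by simp
  \<comment> \<open>With the identity as projection, the relative statement becomes the Poincare
    lemma on a ball.\<close>
  then obtain y where y: "smooth_on ?B y" "\<And>z v. z \<in> ?B \<Longrightarrow> fd y z v = \<omega> z \<bullet> v"
  proof (rule_tac P="\<lambda>v. v" in relative_poincare[OF s\<omega>])
    show "norm (v - (1 - s) *\<^sub>R v) \<le> norm v" if "0 \<le> s" "s \<le> 1" for v :: "real^3" and s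
    proof -
      have "v - (1 - s) *\<^sub>R v = s *\<^sub>R v" by (simp add: algebra_simps)
      then show ?thesis using that by (simp add: mult_left_le_one_le)
    qed
  qed (auto simp: linear_iff)
  \<comment> \<open>Two linear functions complete y to a coordinate system. The covector
    \<open>n\<close> of dy is orthogonal to \<open>a\<close> because \<open>V\<close> is null, so
    \<open>a\<close>, \<open>n\<close> and their cross product are independent; using
    \<open>a\<close> itself as a covector makes the first coordinate increase along
    \<open>V\<close>.\<close>
  define a where "a = \<eta> \<kappa> ?z"
  define n where "n = \<omega> ?z"
  define b where "b = cross3 a n"
  have a0: "a \<noteq> 0" unfolding a_def using \<eta>_nonzero[OF cs inZ[OF zB]] .
  have n0: "n \<noteq> 0"
  proof
    assume "n = 0"
    then have "G \<kappa> ?z (\<eta> \<kappa> ?z) w = 0" for w using \<omega>[OF inZ[OF zB], of w] by (simp add: n_def)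
    then show False using G_nondegenerate[OF cs inZ[OF zB]] a0 by (auto simp: a_def)
  qed
  have an: "a \<bullet> n = 0"
    using \<omega>[OF inZ[OF zB], of a] \<eta>_null[OF cs inZ[OF zB]] by (simp add: a_def n_def inner_commute)
  have "(norm b)\<^sup>2 = (norm a * norm n)\<^sup>2" using norm_cross_dot[of a n] an by (simp add: b_def)
  then have b0: "norm b \<noteq> 0" using a0 n0 by auto
  \<comment> \<open>Shrinking keeps the first component of \<open>V\<close> in the new chart
    positive, not only at the centre.\<close>
  define U where "U = ?B \<inter> (\<lambda>z. a \<bullet> \<eta> \<kappa> z) -` {0<..}"
  have oU: "open U"
    unfolding U_def
    by (rule continuous_open_preimage) (auto intro!: continuous_on_inner smooth_on_continuous[OF s\<eta>])
  have zU: "?z \<in> U" using r a0 by (simp add: U_def a_def)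
  have UB: "U \<subseteq> ?B" by (auto simp: U_def)
  define \<Psi> :: "real^3 \<Rightarrow> real^3" where "\<Psi> = (\<lambda>z. (a \<bullet> z) *\<^sub>R e\<^sub>t + (b \<bullet> z) *\<^sub>R e\<^sub>x + y z *\<^sub>R e\<^sub>y)"
  have s\<Psi>: "smooth_on U \<Psi>"
    unfolding \<Psi>_def by (intro smooth_intros oU smooth_on_subset[OF y(1) UB])
  have d\<Psi>: "fd \<Psi> z v = (a \<bullet> v) *\<^sub>R e\<^sub>t + (b \<bullet> v) *\<^sub>R e\<^sub>x + (\<omega> z \<bullet> v) *\<^sub>R e\<^sub>y" if z: "z \<in> U" for z v
  proof -
    have z': "z \<in> ?B" using z UB by blast
    have "(\<Psi> has_derivative (\<lambda>v. (a \<bullet> v) *\<^sub>R e\<^sub>t + (b \<bullet> v) *\<^sub>R e\<^sub>x + fd y z v *\<^sub>R e\<^sub>y)) (at z)"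
      unfolding \<Psi>_def
      by (intro has_derivative_add has_derivative_scaleR_left has_derivative_inner_right has_derivative_ident
          smooth_on_has_derivative[OF y(1) z'])
    from fd_eq[OF this] show ?thesis by (simp add: y(2)[OF z'])
  qed
  have inj: "v = 0" if "fd \<Psi> ?z v = 0" for v
  proof -
    have *: "a \<bullet> v = 0" "b \<bullet> v = 0" "n \<bullet> v = 0"
      using that unfolding d\<Psi>[OF zU] n_def vec_eq_iff forall_3 by simp_all
    \<comment> \<open>By the Lagrange identity v x (a x n) = (v \<bullet> n) a - (v \<bullet> a) n.
      So v is both parallel and orthogonal to the nonzero vector b.\<close>
    have "cross3 v b = 0" unfolding b_def Lagrange using * by (simp add: inner_commute)
    then have "norm v * norm b = 0" using norm_cross_dot[of v b] * by (simp add: inner_commute)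
    then show ?thesis using b0 by simp
  qed
  obtain \<mu> s where \<mu>: "\<mu> \<in> CS" "p \<in> chart_dom \<mu>" "chart_dom \<mu> \<subseteq> chart_dom \<kappa>"
    "chart_map \<kappa> ` chart_dom \<mu> \<subseteq> U" "\<And>q. chart_map \<mu> q = \<Psi> (chart_map \<kappa> q)"
    "s > 0" "chart_map \<mu> ` chart_dom \<mu> = ball (chart_map \<mu> p) s"
    by (rule new_chart[OF cs p zU oU s\<Psi> inj]) auto
  have coord: "coord_tangent A \<kappa> q v (\<lambda>q. chart_map \<mu> q $ i) = fd \<Psi> (chart_map \<kappa> q) v $ i" if "q \<in> chart_dom \<mu>" for q v i
    by (rule coord_tangent_new_coordinate[OF cs \<mu>(1) that \<mu>(3) \<mu>(5)]) (use smooth_onD[OF s\<Psi>] \<mu>(4) that in blast)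
  have 1: "\<eta> \<mu> (chart_map \<mu> q) $ 1 \<noteq> 0" if q: "q \<in> chart_dom \<mu>" for q
  proof -
    have qk: "q \<in> chart_dom \<kappa>" and qU: "chart_map \<kappa> q \<in> U" using q \<mu>(3,4) by auto
    have "\<eta> \<mu> (chart_map \<mu> q) $ 1 = V q (\<lambda>q. chart_map \<mu> q $ 1)"
      by (simp add: \<eta>_def chart.inv_map[OF cs_chart[OF \<mu>(1)] q])
    also have "\<dots> = a \<bullet> \<eta> \<kappa> (chart_map \<kappa> q)"
      unfolding V_eq[OF cs qk] coord[OF q] d\<Psi>[OF qU] by simp
    also have "\<dots> > 0" using qU by (simp add: U_def)
    finally show ?thesis by simp
  qed
  have 2: "G \<mu> (chart_map \<mu> q) (\<eta> \<mu> (chart_map \<mu> q)) w = w $ 3" if q: "q \<in> chart_dom \<mu>" for q w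
  proof -
    have qk: "q \<in> chart_dom \<kappa>" and qU: "chart_map \<kappa> q \<in> U" and qZ: "chart_map \<kappa> q \<in> ?Z"
      using q \<mu>(3,4) by auto
    obtain v where v: "coord_tangent A \<mu> q w = coord_tangent A \<kappa> q v"
      using coord_tangent_change[OF cs \<mu>(1) qk q] by blast
    have "G \<mu> (chart_map \<mu> q) (\<eta> \<mu> (chart_map \<mu> q)) w = g q (V q) (coord_tangent A \<kappa> q v)"
      by (simp add: G_chart_map[OF \<mu>(1) q] V_eq[OF \<mu>(1) q, symmetric] v)
    also have "\<dots> = \<omega> (chart_map \<kappa> q) \<bullet> v"
      unfolding \<omega>[OF qZ] by (simp add: G_chart_map[OF cs qk] V_eq[OF cs qk, symmetric])
    also have "\<dots> = coord_tangent A \<kappa> q v (\<lambda>q. chart_map \<mu> q $ 3)"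
      unfolding coord[OF q] d\<Psi>[OF qU] by simp
    also have "\<dots> = w $ 3" unfolding v[symmetric] by (rule coord_tangent_coordinate[OF \<mu>(1) q])
    finally show ?thesis .
  qed
  show thesis
    by (rule that[OF \<mu>(1,2,6,7)]) (use 1 2 in auto)
qed

text \<open>The projection to the leaf directions. Its kernel is the y-axis, so in the relative
  Poincare lemma y becomes a parameter.\<close>

definition drop_y :: "real^3 \<Rightarrow> real^3" where "drop_y v = v $ 1 *\<^sub>R e\<^sub>t + v $ 2 *\<^sub>R e\<^sub>x"

lemma drop_y_projection:
  shows "linear drop_y" "drop_y (drop_y v) = drop_y v"
    "0 \<le> s \<Longrightarrow> s \<le> 1 \<Longrightarrow> norm (v - (1 - s) *\<^sub>R drop_y v) \<le> norm v"
proof -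
  show "linear drop_y" unfolding drop_y_def by (intro linearI) (simp_all add: vec_eq_iff forall_3)
  show "drop_y (drop_y v) = drop_y v" by (simp add: drop_y_def)
  assume s: "0 \<le> s" "s \<le> 1"
  show "norm (v - (1 - s) *\<^sub>R drop_y v) \<le> norm v"
  proof (rule norm_le_componentwise_cart)
    fix i :: 3
    have "s * \<bar>x\<bar> \<le> \<bar>x\<bar>" for x :: real using s by (simp add: mult_left_le_one_le)
    moreover have "x - (1 - s) * x = s * x" for x :: real by (simp add: algebra_simps)
    ultimately show "norm ((v - (1 - s) *\<^sub>R drop_y v) $ i) \<le> norm (v $ i)"
      using s exhaust_3[of i] by (auto simp: drop_y_def abs_mult)
  qed
qed

text \<open>The form is extended by 0 in direction y; closedness is demanded only between leaf
  directions. The potential is nevertheless smooth in all variables, and its y-derivative is left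
  uncontrolled.\<close>

lemma leafwise_poincare:
  fixes \<alpha> \<beta> :: "real^3 \<Rightarrow> real"
  assumes s: "smooth_on (ball c r) \<alpha>" "smooth_on (ball c r) \<beta>"
    and closed: "\<And>z. z \<in> ball c r \<Longrightarrow> fd \<beta> z e\<^sub>t = fd \<alpha> z e\<^sub>x"
  obtains F where "smooth_on (ball c r) F" "\<And>z. z \<in> ball c r \<Longrightarrow> fd F z e\<^sub>t = \<alpha> z" "\<And>z. z \<in> ball c r \<Longrightarrow> fd F z e\<^sub>x = \<beta> z"
proof -
  define \<omega> where "\<omega> = (\<lambda>z. \<alpha> z *\<^sub>R e\<^sub>t + \<beta> z *\<^sub>R e\<^sub>x)"
  have s\<omega>: "smooth_on (ball c r) \<omega>" unfolding \<omega>_def by (intro smooth_intros open_ball s)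
  have d: "fd \<omega> z v = fd \<alpha> z v *\<^sub>R e\<^sub>t + fd \<beta> z v *\<^sub>R e\<^sub>x" if "z \<in> ball c r" for z v
  proof -
    have "(\<omega> has_derivative (\<lambda>v. fd \<alpha> z v *\<^sub>R e\<^sub>t + fd \<beta> z v *\<^sub>R e\<^sub>x)) (at z)"
      unfolding \<omega>_def by (intro has_derivative_add has_derivative_scaleR_left smooth_on_has_derivative[OF s(1)] smooth_on_has_derivative[OF s(2)] that)
    from fd_eq[OF this] show ?thesis by simp
  qed
  have "fd \<omega> z (drop_y u) \<bullet> drop_y v = fd \<omega> z (drop_y v) \<bullet> drop_y u" if z: "z \<in> ball c r" for z u v
  proof -
    note l = linear_expand3[OF linear_fd[OF smooth_onD[OF s(1) z]]] linear_expand3[OF linear_fd[OF smooth_onD[OF s(2) z]]]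
    show ?thesis
      unfolding d[OF z] l(1)[of "drop_y u"] l(1)[of "drop_y v"] l(2)[of "drop_y u"] l(2)[of "drop_y v"]
      by (simp add: drop_y_def inner_vec_def sum_3 closed[OF z]) (simp add: algebra_simps)
  qed
  from relative_poincare[OF s\<omega> drop_y_projection this]
  obtain F where F: "smooth_on (ball c r) F" "\<And>z v. z \<in> ball c r \<Longrightarrow> fd F z (drop_y v) = \<omega> z \<bullet> drop_y v"
    by blast
  have "drop_y e\<^sub>t = e\<^sub>t" "drop_y e\<^sub>x = e\<^sub>x" by (simp_all add: drop_y_def)
  then have "fd F z e\<^sub>t = \<alpha> z" "fd F z e\<^sub>x = \<beta> z" if "z \<in> ball c r" for z
    using F(2)[OF that, of "e\<^sub>t"] F(2)[OF that, of "e\<^sub>x"] by (simp_all add: \<omega>_def inner_vec_def sum_3)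
  with F(1) show thesis by (rule that)
qed

end

text \<open>The Killing equation for the pairs \<open>(x, x)\<close> and \<open>(x, y)\<close>, with \<open>V = (V1, m V1, 0)\<close> and the metric
  coefficients substituted. Here \<open>st\<close>, \<open>dmx\<close>, \<open>n2t\<close> etc. are partial derivatives of \<open>s\<close>, \<open>m\<close>, \<open>\<nu>2\<close>.\<close>

lemma killing_identity_xx:
  fixes V1 s m :: real
  assumes "2 * (dV1 * - (m * s\<^sup>2) + (m * dV1 + dm * V1) * s\<^sup>2) + (V1 * (2 * s * st) + m * V1 * (2 * s * sx)) = 0"
    and "V1 \<noteq> 0" "s \<noteq> 0"
  shows "st = - (m * sx + dm * s)"
proof -
  have "2 * s * V1 * (st + m * sx + dm * s) = 0"
    using assms(1) by (simp add: algebra_simps power2_eq_square)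
  then show ?thesis using assms(2,3) by simp
qed

lemma killing_identity_xy:
  fixes V1 s m :: real
  assumes K: "dV1x * (\<nu>1 - m * s * X3) + (m * dV1x + dmx * V1) * (\<nu>2 + s * X3) + dV1y * - (m * s\<^sup>2)
      + (m * dV1y + dmy * V1) * s\<^sup>2 + V1 * (n2t + (- (m * sx + dmx * s)) * X3 + s * (- (m * sy + dmy * s)))
      + m * V1 * (n2x + sx * X3 + s * sy) = 0"
    and D: "V1 * n1x + dV1x * \<nu>1 + (m * V1 * n2x + (m * dV1x + dmx * V1) * \<nu>2) = 0"
    and "V1 \<noteq> 0"
  shows "n2t = n1x"
proof -
  \<comment> \<open>In \<open>K\<close> all terms with \<open>X3\<close>, \<open>sy\<close> or
    \<open>dmy\<close> cancel. Subtracting \<open>D\<close>, which is the x-derivative of the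
    relation \<nu>(V) = 1, leaves this.\<close>
  have "V1 * (n2t - n1x) = 0"
    using K D by algebra
  then show ?thesis using assms(3) by simp
qed

context parallel_null
begin

text \<open>In an adapted chart the metric on the leaves \<open>y = const\<close> is the square of the one-form
  \<open>(- m s, s)\<close>; by the Killing equation this form is leafwise closed, and \<open>x\<close> is its potential.
  The metric is then \<open>dy \<otimes> \<nu> + \<nu> \<otimes> dy + dx \<otimes> dx\<close>, where \<open>\<nu>\<close> is leafwise closed as well, and \<open>t\<close> is
  a leafwise potential of \<open>\<nu>\<close>. The remaining coefficient \<open>\<psi>\<close> of \<open>dy \<otimes> dy\<close> does not depend on \<open>t\<close>
  because \<open>V = \<partial>\<^sub>t\<close> is Killing.\<close>

lemma walker_chart_exists:
  obtains \<kappa> \<phi> r where "\<kappa> \<in> CS" "p \<in> chart_dom \<kappa>" "walker_form A g \<kappa> \<phi>" "r > 0"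
    "chart_map \<kappa> ` chart_dom \<kappa> = ball (chart_map \<kappa> p) r"
    "\<And>q. q \<in> chart_dom \<kappa> \<Longrightarrow> V q = coord_tangent A \<kappa> q e\<^sub>t"
proof -
  obtain \<kappa> r where cs: "\<kappa> \<in> CS" and p: "p \<in> chart_dom \<kappa>" and r: "r > 0"
    and img: "chart_map \<kappa> ` chart_dom \<kappa> = ball (chart_map \<kappa> p) r"
    and n1: "\<And>z. z \<in> chart_map \<kappa> ` chart_dom \<kappa> \<Longrightarrow> \<eta> \<kappa> z $ 1 \<noteq> 0"
    and Gn: "\<And>z w. z \<in> chart_map \<kappa> ` chart_dom \<kappa> \<Longrightarrow> G \<kappa> z (\<eta> \<kappa> z) w = w $ 3"
    by (rule adapted_chart[of p]) (rule that)
  interpret k: chart \<kappa> by (rule cs_chart[OF cs])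
  define B where "B = ball (chart_map \<kappa> p) r"
  have oB: "open B" by (simp add: B_def)
  have BZ: "z \<in> chart_map \<kappa> ` chart_dom \<kappa>" if "z \<in> B" for z using that img by (simp add: B_def)
  define V1 where "V1 = (\<lambda>z. \<eta> \<kappa> z $ 1)"
  define V2 where "V2 = (\<lambda>z. \<eta> \<kappa> z $ 2)"
  define G22 where "G22 = (\<lambda>z. G \<kappa> z e\<^sub>x e\<^sub>x)"
  define G13 where "G13 = (\<lambda>z. G \<kappa> z e\<^sub>t e\<^sub>y)"
  define G23 where "G23 = (\<lambda>z. G \<kappa> z e\<^sub>x e\<^sub>y)"
  define G33 where "G33 = (\<lambda>z. G \<kappa> z e\<^sub>y e\<^sub>y)"
  have V1nz: "V1 z \<noteq> 0" if "z \<in> B" for z using n1[OF BZ[OF that]] by (simp add: V1_def)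
  \<comment> \<open>\<open>V\<close> is null, and pairing with \<open>V\<close> is dy; hence dy(V) =
    0 and \<open>V\<close> is tangent to the leaves.\<close>
  have n3: "\<eta> \<kappa> z $ 3 = 0" if "z \<in> B" for z
    using Gn[OF BZ[OF that], of "\<eta> \<kappa> z"] \<eta>_null[OF cs BZ[OF that]] by simp
  have s\<eta>: "smooth_on B (\<eta> \<kappa>)" using \<eta>_smooth[OF cs] by (simp add: img B_def)
  have sG: "smooth_on B (\<lambda>z. G \<kappa> z u v)" for u v using G_smooth[OF cs, of u v] by (simp add: img B_def)
  have sV: "smooth_on B V1" "smooth_on B V2" unfolding V1_def V2_def by (intro smooth_on_nth oB s\<eta>)+
  have sGs: "smooth_on B G22" "smooth_on B G13" "smooth_on B G23" "smooth_on B G33"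
    unfolding G22_def G13_def G23_def G33_def by (rule sG)+
  have Gleft: "G \<kappa> z u w = u $ 1 * G \<kappa> z e\<^sub>t w + u $ 2 * G \<kappa> z e\<^sub>x w + u $ 3 * G \<kappa> z e\<^sub>y w" if "z \<in> B" for z u w
    using linear_expand3[OF G_linear_left[OF cs BZ[OF that]], of u w] by simp
  have G\<eta>: "V1 z * G \<kappa> z e\<^sub>t w + V2 z * G \<kappa> z e\<^sub>x w = w $ 3" if "z \<in> B" for z w
    using Gn[OF BZ[OF that], of w] unfolding Gleft[OF that, of "\<eta> \<kappa> z"] by (simp add: V1_def V2_def n3[OF that])
  have G22pos: "G22 z > 0" if z: "z \<in> B" for z
    unfolding G22_def
  proof (rule \<eta>_orthogonal_pos[OF cs BZ[OF z]])
    show "G \<kappa> z (\<eta> \<kappa> z) e\<^sub>x = 0" using Gn[OF BZ[OF z], of "e\<^sub>x"] by simp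
    show "e\<^sub>x \<noteq> c *\<^sub>R \<eta> \<kappa> z" for c
    proof
      assume a: "e\<^sub>x = c *\<^sub>R \<eta> \<kappa> z"
      from arg_cong[OF a, of "\<lambda>v. v $ 1"] arg_cong[OF a, of "\<lambda>v. v $ 2"] show False
        using n1[OF BZ[OF z]] by simp
    qed
  qed
  \<comment> \<open>Within a leaf, \<open>V\<close> has slope \<open>m\<close> and spans the kernel
    of the metric, so the metric there is s^2 (dx - m dt)^2 in the old coordinates, where
    \<open>s\<close> is the length of the second coordinate vector. This dictates the values of
    \<open>G12\<close> and \<open>G11\<close>.\<close>
  define m where "m = (\<lambda>z. V2 z / V1 z)"
  define s where "s = (\<lambda>z. sqrt (G22 z))"
  have sm: "smooth_on B m" unfolding m_def by (intro smooth_on_divide oB sV V1nz)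
  have ss: "smooth_on B s" unfolding s_def by (intro smooth_on_sqrt oB sGs G22pos)
  have spos: "s z > 0" if "z \<in> B" for z using G22pos[OF that] by (simp add: s_def)
  have V2m: "V2 z = m z * V1 z" if "z \<in> B" for z using V1nz[OF that] by (simp add: m_def)
  have G22s: "G22 z = (s z)\<^sup>2" if "z \<in> B" for z using G22pos[OF that] by (simp add: s_def)
  have G12: "G \<kappa> z e\<^sub>t e\<^sub>x = - (m z * (s z)\<^sup>2)" if "z \<in> B" for z
  proof -
    have "V1 z * (G \<kappa> z e\<^sub>t e\<^sub>x + m z * (s z)\<^sup>2) = 0"
      using G\<eta>[OF that, of "e\<^sub>x"] unfolding V2m[OF that] G22s[OF that, symmetric] G22_def by (simp add: algebra_simps)
    then show ?thesis using V1nz[OF that] by simp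
  qed
  have G11: "G \<kappa> z e\<^sub>t e\<^sub>t = (m z * s z)\<^sup>2" if "z \<in> B" for z
  proof -
    have "V1 z * (G \<kappa> z e\<^sub>t e\<^sub>t - (m z * s z)\<^sup>2) = 0"
      using G\<eta>[OF that, of "e\<^sub>t"] unfolding V2m[OF that] G_sym[OF cs BZ[OF that], of "e\<^sub>x" "e\<^sub>t"] G12[OF that]
      by (simp add: algebra_simps power2_eq_square)
    then show ?thesis using V1nz[OF that] by simp
  qed
  note D = smooth_onD
  have d\<eta>: "fd (\<eta> \<kappa>) z v $ 1 = fd V1 z v" "fd (\<eta> \<kappa>) z v $ 2 = fd V2 z v" "fd (\<eta> \<kappa>) z v $ 3 = 0" if z: "z \<in> B" for z v
  proof -
    show "fd (\<eta> \<kappa>) z v $ 1 = fd V1 z v" "fd (\<eta> \<kappa>) z v $ 2 = fd V2 z v"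
      unfolding V1_def V2_def by (rule fd_nth[OF D[OF s\<eta> z], symmetric])+
    have "fd (\<eta> \<kappa>) z v $ 3 = fd (\<lambda>z. \<eta> \<kappa> z $ 3) z v" by (rule fd_nth[OF D[OF s\<eta> z], symmetric])
    also have "\<dots> = fd (\<lambda>z. 0) z v" by (rule fd_fun_cong[OF oB z]) (rule n3)
    finally show "fd (\<eta> \<kappa>) z v $ 3 = 0" by simp
  qed
  have dV2: "fd V2 z v = m z * fd V1 z v + fd m z v * V1 z" if z: "z \<in> B" for z v
  proof -
    have "fd V2 z v = fd (\<lambda>z. m z * V1 z) z v" by (rule fd_fun_cong[OF oB z]) (rule V2m)
    then show ?thesis using fd_mult[OF D[OF sm z] D[OF sV(1) z]] by simp
  qed
  have dG\<eta>: "dG \<kappa> z (\<eta> \<kappa> z) u v = V1 z * dG \<kappa> z e\<^sub>t u v + m z * V1 z * dG \<kappa> z e\<^sub>x u v" if z: "z \<in> B" for z u v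
  proof -
    have "linear (\<lambda>w. dG \<kappa> z w u v)" by (rule dG_linear(1)[OF cs BZ[OF z]])
    from linear_expand3[OF this, of "\<eta> \<kappa> z"] show ?thesis
      by (simp add: V1_def n3[OF z] V2m[OF z, unfolded V1_def V2_def])
  qed
  have dG22: "dG \<kappa> z v e\<^sub>x e\<^sub>x = 2 * s z * fd s z v" if z: "z \<in> B" for z v
  proof -
    have "dG \<kappa> z v e\<^sub>x e\<^sub>x = fd (\<lambda>z. s z * s z) z v"
      by (rule fd_fun_cong[OF oB z]) (use G22s in \<open>simp add: G22_def power2_eq_square\<close>)
    then show ?thesis using fd_mult[OF D[OF ss z] D[OF ss z], of v] by simp
  qed
  have st: "fd s z e\<^sub>t = - (m z * fd s z e\<^sub>x + fd m z e\<^sub>x * s z)" if z: "z \<in> B" for z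
  proof (rule killing_identity_xx[OF _ V1nz[OF z]])
    show "s z \<noteq> 0" using spos[OF z] by simp
    have 1: "G \<kappa> z (fd (\<eta> \<kappa>) z e\<^sub>x) e\<^sub>x = fd V1 z e\<^sub>x * - (m z * (s z)\<^sup>2) + (m z * fd V1 z e\<^sub>x + fd m z e\<^sub>x * V1 z) * (s z)\<^sup>2"
      unfolding Gleft[OF z, of "fd (\<eta> \<kappa>) z e\<^sub>x"] d\<eta>[OF z] dV2[OF z] G12[OF z] G22s[OF z, unfolded G22_def] by simp
    show "2 * (fd V1 z e\<^sub>x * - (m z * (s z)\<^sup>2) + (m z * fd V1 z e\<^sub>x + fd m z e\<^sub>x * V1 z) * (s z)\<^sup>2) +
        (V1 z * (2 * s z * fd s z e\<^sub>t) + m z * V1 z * (2 * s z * fd s z e\<^sub>x)) = 0"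
      using \<eta>_killing[OF cs BZ[OF z], of "e\<^sub>x" "e\<^sub>x"] unfolding dG\<eta>[OF z] unfolding dG22[OF z] 1 by (simp only: mult_2)
  qed
  have sms: "smooth_on B (\<lambda>z. - (m z * s z))" by (intro smooth_intros oB sm ss)
  have dms: "fd (\<lambda>z. - (m z * s z)) z v = - (m z * fd s z v + fd m z v * s z)" if z: "z \<in> B" for z v
    using fd_eq[OF has_derivative_minus[OF has_derivative_mult[OF smooth_on_has_derivative[OF sm z] smooth_on_has_derivative[OF ss z]]]]
    by simp
  obtain x where sx: "smooth_on B x" and x1: "\<And>z. z \<in> B \<Longrightarrow> fd x z e\<^sub>t = - (m z * s z)"
    and x2: "\<And>z. z \<in> B \<Longrightarrow> fd x z e\<^sub>x = s z"
    by (rule leafwise_poincare[OF sms[unfolded B_def] ss[unfolded B_def]])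
      (simp_all only: B_def[symmetric] st dms)
  \<comment> \<open>The y-component of dx, on which the leafwise construction has no influence. It
    is absorbed into \<nu> and \<psi>.\<close>
  define X3 where "X3 = (\<lambda>z. fd x z e\<^sub>y)"
  have sX3: "smooth_on B X3" unfolding X3_def by (rule smooth_on_fd[OF sx])
  have dX3: "fd X3 z e\<^sub>t = - (m z * fd s z e\<^sub>y + fd m z e\<^sub>y * s z)" "fd X3 z e\<^sub>x = fd s z e\<^sub>y" if z: "z \<in> B" for z
  proof -
    have "fd X3 z e\<^sub>t = fd (\<lambda>z. fd x z e\<^sub>t) z e\<^sub>y" unfolding X3_def by (rule fd_fd_commute[OF oB z sx])
    also have "\<dots> = fd (\<lambda>z. - (m z * s z)) z e\<^sub>y" by (rule fd_fun_cong[OF oB z]) (rule x1)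
    finally show "fd X3 z e\<^sub>t = - (m z * fd s z e\<^sub>y + fd m z e\<^sub>y * s z)" by (simp only: dms[OF z])
    have "fd X3 z e\<^sub>x = fd (\<lambda>z. fd x z e\<^sub>x) z e\<^sub>y" unfolding X3_def by (rule fd_fd_commute[OF oB z sx])
    also have "\<dots> = fd s z e\<^sub>y" by (rule fd_fun_cong[OF oB z]) (rule x2)
    finally show "fd X3 z e\<^sub>x = fd s z e\<^sub>y" .
  qed
  \<comment> \<open>The mixed coefficients with y that remain after dx \<otimes> dx has been
    subtracted from the metric; dx has the components -m s, s and \<open>X3\<close>.\<close>
  define \<nu>1 where "\<nu>1 = (\<lambda>z. G13 z + m z * s z * X3 z)"
  define \<nu>2 where "\<nu>2 = (\<lambda>z. G23 z - s z * X3 z)"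
  have s\<nu>: "smooth_on B \<nu>1" "smooth_on B \<nu>2"
    unfolding \<nu>1_def \<nu>2_def by (intro smooth_intros oB sGs sm ss sX3)+
  \<comment> \<open>Since dx(V) = 0, the pairing of \<open>V\<close> with the y-direction is
    entirely due to \<nu>. Later this says that V t = 1.\<close>
  have \<nu>V: "V1 z * \<nu>1 z + V2 z * \<nu>2 z = 1" if z: "z \<in> B" for z
    using G\<eta>[OF z, of "e\<^sub>y"] by (simp add: \<nu>1_def \<nu>2_def G13_def G23_def V2m[OF z] algebra_simps)
  have \<nu>closed: "fd \<nu>2 z e\<^sub>t = fd \<nu>1 z e\<^sub>x" if z: "z \<in> B" for z
  proof (rule killing_identity_xy[OF _ _ V1nz[OF z]])
    have "fd (\<lambda>z. V1 z * \<nu>1 z + V2 z * \<nu>2 z) z e\<^sub>x = fd (\<lambda>z. 1) z e\<^sub>x"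
      by (rule fd_fun_cong[OF oB z]) (rule \<nu>V)
    moreover have "fd (\<lambda>z. V1 z * \<nu>1 z + V2 z * \<nu>2 z) z e\<^sub>x
        = (V1 z * fd \<nu>1 z e\<^sub>x + fd V1 z e\<^sub>x * \<nu>1 z) + (V2 z * fd \<nu>2 z e\<^sub>x + fd V2 z e\<^sub>x * \<nu>2 z)"
      using fd_eq[OF has_derivative_add[OF has_derivative_mult[OF smooth_on_has_derivative[OF sV(1) z] smooth_on_has_derivative[OF s\<nu>(1) z]]
          has_derivative_mult[OF smooth_on_has_derivative[OF sV(2) z] smooth_on_has_derivative[OF s\<nu>(2) z]]]]
      by simp
    ultimately show "V1 z * fd \<nu>1 z e\<^sub>x + fd V1 z e\<^sub>x * \<nu>1 z
        + (m z * V1 z * fd \<nu>2 z e\<^sub>x + (m z * fd V1 z e\<^sub>x + fd m z e\<^sub>x * V1 z) * \<nu>2 z) = 0"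
      by (simp add: V2m[OF z] dV2[OF z])
    have dG23: "dG \<kappa> z v e\<^sub>x e\<^sub>y = fd \<nu>2 z v + fd s z v * X3 z + s z * fd X3 z v" for v
    proof -
      have "dG \<kappa> z v e\<^sub>x e\<^sub>y = fd (\<lambda>z. \<nu>2 z + s z * X3 z) z v"
        by (rule fd_fun_cong[OF oB z]) (simp add: \<nu>2_def G23_def)
      then show ?thesis
        using fd_eq[OF has_derivative_add[OF smooth_on_has_derivative[OF s\<nu>(2) z]
            has_derivative_mult[OF smooth_on_has_derivative[OF ss z] smooth_on_has_derivative[OF sX3 z]]]]
        by simp
    qed
    have 1: "G \<kappa> z (fd (\<eta> \<kappa>) z e\<^sub>x) e\<^sub>y = fd V1 z e\<^sub>x * (\<nu>1 z - m z * s z * X3 z)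
        + (m z * fd V1 z e\<^sub>x + fd m z e\<^sub>x * V1 z) * (\<nu>2 z + s z * X3 z)"
      unfolding Gleft[OF z, of "fd (\<eta> \<kappa>) z e\<^sub>x"] d\<eta>[OF z] dV2[OF z]
      by (simp add: \<nu>1_def \<nu>2_def G13_def G23_def)
    have 2: "G \<kappa> z (fd (\<eta> \<kappa>) z e\<^sub>y) e\<^sub>x = fd V1 z e\<^sub>y * - (m z * (s z)\<^sup>2) + (m z * fd V1 z e\<^sub>y + fd m z e\<^sub>y * V1 z) * (s z)\<^sup>2"
      unfolding Gleft[OF z, of "fd (\<eta> \<kappa>) z e\<^sub>y"] d\<eta>[OF z] dV2[OF z] G12[OF z] G22s[OF z, unfolded G22_def] by simp
    show "fd V1 z e\<^sub>x * (\<nu>1 z - m z * s z * X3 z) + (m z * fd V1 z e\<^sub>x + fd m z e\<^sub>x * V1 z) * (\<nu>2 z + s z * X3 z)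
        + fd V1 z e\<^sub>y * - (m z * (s z)\<^sup>2) + (m z * fd V1 z e\<^sub>y + fd m z e\<^sub>y * V1 z) * (s z)\<^sup>2
        + V1 z * (fd \<nu>2 z e\<^sub>t + (- (m z * fd s z e\<^sub>x + fd m z e\<^sub>x * s z)) * X3 z + s z * (- (m z * fd s z e\<^sub>y + fd m z e\<^sub>y * s z)))
        + m z * V1 z * (fd \<nu>2 z e\<^sub>x + fd s z e\<^sub>x * X3 z + s z * fd s z e\<^sub>y) = 0"
      using \<eta>_killing[OF cs BZ[OF z], of "e\<^sub>x" "e\<^sub>y"]
      unfolding 1 2 dG\<eta>[OF z] unfolding dG23 dX3[OF z] st[OF z] by linarith
  qed
  obtain t where st': "smooth_on B t" and t1: "\<And>z. z \<in> B \<Longrightarrow> fd t z e\<^sub>t = \<nu>1 z"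
    and t2: "\<And>z. z \<in> B \<Longrightarrow> fd t z e\<^sub>x = \<nu>2 z"
    by (rule leafwise_poincare[OF s\<nu>[unfolded B_def]]) (simp_all only: B_def[symmetric] \<nu>closed)
  \<comment> \<open>From the (y, y) coefficient, the square of the y-component of dx and twice the
    y-component of dt are removed; the latter appears twice because dt and dy are
    symmetrised.\<close>
  define \<psi> where "\<psi> = (\<lambda>z. G33 z - (X3 z)\<^sup>2 - 2 * fd t z e\<^sub>y)"
  have dx: "fd x z u = - (m z * s z) * u $ 1 + s z * u $ 2 + X3 z * u $ 3" if z: "z \<in> B" for z u
    using linear_expand3[OF linear_fd[OF D[OF sx z]], of u] by (simp add: x1[OF z] x2[OF z] X3_def)
  have dt: "fd t z u = \<nu>1 z * u $ 1 + \<nu>2 z * u $ 2 + fd t z e\<^sub>y * u $ 3" if z: "z \<in> B" for z u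
    using linear_expand3[OF linear_fd[OF D[OF st' z]], of u] by (simp add: t1[OF z] t2[OF z])
  have Gform: "G \<kappa> z u w = fd t z u * w $ 3 + u $ 3 * fd t z w + fd x z u * fd x z w + \<psi> z * u $ 3 * w $ 3"
    if z: "z \<in> B" for z u w
  proof -
    have right: "G \<kappa> z v w = w $ 1 * G \<kappa> z e\<^sub>t v + w $ 2 * G \<kappa> z e\<^sub>x v + w $ 3 * G \<kappa> z e\<^sub>y v" for v
      unfolding G_sym[OF cs BZ[OF z], of v w] by (rule Gleft[OF z])
    have sy: "G \<kappa> z e\<^sub>x e\<^sub>t = G \<kappa> z e\<^sub>t e\<^sub>x" "G \<kappa> z e\<^sub>y e\<^sub>t = G \<kappa> z e\<^sub>t e\<^sub>y" "G \<kappa> z e\<^sub>y e\<^sub>x = G \<kappa> z e\<^sub>x e\<^sub>y"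
      by (rule G_sym[OF cs BZ[OF z]])+
    have g: "G \<kappa> z e\<^sub>t e\<^sub>y = \<nu>1 z - m z * s z * X3 z" "G \<kappa> z e\<^sub>x e\<^sub>y = \<nu>2 z + s z * X3 z"
      "G \<kappa> z e\<^sub>y e\<^sub>y = \<psi> z + (X3 z)\<^sup>2 + 2 * fd t z e\<^sub>y"
      by (simp_all add: \<nu>1_def \<nu>2_def G13_def G23_def \<psi>_def G33_def)
    have "G \<kappa> z u w = u $ 1 * G \<kappa> z e\<^sub>t w + u $ 2 * G \<kappa> z e\<^sub>x w + u $ 3 * G \<kappa> z e\<^sub>y w" by (rule Gleft[OF z])
    also have "\<dots> = fd t z u * w $ 3 + u $ 3 * fd t z w + fd x z u * fd x z w + \<psi> z * u $ 3 * w $ 3"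
      unfolding right[of "e\<^sub>t"] right[of "e\<^sub>x"] right[of "e\<^sub>y"] sy G12[OF z] G11[OF z] G22s[OF z, unfolded G22_def] g
        dx[OF z] dt[OF z, of u] dt[OF z, of w]
      by (simp add: algebra_simps power2_eq_square)
    finally show ?thesis .
  qed
  define \<Psi> :: "real^3 \<Rightarrow> real^3" where "\<Psi> = (\<lambda>z. t z *\<^sub>R e\<^sub>t + x z *\<^sub>R e\<^sub>x + (z $ 3) *\<^sub>R e\<^sub>y)"
  have s\<Psi>: "smooth_on B \<Psi>" unfolding \<Psi>_def by (intro smooth_intros oB st' sx)
  have d\<Psi>: "fd \<Psi> z v = fd t z v *\<^sub>R e\<^sub>t + fd x z v *\<^sub>R e\<^sub>x + (v $ 3) *\<^sub>R e\<^sub>y" if z: "z \<in> B" for z v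
  proof -
    have "(\<Psi> has_derivative (\<lambda>v. fd t z v *\<^sub>R e\<^sub>t + fd x z v *\<^sub>R e\<^sub>x + (v $ 3) *\<^sub>R e\<^sub>y)) (at z)"
      unfolding \<Psi>_def
      by (intro has_derivative_add has_derivative_scaleR_left smooth_on_has_derivative[OF st' z]
          smooth_on_has_derivative[OF sx z] bounded_linear_imp_has_derivative bounded_linear_vec_nth)
    from fd_eq[OF this] show ?thesis by simp
  qed
  have pB: "chart_map \<kappa> p \<in> B" using r by (simp add: B_def)
  \<comment> \<open>A vector killed by dt, dx and dy is orthogonal to everything by
    \<open>Gform\<close>, so nondegeneracy makes it zero.\<close>
  have inj: "v = 0" if "fd \<Psi> (chart_map \<kappa> p) v = 0" for v
  proof (rule G_nondegenerate[OF cs BZ[OF pB]])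
    have *: "fd t (chart_map \<kappa> p) v = 0" "fd x (chart_map \<kappa> p) v = 0" "v $ 3 = 0"
      using that unfolding d\<Psi>[OF pB] vec_eq_iff forall_3 by simp_all
    show "G \<kappa> (chart_map \<kappa> p) v w = 0" for w unfolding Gform[OF pB] using * by simp
  qed
  obtain \<mu> \<rho> where \<mu>: "\<mu> \<in> CS" "p \<in> chart_dom \<mu>" "chart_dom \<mu> \<subseteq> chart_dom \<kappa>"
    "chart_map \<kappa> ` chart_dom \<mu> \<subseteq> B" "\<And>q. chart_map \<mu> q = \<Psi> (chart_map \<kappa> q)"
    "\<rho> > 0" "chart_map \<mu> ` chart_dom \<mu> = ball (chart_map \<mu> p) \<rho>"
    by (rule new_chart[OF cs p pB oB s\<Psi> inj]) auto
  interpret mu: chart \<mu> by (rule cs_chart[OF \<mu>(1)])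
  have qs: "q \<in> chart_dom \<kappa>" "chart_map \<kappa> q \<in> B" if "q \<in> chart_dom \<mu>" for q using that \<mu>(3,4) by auto
  have coord: "coord_tangent A \<kappa> q v (\<lambda>q. chart_map \<mu> q $ i) = fd \<Psi> (chart_map \<kappa> q) v $ i" if "q \<in> chart_dom \<mu>" for q v i
    by (rule coord_tangent_new_coordinate[OF cs \<mu>(1) that \<mu>(3) \<mu>(5) D[OF s\<Psi> qs(2)[OF that]]])
  have G\<mu>: "G \<mu> (chart_map \<mu> q) u w = u $ 1 * w $ 3 + u $ 3 * w $ 1 + u $ 2 * w $ 2 + \<psi> (chart_map \<kappa> q) * u $ 3 * w $ 3"
    if q: "q \<in> chart_dom \<mu>" for q u w
  proof -
    let ?z = "chart_map \<kappa> q"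
    note change = coord_tangent_change[OF cs \<mu>(1) qs(1)[OF q] q]
    obtain u' where u': "coord_tangent A \<mu> q u = coord_tangent A \<kappa> q u'" using change[of u] by (rule that)
    obtain w' where w': "coord_tangent A \<mu> q w = coord_tangent A \<kappa> q w'" using change[of w] by (rule that)
    have *: "v $ i = fd \<Psi> ?z v' $ i" if "coord_tangent A \<mu> q v = coord_tangent A \<kappa> q v'" for v v' i
      using coord_tangent_coordinate[OF \<mu>(1) q, of v i] coord[OF q, of v' i] that by simp
    have u: "u $ 1 = fd t ?z u'" "u $ 2 = fd x ?z u'" "u $ 3 = u' $ 3"
      unfolding *[OF u'] d\<Psi>[OF qs(2)[OF q]] by simp_all
    have w: "w $ 1 = fd t ?z w'" "w $ 2 = fd x ?z w'" "w $ 3 = w' $ 3"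
      unfolding *[OF w'] d\<Psi>[OF qs(2)[OF q]] by simp_all
    have "G \<mu> (chart_map \<mu> q) u w = G \<kappa> ?z u' w'"
      unfolding G_chart_map[OF \<mu>(1) q] G_chart_map[OF cs qs(1)[OF q]] u' w' ..
    then show ?thesis unfolding Gform[OF qs(2)[OF q]] u w by simp
  qed
  have \<eta>\<mu>: "\<eta> \<mu> z = e\<^sub>t" if "z \<in> chart_map \<mu> ` chart_dom \<mu>" for z
  proof -
    obtain q where q: "q \<in> chart_dom \<mu>" "z = chart_map \<mu> q" using \<open>z \<in> chart_map \<mu> ` chart_dom \<mu>\<close> by blast
    let ?z = "chart_map \<kappa> q"
    note zB = qs(2)[OF q(1)]
    have "\<eta> \<mu> z $ i = fd \<Psi> ?z (\<eta> \<kappa> ?z) $ i" for i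
    proof -
      have "\<eta> \<mu> z $ i = V q (\<lambda>q. chart_map \<mu> q $ i)"
        unfolding \<eta>_def q(2) mu.inv_map[OF q(1)] by simp
      also have "\<dots> = fd \<Psi> ?z (\<eta> \<kappa> ?z) $ i"
        unfolding V_eq[OF cs qs(1)[OF q(1)]] by (rule coord[OF q(1)])
      finally show ?thesis .
    qed
    moreover have "fd t ?z (\<eta> \<kappa> ?z) = 1"
      using \<nu>V[OF zB] dt[OF zB, of "\<eta> \<kappa> ?z"] n3[OF zB] by (simp add: V1_def V2_def mult.commute)
    moreover have "fd x ?z (\<eta> \<kappa> ?z) = 0"
      using V2m[OF zB] dx[OF zB, of "\<eta> \<kappa> ?z"] n3[OF zB] by (simp add: V1_def V2_def)
    ultimately show ?thesis
      unfolding vec_eq_iff forall_3 d\<Psi>[OF zB, of "\<eta> \<kappa> ?z"] by (simp add: n3[OF zB])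
  qed
  let ?M = "chart_map \<mu> ` chart_dom \<mu>"
  define h where "h = (\<lambda>z. G \<mu> z e\<^sub>y e\<^sub>y)"
  \<comment> \<open>\<open>V\<close> has constant components in the new chart, so the derivatives of
    \<eta> drop out of the Killing equation and only the t-derivative of the metric coefficient
    remains.\<close>
  have dh: "fd h z e\<^sub>t = 0" if z: "z \<in> ?M" for z
  proof -
    have "fd (\<eta> \<mu>) z v = 0" for v
      using fd_fun_cong[where g="\<lambda>z. e\<^sub>t" and v=v, OF mu.open_image_dom z \<eta>\<mu>] by simp
    then show ?thesis
      using \<eta>_killing[OF \<mu>(1) z, of "e\<^sub>y" "e\<^sub>y"] linear_0[OF G_linear_left[OF \<mu>(1) z]]
      by (simp add: \<eta>\<mu>[OF z] h_def)
  qed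
  let ?c = "chart_map \<mu> p"
  \<comment> \<open>The t-coordinate is frozen at its value at the centre. Replacing a coordinate by
    that of the centre does not leave the ball, so \<open>h\<close> agrees with its frozen
    version.\<close>
  define \<phi> where "\<phi> = (\<lambda>a b. h (?c $ 1 *\<^sub>R e\<^sub>t + a *\<^sub>R e\<^sub>x + b *\<^sub>R e\<^sub>y))"
  have h\<phi>: "h z = \<phi> (z $ 2) (z $ 3)" if z: "z \<in> ?M" for z
  proof -
    let ?k = "?c $ 1 - z $ 1"
    have e: "?c $ 1 *\<^sub>R e\<^sub>t + z $ 2 *\<^sub>R e\<^sub>x + z $ 3 *\<^sub>R e\<^sub>y = z + ?k *\<^sub>R e\<^sub>t"
      by (simp add: vec_eq_iff forall_3)
    have "norm (z + ?k *\<^sub>R e\<^sub>t - ?c) \<le> norm (z - ?c)"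
    proof (rule norm_le_componentwise_cart)
      fix i :: 3
      show "norm ((z + ?k *\<^sub>R e\<^sub>t - ?c) $ i) \<le> norm ((z - ?c) $ i)"
        using exhaust_3[of i] by auto
    qed
    then have "z + ?k *\<^sub>R e\<^sub>t \<in> ?M" using z unfolding \<mu>(7) by (simp add: dist_norm norm_minus_commute)
    then have "h (z + ?k *\<^sub>R e\<^sub>t) = h z"
      using G_differentiable[OF \<mu>(1)] dh z unfolding h_def \<mu>(7)
      by (intro constant_along[where S="ball ?c \<rho>"]) auto
    then show ?thesis unfolding \<phi>_def e ..
  qed
  have "walker_form A g \<mu> \<phi>"
    unfolding walker_form_def
  proof (intro ballI)
    fix q D E assume q: "q \<in> chart_dom \<mu>" and DE: "D \<in> tangent_space A q" "E \<in> tangent_space A q"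
    obtain u w where uw: "D = coord_tangent A \<mu> q u" "E = coord_tangent A \<mu> q w"
      using DE unfolding tangent_space_eq[OF \<mu>(1) q] by auto
    have \<psi>\<phi>: "\<psi> (chart_map \<kappa> q) = \<phi> (chart_map \<mu> q $ 2) (chart_map \<mu> q $ 3)"
      using G\<mu>[OF q, of "e\<^sub>y" "e\<^sub>y"] h\<phi>[OF imageI[OF q]] by (simp add: h_def)
    show "g q D E = D (\<lambda>p. chart_map \<mu> p $ 1) * E (\<lambda>p. chart_map \<mu> p $ 3) + D (\<lambda>p. chart_map \<mu> p $ 3) * E (\<lambda>p. chart_map \<mu> p $ 1)
        + D (\<lambda>p. chart_map \<mu> p $ 2) * E (\<lambda>p. chart_map \<mu> p $ 2)
        + \<phi> (chart_map \<mu> q $ 2) (chart_map \<mu> q $ 3) * D (\<lambda>p. chart_map \<mu> p $ 3) * E (\<lambda>p. chart_map \<mu> p $ 3)"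
      unfolding uw coord_tangent_coordinate[OF \<mu>(1) q] G_chart_map[OF \<mu>(1) q, symmetric] G\<mu>[OF q] \<psi>\<phi> ..
  qed
  moreover have "V q = coord_tangent A \<mu> q e\<^sub>t" if "q \<in> chart_dom \<mu>" for q
    using V_eq[OF \<mu>(1) that] \<eta>\<mu>[OF imageI[OF that]] by simp
  ultimately show thesis using \<mu>(1,2,6,7) by (intro that)
qed

end

section \<open>Gradient Ricci solitons in Walker coordinates\<close>

lemma smooth_on_real_derivative:
  fixes \<gamma> :: "real \<Rightarrow> real"
  assumes "smooth_on S \<gamma>" "y \<in> S"
  shows "(\<gamma> has_real_derivative deriv \<gamma> y) (at y)" "fd \<gamma> y 1 = deriv \<gamma> y"
proof -
  have "fd \<gamma> y h = fd \<gamma> y 1 * h" for h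
    using linear_scale[OF linear_fd[OF smooth_onD[OF assms]], of h 1] by simp
  then have "fd \<gamma> y = (*) (fd \<gamma> y 1)" by (intro ext)
  then have *: "(\<gamma> has_real_derivative fd \<gamma> y 1) (at y)"
    using smooth_on_has_derivative[OF assms] unfolding has_field_derivative_def by metis
  then show "fd \<gamma> y 1 = deriv \<gamma> y" by (rule DERIV_imp_deriv[symmetric])
  with * show "(\<gamma> has_real_derivative deriv \<gamma> y) (at y)" by simp
qed

lemma has_derivative_real_nth:
  fixes \<gamma> :: "real \<Rightarrow> real" and z :: "real^'n"
  assumes "smooth_on S \<gamma>" "z $ i \<in> S"
  shows "((\<lambda>z. \<gamma> (z $ i)) has_derivative (\<lambda>v. v $ i * deriv \<gamma> (z $ i))) (at z)"
proof -
  have "(\<gamma> has_derivative (\<lambda>h. h * deriv \<gamma> (z $ i))) (at (z $ i))"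
    using smooth_on_real_derivative(1)[OF assms] by (simp add: has_field_derivative_def mult_commute_abs)
  from has_derivative_compose[OF bounded_linear_imp_has_derivative[OF bounded_linear_vec_nth] this]
  show ?thesis .
qed

lemma smooth_on_deriv:
  fixes \<gamma> :: "real \<Rightarrow> real"
  assumes S: "open S" and \<gamma>: "smooth_on S \<gamma>"
  shows "smooth_on S (deriv \<gamma>)"
  by (rule smooth_on_cong[OF S smooth_on_fd[OF \<gamma>, of 1]]) (rule smooth_on_real_derivative(2)[OF \<gamma>])

lemma walker_form_cong:
  assumes "walker_form A g \<kappa> \<phi>" "\<And>p. p \<in> chart_dom \<kappa> \<Longrightarrow> \<phi> (cx \<kappa> p) (cy \<kappa> p) = \<phi>' (cx \<kappa> p) (cy \<kappa> p)"
  shows "walker_form A g \<kappa> \<phi>'"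
  using assms unfolding walker_form_def by simp

section \<open>Both normal forms solve the steady soliton equation\<close>

context walker_chart
begin

text \<open>Openness of the y-range makes \<open>smooth_on\<close> and \<open>deriv\<close>
  meaningful for the coefficient functions.\<close>

lemma open_cy: "open (cy \<kappa> ` chart_dom \<kappa>)"
  unfolding open_contains_ball
proof
  fix y assume "y \<in> cy \<kappa> ` chart_dom \<kappa>"
  then obtain z where z: "z \<in> \<Omega>" "y = z $ 3" by auto
  then obtain r where r: "r > 0" "ball z r \<subseteq> \<Omega>" using openZ open_contains_ball by blast
  have "b \<in> cy \<kappa> ` chart_dom \<kappa>" if "b \<in> ball y r" for b
  proof -
    have "dist z (z + (b - y) *\<^sub>R e\<^sub>y) < r"
      using that by (simp add: dist_norm norm_axis_1 abs_minus_commute)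
    then have "z + (b - y) *\<^sub>R e\<^sub>y \<in> \<Omega>" using r by auto
    then obtain q where "q \<in> chart_dom \<kappa>" "z + (b - y) *\<^sub>R e\<^sub>y = chart_map \<kappa> q" by auto
    moreover from arg_cong[OF this(2), of "\<lambda>v. v $ 3"] have "b = cy \<kappa> q" using z(2) by simp
    ultimately show ?thesis by blast
  qed
  then show "\<exists>e>0. ball y e \<subseteq> cy \<kappa> ` chart_dom \<kappa>" using r(1) by blast
qed

context
  fixes f :: "'a \<Rightarrow> real" and \<alpha> :: real and \<gamma> :: "real \<Rightarrow> real"
  assumes f: "smooth_fun_on A UNIV f"
    and \<gamma>: "smooth_on (cy \<kappa> ` chart_dom \<kappa>) \<gamma>"
    and form: "\<And>p. p \<in> chart_dom \<kappa> \<Longrightarrow> f p = cx \<kappa> p * \<alpha> + \<gamma> (cy \<kappa> p)"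
begin

lemma F_form: "z \<in> \<Omega> \<Longrightarrow> F f z = z $ 2 * \<alpha> + \<gamma> (z $ 3)"
  using form by (auto simp: F_def[OF f])

lemma fd_F_form: 
  assumes z: "z \<in> \<Omega>"
  shows "fd (F f) z v = v $ 2 * \<alpha> + v $ 3 * deriv \<gamma> (z $ 3)"
proof -
  have y: "z $ 3 \<in> cy \<kappa> ` chart_dom \<kappa>" using z by auto
  have "((\<lambda>z. z $ 2 * \<alpha> + \<gamma> (z $ 3)) has_derivative (\<lambda>v. v $ 2 * \<alpha> + v $ 3 * deriv \<gamma> (z $ 3))) (at z)"
    by (intro has_derivative_add has_derivative_mult_left has_derivative_real_nth[OF \<gamma> y]
        bounded_linear_imp_has_derivative bounded_linear_vec_nth)
  from fd_eq[OF this] have 1: "fd (\<lambda>z. z $ 2 * \<alpha> + \<gamma> (z $ 3)) z v = v $ 2 * \<alpha> + v $ 3 * deriv \<gamma> (z $ 3)" by simp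
  have "fd (F f) z v = fd (\<lambda>z. z $ 2 * \<alpha> + \<gamma> (z $ 3)) z v"
    by (rule fd_fun_cong[OF openZ z]) (rule F_form)
  then show ?thesis unfolding 1 .
qed

lemma fd_fd_F_form:
  assumes z: "z \<in> \<Omega>"
  shows "fd (\<lambda>z. fd (F f) z v) z u = u $ 3 * v $ 3 * deriv (deriv \<gamma>) (z $ 3)"
proof -
  have y: "z $ 3 \<in> cy \<kappa> ` chart_dom \<kappa>" using z by auto
  have "((\<lambda>z. v $ 2 * \<alpha> + v $ 3 * deriv \<gamma> (z $ 3)) has_derivative (\<lambda>u. 0 + v $ 3 * (u $ 3 * deriv (deriv \<gamma>) (z $ 3)))) (at z)"
    by (intro has_derivative_add has_derivative_const has_derivative_mult_right
        has_derivative_real_nth[OF smooth_on_deriv[OF open_cy \<gamma>] y])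
  from fd_eq[OF this]
  have 1: "fd (\<lambda>z. v $ 2 * \<alpha> + v $ 3 * deriv \<gamma> (z $ 3)) z u = u $ 3 * v $ 3 * deriv (deriv \<gamma>) (z $ 3)" by simp
  have "fd (\<lambda>z. fd (F f) z v) z u = fd (\<lambda>z. v $ 2 * \<alpha> + v $ 3 * deriv \<gamma> (z $ 3)) z u"
    by (rule fd_fun_cong[OF openZ z]) (rule fd_F_form)
  then show ?thesis unfolding 1 .
qed

lemma gradient_form:
  assumes p: "p \<in> chart_dom \<kappa>"
  shows "gradient A g f p = (\<lambda>h. \<alpha> * coord_field A \<kappa> 2 p h + deriv \<gamma> (cy \<kappa> p) * coord_field A \<kappa> 1 p h)"
    and "g p (gradient A g f p) (gradient A g f p) = \<alpha>\<^sup>2"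
proof -
  have z: "chart_map \<kappa> p \<in> \<Omega>" using p by simp
  have grad: "gradient A g f p = coord_tangent A \<kappa> p (\<alpha> *\<^sub>R e\<^sub>x + deriv \<gamma> (cy \<kappa> p) *\<^sub>R e\<^sub>t)"
    unfolding gradient_chart[OF f p] fd_F_form[OF z] by (simp add: add.commute)
  show "gradient A g f p = (\<lambda>h. \<alpha> * coord_field A \<kappa> 2 p h + deriv \<gamma> (cy \<kappa> p) * coord_field A \<kappa> 1 p h)"
    unfolding grad coord_tangent_linear[OF cs p] coord_field_def ..
  show "g p (gradient A g f p) (gradient A g f p) = \<alpha>\<^sup>2"
    unfolding grad G_chart_map[OF cs p, symmetric] G_walker[OF z] by (simp add: power2_eq_square)
qed

text \<open>Since f_t = 0 and f_x is constant, both sides vanish in all components except (y, y),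
  where the equation is half of \<open>eq\<close>.\<close>

lemma soliton_form:
  assumes z: "z \<in> \<Omega>"
    and eq: "2 * deriv (deriv \<gamma>) (z $ 3) + \<alpha> * \<Phi>x z = \<Phi>xx z"
  shows "soliton_eq f 0 z u v"
  unfolding soliton_eq_def[OF f] fd_fd_F_form[OF z] fd_F_form[OF z] eq[symmetric]
  by (simp add: algebra_simps)

end

lemma exponential_derivatives:
  fixes a b c :: "real \<Rightarrow> real"
  assumes s: "smooth_on (cy \<kappa> ` chart_dom \<kappa>) a" "smooth_on (cy \<kappa> ` chart_dom \<kappa>) b" "smooth_on (cy \<kappa> ` chart_dom \<kappa>) c"
    and \<phi>: "\<phi> = (\<lambda>x y. 1 / \<alpha>\<^sup>2 * a y * exp (\<alpha> * x) + x * b y + c y)" and \<alpha>: "\<alpha> \<noteq> 0" and z: "z \<in> \<Omega>"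
  shows "\<Phi>x z = 1 / \<alpha> * a (z $ 3) * exp (\<alpha> * z $ 2) + b (z $ 3)" "\<Phi>xx z = a (z $ 3) * exp (\<alpha> * z $ 2)"
proof -
  have \<Phi>: "\<Phi> = (\<lambda>z. 1 / \<alpha>\<^sup>2 * a (z $ 3) * exp (\<alpha> * z $ 2) + z $ 2 * b (z $ 3) + c (z $ 3))"
    unfolding \<Phi>_def fun_eq_iff by (simp add: \<phi>)
  note nth = bounded_linear_imp_has_derivative[OF bounded_linear_vec_nth]
  have e: "((\<lambda>z::real^3. exp (\<alpha> * z $ 2)) has_derivative (\<lambda>v. exp (\<alpha> * z $ 2) * (\<alpha> * v $ 2))) (at z)" for z
    by (rule has_derivative_eq_rhs[OF has_derivative_exp[OF has_derivative_mult_right[OF nth]]]) (simp add: mult_ac)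
  have 1: "\<Phi>x z = 1 / \<alpha> * a (z $ 3) * exp (\<alpha> * z $ 2) + b (z $ 3)" if z: "z \<in> \<Omega>" for z
  proof -
    have y: "z $ 3 \<in> cy \<kappa> ` chart_dom \<kappa>" using z by auto
    note d = has_derivative_add[OF has_derivative_add[OF has_derivative_mult[OF has_derivative_mult_right[OF has_derivative_real_nth[OF s(1) y], of "1 / \<alpha>\<^sup>2"] e]
        has_derivative_mult[OF nth has_derivative_real_nth[OF s(2) y]]] has_derivative_real_nth[OF s(3) y]]
    show ?thesis
      unfolding \<Phi> fd_eq[OF d[of 2]] using \<alpha> by (simp add: power2_eq_square field_simps)
  qed
  show "\<Phi>x z = 1 / \<alpha> * a (z $ 3) * exp (\<alpha> * z $ 2) + b (z $ 3)" by (rule 1[OF z])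
  have y: "z $ 3 \<in> cy \<kappa> ` chart_dom \<kappa>" using z by auto
  note d = has_derivative_add[OF has_derivative_mult[OF has_derivative_mult_right[OF has_derivative_real_nth[OF s(1) y], of "1 / \<alpha>"] e]
     has_derivative_real_nth[OF s(2) y]]
  have "\<Phi>xx z = fd (\<lambda>z. 1 / \<alpha> * a (z $ 3) * exp (\<alpha> * z $ 2) + b (z $ 3)) z e\<^sub>x"
    by (rule fd_fun_cong[OF openZ z 1])
  then show "\<Phi>xx z = a (z $ 3) * exp (\<alpha> * z $ 2)"
    unfolding fd_eq[OF d] using \<alpha> by simp
qed

lemma quadratic_derivatives:
  fixes a b c :: "real \<Rightarrow> real"
  assumes s: "smooth_on (cy \<kappa> ` chart_dom \<kappa>) a" "smooth_on (cy \<kappa> ` chart_dom \<kappa>) b" "smooth_on (cy \<kappa> ` chart_dom \<kappa>) c"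
    and \<phi>: "\<phi> = (\<lambda>x y. x\<^sup>2 * a y + x * b y + c y)" and z: "z \<in> \<Omega>"
  shows "\<Phi>xx z = 2 * a (z $ 3)"
proof -
  have \<Phi>: "\<Phi> = (\<lambda>z. z $ 2 * z $ 2 * a (z $ 3) + z $ 2 * b (z $ 3) + c (z $ 3))"
    unfolding \<Phi>_def fun_eq_iff by (simp add: \<phi> power2_eq_square)
  note nth = bounded_linear_imp_has_derivative[OF bounded_linear_vec_nth]
  have 1: "\<Phi>x z = 2 * z $ 2 * a (z $ 3) + b (z $ 3)" if z: "z \<in> \<Omega>" for z
  proof -
    have y: "z $ 3 \<in> cy \<kappa> ` chart_dom \<kappa>" using z by auto
    note d = has_derivative_add[OF has_derivative_add[OF has_derivative_mult[OF has_derivative_mult[OF nth nth] has_derivative_real_nth[OF s(1) y]]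
        has_derivative_mult[OF nth has_derivative_real_nth[OF s(2) y]]] has_derivative_real_nth[OF s(3) y]]
    show ?thesis unfolding \<Phi> fd_eq[OF d[of 2 2 2]] by simp
  qed
  have y: "z $ 3 \<in> cy \<kappa> ` chart_dom \<kappa>" using z by auto
  note d = has_derivative_add[OF has_derivative_mult[OF has_derivative_mult_right[OF nth] has_derivative_real_nth[OF s(1) y]]
     has_derivative_real_nth[OF s(2) y]]
  have "\<Phi>xx z = fd (\<lambda>z. 2 * z $ 2 * a (z $ 3) + b (z $ 3)) z e\<^sub>x"
    by (rule fd_fun_cong[OF openZ z 1])
  then show ?thesis unfolding fd_eq[OF d[of 2 2]] by simp
qed

end

context lorentz3
begin

text \<open>In \<open>2 \<gamma>'' + \<alpha> \<Phi>x = \<Phi>xx\<close> the exponential terms agree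
  because of the factor 1/\<alpha>^2, and the rest is the condition on \<gamma>. The factor 0 in the
  third claim is the soliton constant.\<close>

lemma exponential_form_soliton:
  assumes f: "smooth_fun_on A UNIV f" and \<kappa>: "\<kappa> \<in> CS" and form: "exponential_form A g f \<kappa> \<alpha> a b c \<gamma>"
    and p: "p \<in> chart_dom \<kappa>"
  shows "gradient A g f p = (\<lambda>h. \<alpha> * coord_field A \<kappa> 2 p h + deriv \<gamma> (cy \<kappa> p) * coord_field A \<kappa> 1 p h)"
    and "g p (gradient A g f p) (gradient A g f p) > 0"
    and "smooth_vfield_at A p X \<Longrightarrow> smooth_vfield_at A p Y \<Longrightarrow> hessian A g f X Y p + ricci A g X Y p = 0 * g p (X p) (Y p)"
proof -
  let ?\<phi> = "\<lambda>x y. 1 / \<alpha>\<^sup>2 * a y * exp (\<alpha> * x) + x * b y + c y"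
  have F: "\<alpha> \<noteq> 0" "smooth_on (cy \<kappa> ` chart_dom \<kappa>) a" "smooth_on (cy \<kappa> ` chart_dom \<kappa>) b"
    "smooth_on (cy \<kappa> ` chart_dom \<kappa>) c" "smooth_on (cy \<kappa> ` chart_dom \<kappa>) \<gamma>"
    "walker_form A g \<kappa> ?\<phi>"
    "\<And>p. p \<in> chart_dom \<kappa> \<Longrightarrow> f p = cx \<kappa> p * \<alpha> + \<gamma> (cy \<kappa> p)"
    "\<And>y. y \<in> cy \<kappa> ` chart_dom \<kappa> \<Longrightarrow> deriv (deriv \<gamma>) y = - (1 / 2) * \<alpha> * b y"
    using form unfolding exponential_form_def by blast+
  interpret w: walker_chart A g \<kappa> ?\<phi> by unfold_locales (rule \<kappa>, rule F)
  show "gradient A g f p = (\<lambda>h. \<alpha> * coord_field A \<kappa> 2 p h + deriv \<gamma> (cy \<kappa> p) * coord_field A \<kappa> 1 p h)"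
    by (rule w.gradient_form(1)[OF f F(5,7) p])
  show "g p (gradient A g f p) (gradient A g f p) > 0"
    using w.gradient_form(2)[OF f F(5,7) p] F(1) by simp
  have z: "chart_map \<kappa> p \<in> chart_map \<kappa> ` chart_dom \<kappa>" using p by simp
  have "w.soliton_eq f 0 (chart_map \<kappa> p) u v" for u v
  proof (rule w.soliton_form[OF f F(5,7) z])
    show "2 * deriv (deriv \<gamma>) (chart_map \<kappa> p $ 3) + \<alpha> * w.\<Phi>x (chart_map \<kappa> p) = w.\<Phi>xx (chart_map \<kappa> p)"
      unfolding w.exponential_derivatives[OF F(2-4) refl F(1) z] F(8)[OF imageI[OF p]]
      using F(1) by (simp add: algebra_simps)
  qed
  then show "smooth_vfield_at A p X \<Longrightarrow> smooth_vfield_at A p Y \<Longrightarrow> hessian A g f X Y p + ricci A g X Y p = 0 * g p (X p) (Y p)"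
    using w.soliton_chart[OF f p, of 0] by blast
qed

text \<open>Treated as the case of slope 0 in x of the shared computation for f = \<alpha> x +
  \<gamma>(y); the equation then reads 2 \<gamma>'' = \<Phi>xx = 2 a.\<close>

lemma quadratic_form_soliton:
  assumes f: "smooth_fun_on A UNIV f" and \<kappa>: "\<kappa> \<in> CS" and form: "quadratic_form A g f \<kappa> a b c \<gamma>"
    and p: "p \<in> chart_dom \<kappa>"
  shows "gradient A g f p = (\<lambda>h. deriv \<gamma> (cy \<kappa> p) * coord_field A \<kappa> 1 p h)"
    and "g p (gradient A g f p) (gradient A g f p) = 0"
    and "smooth_vfield_at A p X \<Longrightarrow> smooth_vfield_at A p Y \<Longrightarrow> hessian A g f X Y p + ricci A g X Y p = 0 * g p (X p) (Y p)"
proof -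
  let ?\<phi> = "\<lambda>x y. x\<^sup>2 * a y + x * b y + c y"
  have F: "smooth_on (cy \<kappa> ` chart_dom \<kappa>) a" "smooth_on (cy \<kappa> ` chart_dom \<kappa>) b"
    "smooth_on (cy \<kappa> ` chart_dom \<kappa>) c" "smooth_on (cy \<kappa> ` chart_dom \<kappa>) \<gamma>"
    "walker_form A g \<kappa> ?\<phi>"
    "\<And>p. p \<in> chart_dom \<kappa> \<Longrightarrow> f p = cx \<kappa> p * 0 + \<gamma> (cy \<kappa> p)"
    "\<And>y. y \<in> cy \<kappa> ` chart_dom \<kappa> \<Longrightarrow> deriv (deriv \<gamma>) y = a y"
    using form unfolding quadratic_form_def by (blast, blast, blast, blast, blast, simp, blast)
  interpret w: walker_chart A g \<kappa> ?\<phi> by unfold_locales (rule \<kappa>, rule F)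
  show "gradient A g f p = (\<lambda>h. deriv \<gamma> (cy \<kappa> p) * coord_field A \<kappa> 1 p h)"
    using w.gradient_form(1)[OF f F(4,6) p] by simp
  show "g p (gradient A g f p) (gradient A g f p) = 0"
    using w.gradient_form(2)[OF f F(4,6) p] by simp
  have z: "chart_map \<kappa> p \<in> chart_map \<kappa> ` chart_dom \<kappa>" using p by simp
  have "w.soliton_eq f 0 (chart_map \<kappa> p) u v" for u v
  proof (rule w.soliton_form[OF f F(4,6) z])
    show "2 * deriv (deriv \<gamma>) (chart_map \<kappa> p $ 3) + 0 * w.\<Phi>x (chart_map \<kappa> p) = w.\<Phi>xx (chart_map \<kappa> p)"
      unfolding w.quadratic_derivatives[OF F(1-3) refl z] F(7)[OF imageI[OF p]] by simp
  qed
  then show "smooth_vfield_at A p X \<Longrightarrow> smooth_vfield_at A p Y \<Longrightarrow> hessian A g f X Y p + ricci A g X Y p = 0 * g p (X p) (Y p)"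
    using w.soliton_chart[OF f p, of 0] by blast
qed

end

text \<open>A line transversal to the leaves through the centre c, parametrised by the coordinate y
  itself. Restriction to it turns functions that are constant on leaves into functions of y.\<close>

definition y_axis :: "real^3 \<Rightarrow> real \<Rightarrow> real^3" where "y_axis c y = c + (y - c $ 3) *\<^sub>R e\<^sub>y"

lemma y_axis_in_ball: "z \<in> ball c r \<Longrightarrow> y_axis c (z $ 3) \<in> ball c r"
proof -
  assume z: "z \<in> ball c r"
  have "norm (y_axis c (z $ 3) - c) = \<bar>(z - c) $ 3\<bar>" by (simp add: y_axis_def norm_axis_1)
  also have "\<dots> \<le> norm (z - c)" by (rule component_le_norm_cart)
  also have "\<dots> < r" using z by (simp add: dist_norm norm_minus_commute)
  finally show ?thesis by (simp add: dist_norm norm_minus_commute)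
qed

text \<open>The point is moved to the transversal first along t and then along x. Each move sets a
  coordinate to that of the centre, so the segment stays in the ball.\<close>

lemma constant_on_leaves:
  fixes h :: "real^3 \<Rightarrow> real"
  assumes d: "\<And>z. z \<in> ball c r \<Longrightarrow> h differentiable (at z)"
    and 0: "\<And>z. z \<in> ball c r \<Longrightarrow> fd h z e\<^sub>t = 0" "\<And>z. z \<in> ball c r \<Longrightarrow> fd h z e\<^sub>x = 0"
    and z: "z \<in> ball c r"
  shows "h z = h (y_axis c (z $ 3))"
proof -
  let ?w = "z + (c $ 1 - z $ 1) *\<^sub>R e\<^sub>t"
  have "norm (?w - c) \<le> norm (z - c)"
  proof (rule norm_le_componentwise_cart)
    fix i :: 3 show "norm ((?w - c) $ i) \<le> norm ((z - c) $ i)" using exhaust_3[of i] by auto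
  qed
  then have w: "?w \<in> ball c r" using z by (simp add: dist_norm norm_minus_commute)
  have e: "y_axis c (z $ 3) = ?w + (c $ 2 - z $ 2) *\<^sub>R e\<^sub>x"
    by (simp add: y_axis_def vec_eq_iff forall_3)
  have "h ?w = h z" by (rule constant_along[OF d convex_ball 0(1) z w])
  moreover have "h (?w + (c $ 2 - z $ 2) *\<^sub>R e\<^sub>x) = h ?w"
    by (rule constant_along[OF d convex_ball 0(2) w]) (use y_axis_in_ball[OF z] e in simp_all)
  ultimately show ?thesis unfolding e by simp
qed

lemma constant_on_ball:
  fixes h :: "real^3 \<Rightarrow> real"
  assumes d: "\<And>z. z \<in> ball c r \<Longrightarrow> h differentiable (at z)"
    and 0: "\<And>z. z \<in> ball c r \<Longrightarrow> fd h z e\<^sub>t = 0" "\<And>z. z \<in> ball c r \<Longrightarrow> fd h z e\<^sub>x = 0"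
      "\<And>z. z \<in> ball c r \<Longrightarrow> fd h z e\<^sub>y = 0"
    and z: "z \<in> ball c r"
  shows "h z = h c"
proof -
  have "r > 0" using z by (metis ball_eq_empty empty_iff not_le)
  have "h (c + (z $ 3 - c $ 3) *\<^sub>R e\<^sub>y) = h c"
    by (rule constant_along[OF d convex_ball 0(3)])
      (use y_axis_in_ball[OF z] \<open>r > 0\<close> in \<open>simp_all add: y_axis_def\<close>)
  then show ?thesis using constant_on_leaves[OF d 0(1,2) z] by (simp add: y_axis_def)
qed

lemma y_axis_derivative:
  fixes h :: "real^3 \<Rightarrow> real"
  assumes "h differentiable (at (y_axis c y))"
  shows "deriv (\<lambda>y. h (y_axis c y)) y = fd h (y_axis c y) e\<^sub>y"
proof -
  have "((\<lambda>y. y_axis c y) has_derivative (\<lambda>k. k *\<^sub>R e\<^sub>y)) (at y)"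
    unfolding y_axis_def by (auto intro!: derivative_eq_intros)
  from has_derivative_compose[OF this has_derivative_fd[OF assms]]
  have "((\<lambda>y. h (y_axis c y)) has_derivative (\<lambda>k. fd h (y_axis c y) (k *\<^sub>R e\<^sub>y))) (at y)" .
  moreover have "(\<lambda>k. fd h (y_axis c y) (k *\<^sub>R e\<^sub>y)) = (*) (fd h (y_axis c y) e\<^sub>y)"
    using linear_scale[OF linear_fd[OF assms]] by (auto simp: mult.commute)
  ultimately have "((\<lambda>y. h (y_axis c y)) has_real_derivative fd h (y_axis c y) e\<^sub>y) (at y)"
    by (simp add: has_field_derivative_def)
  then show ?thesis by (rule DERIV_imp_deriv)
qed

lemma smooth_on_y_axis:
  fixes h :: "real^3 \<Rightarrow> real"
  assumes "smooth_on (ball c r) h" "open S" "\<And>y. y \<in> S \<Longrightarrow> y_axis c y \<in> ball c r"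
  shows "smooth_on S (\<lambda>y. h (y_axis c y))"
proof (rule smooth_on_compose[OF assms(1,2) open_ball _ assms(3)])
  show "smooth_on S (y_axis c)"
    unfolding y_axis_def by (intro smooth_intros assms(2))
qed

lemma locally_constant_imp_eq:
  fixes h :: "'a::topological_space \<Rightarrow> 'b"
  assumes "connected (UNIV :: 'a set)" "\<And>p. \<exists>U. open U \<and> p \<in> U \<and> (\<forall>q\<in>U. h q = h p)"
  shows "h p = h q"
proof -
  have "h constant_on UNIV"
    by (rule locally_constant_imp_constant[OF assms(1)]) (use assms(2) in simp)
  then show ?thesis by (auto simp: constant_on_def)
qed

section \<open>Solving the soliton equation in a Walker chart\<close>

context walker_chart
begin

context
  fixes f :: "'a \<Rightarrow> real" and l :: real
  assumes f: "smooth_fun_on A UNIV f"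
    and soliton: "\<And>z u v. z \<in> \<Omega> \<Longrightarrow> soliton_eq f l z u v"
begin

abbreviation "Ft \<equiv> \<lambda>z. fd (F f) z e\<^sub>t"
abbreviation "Fx \<equiv> \<lambda>z. fd (F f) z e\<^sub>x"
abbreviation "Fy \<equiv> \<lambda>z. fd (F f) z e\<^sub>y"

lemma sF: "smooth_on \<Omega> (F f)" by (rule F_smooth[OF f])

lemma soliton_equations:
  assumes z: "z \<in> \<Omega>"
  shows "fd Ft z e\<^sub>t = 0" "fd Ft z e\<^sub>x = 0" "fd Ft z e\<^sub>y = l" "fd Fx z e\<^sub>t = 0" "fd Fx z e\<^sub>x = l"
    "fd Fx z e\<^sub>y = 1/2 * \<Phi>x z * Ft z" "fd Fy z e\<^sub>t = l"
    "fd Fy z e\<^sub>y - 1/2 * \<Phi>y z * Ft z + 1/2 * \<Phi>x z * Fx z - 1/2 * \<Phi>xx z = l * \<Phi> z"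
proof -
  note lin = linear_fd[OF smooth_onD[OF sF z]]
  note eq = soliton[OF z, unfolded soliton_eq_def[OF f] G_walker[OF z] \<Gamma>_def]
  note simps = linear_0[OF lin] linear_scale[OF lin] linear_diff[OF lin]
  show "fd Ft z e\<^sub>t = 0" using eq[of e\<^sub>t e\<^sub>t] by (simp add: simps)
  show "fd Ft z e\<^sub>x = 0" using eq[of e\<^sub>t e\<^sub>x] by (simp add: simps)
  show "fd Ft z e\<^sub>y = l" using eq[of e\<^sub>t e\<^sub>y] by (simp add: simps)
  show "fd Fx z e\<^sub>t = 0" using eq[of e\<^sub>x e\<^sub>t] by (simp add: simps)
  show "fd Fx z e\<^sub>x = l" using eq[of e\<^sub>x e\<^sub>x] by (simp add: simps)
  show "fd Fx z e\<^sub>y = 1/2 * \<Phi>x z * Ft z" using eq[of e\<^sub>x e\<^sub>y] by (simp add: simps)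
  show "fd Fy z e\<^sub>t = l" using eq[of e\<^sub>y e\<^sub>t] by (simp add: simps)
  show "fd Fy z e\<^sub>y - 1/2 * \<Phi>y z * Ft z + 1/2 * \<Phi>x z * Fx z - 1/2 * \<Phi>xx z = l * \<Phi> z"
    using eq[of e\<^sub>y e\<^sub>y] by (simp add: simps)
qed

text \<open>Differentiate the \<open>(y, x)\<close> equation in direction \<open>x\<close>, and the result in direction \<open>y\<close>.\<close>

lemma \<Phi>xx_Ft:
  assumes z: "z \<in> \<Omega>"
  shows "\<Phi>xx z * Ft z = 0"
proof -
  note d = smooth_onD[OF smooth_on_fd[OF \<Phi>_smooth, of e\<^sub>x] z] smooth_onD[OF smooth_on_fd[OF sF, of e\<^sub>t] z]
  have "fd (\<lambda>z. fd Fx z e\<^sub>y) z e\<^sub>x = fd (\<lambda>z. fd Fx z e\<^sub>x) z e\<^sub>y"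
    by (rule fd_fd_commute[OF openZ z smooth_on_fd[OF sF]])
  also have "\<dots> = fd (\<lambda>z. l) z e\<^sub>y"
    by (rule fd_fun_cong[OF openZ z]) (rule soliton_equations)
  also have "\<dots> = 0" by simp
  finally have "fd (\<lambda>z. fd Fx z e\<^sub>y) z e\<^sub>x = 0" .
  moreover have "fd (\<lambda>z. fd Fx z e\<^sub>y) z e\<^sub>x = fd (\<lambda>z. (1/2 * \<Phi>x z) * Ft z) z e\<^sub>x"
    by (rule fd_fun_cong[OF openZ z]) (rule soliton_equations)
  moreover have "fd (\<lambda>z. (1/2 * \<Phi>x z) * Ft z) z e\<^sub>x = (1/2 * \<Phi>x z) * fd Ft z e\<^sub>x + (1/2 * \<Phi>xx z) * Ft z"
    unfolding fd_eq[OF has_derivative_mult[OF has_derivative_mult_right[OF has_derivative_fd[OF d(1)]] has_derivative_fd[OF d(2)]]] ..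
  ultimately show ?thesis by (simp add: soliton_equations[OF z])
qed

lemma l_\<Phi>xx:
  assumes z: "z \<in> \<Omega>"
  shows "l * \<Phi>xx z = 0"
proof -
  note d = smooth_onD[OF smooth_on_fd[OF smooth_on_fd[OF \<Phi>_smooth, of e\<^sub>x], of e\<^sub>x] z]
    smooth_onD[OF smooth_on_fd[OF sF, of e\<^sub>t] z]
  have "fd (\<lambda>z. \<Phi>xx z * Ft z) z e\<^sub>y = fd (\<lambda>z. 0) z e\<^sub>y"
    by (rule fd_fun_cong[OF openZ z]) (rule \<Phi>xx_Ft)
  then have "\<Phi>xx z * l + fd \<Phi>xx z e\<^sub>y * Ft z = 0"
    using fd_mult[OF d, of e\<^sub>y] by (simp add: soliton_equations[OF z])
  \<comment> \<open>Multiplication by \<Phi>xx makes the second summand vanish by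
    \<open>\<Phi>xx_Ft\<close>, so that l \<Phi>xx^2 = 0.\<close>
  then have "\<Phi>xx z * (\<Phi>xx z * l) + fd \<Phi>xx z e\<^sub>y * (\<Phi>xx z * Ft z) = 0" by algebra
  then show ?thesis using \<Phi>xx_Ft[OF z] by auto
qed

context
  fixes c :: "real^3" and r :: real
  assumes l: "l = 0" and ball: "\<Omega> = ball c r"
begin

text \<open>For l = 0 the first three soliton equations say that all partial derivatives of
  \<open>Ft\<close> vanish. With \<open>Ft\<close> = 0 the next three say the same of
  \<open>Fx\<close>.\<close>

lemma Ft_constant: "z \<in> \<Omega> \<Longrightarrow> Ft z = Ft c"
  using soliton_equations(1-3) smooth_onD[OF smooth_on_fd[OF sF]] unfolding l ball
  by (intro constant_on_ball) auto

context
  assumes Ft0: "\<And>z. z \<in> \<Omega> \<Longrightarrow> Ft z = 0"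
begin

lemma Fx_constant: "z \<in> \<Omega> \<Longrightarrow> Fx z = Fx c"
proof -
  have "fd Fx z e\<^sub>y = 0" if "z \<in> \<Omega>" for z using soliton_equations(6)[OF that] Ft0[OF that] by simp
  then show "z \<in> \<Omega> \<Longrightarrow> Fx z = Fx c"
    using soliton_equations(4,5) smooth_onD[OF smooth_on_fd[OF sF]] unfolding l ball
    by (intro constant_on_ball) auto
qed

lemma gradient_norm:
  assumes p: "p \<in> chart_dom \<kappa>"
  shows "g p (gradient A g f p) (gradient A g f p) = (Fx (chart_map \<kappa> p))\<^sup>2"
proof -
  have z: "chart_map \<kappa> p \<in> \<Omega>" using p by simp
  show ?thesis
    unfolding gradient_chart[OF f p] G_chart_map[OF cs p, symmetric] G_walker[OF z] Ft0[OF z]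
    by (simp add: power2_eq_square)
qed

context
  fixes \<alpha> :: real
  assumes Fx: "\<And>z. z \<in> \<Omega> \<Longrightarrow> Fx z = \<alpha>"
begin

text \<open>The second y-derivative of f in the chart. It is constant on leaves, it is the
  inhomogeneity of the equation for \<Phi>x, and on the transversal it is \<gamma>''.\<close>

definition W :: "real^3 \<Rightarrow> real" where "W = (\<lambda>z. fd Fy z e\<^sub>y)"

lemma W_smooth: "smooth_on \<Omega> W" unfolding W_def by (intro smooth_on_fd sF)

lemma fd_W:
  assumes z: "z \<in> \<Omega>" shows "fd W z e\<^sub>t = 0" "fd W z e\<^sub>x = 0"
proof -
  have "fd W z v = 0" if v: "\<And>z. z \<in> \<Omega> \<Longrightarrow> fd Fy z v = 0" for v
  proof -
    have "fd W z v = fd (\<lambda>z. fd Fy z v) z e\<^sub>y"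
      unfolding W_def by (rule fd_fd_commute[OF openZ z smooth_on_fd[OF sF]])
    also have "\<dots> = fd (\<lambda>z. 0) z e\<^sub>y" by (rule fd_fun_cong[OF openZ z v])
    finally show ?thesis by simp
  qed
  moreover have "fd Fy z e\<^sub>t = 0" if "z \<in> \<Omega>" for z using soliton_equations(7)[OF that] l by simp
  moreover have "fd Fy z e\<^sub>x = 0" if z: "z \<in> \<Omega>" for z
  proof -
    have "fd Fy z e\<^sub>x = fd Fx z e\<^sub>y" by (rule fd_fd_commute[OF openZ z sF])
    then show ?thesis using soliton_equations(6)[OF z] Ft0[OF z] by simp
  qed
  ultimately show "fd W z e\<^sub>t = 0" "fd W z e\<^sub>x = 0" by blast+
qed

lemma \<Phi>xx_ode: "z \<in> \<Omega> \<Longrightarrow> \<Phi>xx z = \<alpha> * \<Phi>x z + 2 * W z"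
  using soliton_equations(8)[of z] Ft0[of z] Fx[of z] l by (simp add: W_def algebra_simps)

lemma \<Phi>x_t: "z \<in> \<Omega> \<Longrightarrow> fd \<Phi>x z e\<^sub>t = 0"
  using fd_fd_\<Phi>(1)[of z e\<^sub>t] by simp

text \<open>f - \<alpha> x is constant on leaves; \<gamma> is its restriction to the
  transversal.\<close>

definition \<gamma> :: "real \<Rightarrow> real" where "\<gamma> y = F f (y_axis c y) - y_axis c y $ 2 * \<alpha>"

lemma y_axis_in: "y \<in> cy \<kappa> ` chart_dom \<kappa> \<Longrightarrow> y_axis c y \<in> \<Omega>"
proof -
  assume "y \<in> cy \<kappa> ` chart_dom \<kappa>"
  then obtain p where p: "p \<in> chart_dom \<kappa>" "y = cy \<kappa> p" by auto
  then have "chart_map \<kappa> p \<in> ball c r" using ball by blast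
  from y_axis_in_ball[OF this] show ?thesis using p(2) ball by simp
qed

lemma smooth_on_cy:
  assumes "smooth_on \<Omega> (h :: real^3 \<Rightarrow> real)" shows "smooth_on (cy \<kappa> ` chart_dom \<kappa>) (\<lambda>y. h (y_axis c y))"
  by (rule smooth_on_y_axis[OF assms[unfolded ball] open_cy]) (use y_axis_in in \<open>simp add: ball\<close>)

lemma nth_has_derivative: "((\<lambda>z::real^3. z $ i) has_derivative (\<lambda>v. v $ i)) (at z)"
  by (intro bounded_linear_imp_has_derivative bounded_linear_vec_nth)

lemma leafwise_const:
  fixes h :: "real^3 \<Rightarrow> real"
  assumes "smooth_on \<Omega> h" "\<And>z. z \<in> \<Omega> \<Longrightarrow> fd h z e\<^sub>t = 0" "\<And>z. z \<in> \<Omega> \<Longrightarrow> fd h z e\<^sub>x = 0" "z \<in> \<Omega>"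
  shows "h z = h (y_axis c (z $ 3))"
  by (rule constant_on_leaves[where h=h and c=c and r=r, folded ball]) (fact smooth_onD[OF assms(1)] assms(2-4))+

lemma \<gamma>_props:
  shows "smooth_on (cy \<kappa> ` chart_dom \<kappa>) \<gamma>"
    and "p \<in> chart_dom \<kappa> \<Longrightarrow> f p = cx \<kappa> p * \<alpha> + \<gamma> (cy \<kappa> p)"
    and "y \<in> cy \<kappa> ` chart_dom \<kappa> \<Longrightarrow> deriv (deriv \<gamma>) y = W (y_axis c y)"
proof -
  define h where "h = (\<lambda>z. F f z - z $ 2 * \<alpha>)"
  have \<gamma>h: "\<gamma> = (\<lambda>y. h (y_axis c y))" by (simp add: \<gamma>_def[abs_def] h_def)
  have sh: "smooth_on \<Omega> h" unfolding h_def by (intro smooth_intros openZ sF)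
  have dh: "fd h z v = fd (F f) z v - v $ 2 * \<alpha>" if z: "z \<in> \<Omega>" for z v
    using fd_eq[OF has_derivative_diff[OF smooth_on_has_derivative[OF sF z] has_derivative_mult_left[OF nth_has_derivative]]]
    unfolding h_def by simp
  show s: "smooth_on (cy \<kappa> ` chart_dom \<kappa>) \<gamma>" unfolding \<gamma>h by (rule smooth_on_cy[OF sh])
  have leafwise_const: "h z = h (y_axis c (z $ 3))" if "z \<in> \<Omega>" for z
    by (rule leafwise_const[OF sh _ _ that]) (simp_all add: dh Ft0 Fx)
  show "f p = cx \<kappa> p * \<alpha> + \<gamma> (cy \<kappa> p)" if "p \<in> chart_dom \<kappa>"
    using leafwise_const[of "chart_map \<kappa> p"] that by (simp add: \<gamma>h) (simp add: h_def F_def[OF f])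
  have 1: "deriv \<gamma> y = Fy (y_axis c y)" if "y \<in> cy \<kappa> ` chart_dom \<kappa>" for y
    unfolding \<gamma>h y_axis_derivative[OF smooth_onD[OF sh y_axis_in[OF that]]] dh[OF y_axis_in[OF that]] by simp
  show "deriv (deriv \<gamma>) y = W (y_axis c y)" if y: "y \<in> cy \<kappa> ` chart_dom \<kappa>"
  proof -
    have "\<forall>\<^sub>F y in nhds y. deriv \<gamma> y = Fy (y_axis c y)"
      unfolding eventually_nhds using open_cy y 1 by blast
    then have "deriv (deriv \<gamma>) y = deriv (\<lambda>y. Fy (y_axis c y)) y" by (rule deriv_cong_ev) simp
    also have "\<dots> = W (y_axis c y)"
      unfolding W_def by (rule y_axis_derivative[OF smooth_onD[OF smooth_on_fd[OF sF] y_axis_in[OF y]]])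
    finally show ?thesis .
  qed
qed

text \<open>The equation \<open>\<Phi>xx = \<alpha> \<Phi>x + 2 W\<close> is linear in \<open>x\<close> and is integrated explicitly: \<open>h1\<close> and \<open>h2\<close>
  below are its first integrals, so they depend on \<open>y\<close> only.\<close>

lemma quadratic_form_exists:
  assumes \<alpha>: "\<alpha> = 0"
  shows "\<exists>a b c \<gamma>. quadratic_form A g f \<kappa> a b c \<gamma>"
proof -
  \<comment> \<open>Here \<Phi>xx = 2 W with W constant along x, so \<open>h1\<close> is the linear
    coefficient and \<open>h2\<close> the constant term of the quadratic polynomial \<Phi> in
    x.\<close>
  define h1 where "h1 = (\<lambda>z. \<Phi>x z - 2 * z $ 2 * W z)"
  define h2 where "h2 = (\<lambda>z. \<Phi> z - z $ 2 * z $ 2 * W z - z $ 2 * h1 z)"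
  have s1: "smooth_on \<Omega> h1" unfolding h1_def by (intro smooth_intros openZ \<Phi>_smooth W_smooth)
  have s2: "smooth_on \<Omega> h2" unfolding h2_def by (intro smooth_intros openZ \<Phi>_smooth W_smooth s1)
  have d1: "fd h1 z v = fd \<Phi>x z v - (2 * z $ 2 * fd W z v + 2 * v $ 2 * W z)" if z: "z \<in> \<Omega>" for z v
    using fd_eq[OF has_derivative_diff[OF smooth_on_has_derivative[OF smooth_on_fd[OF \<Phi>_smooth] z]
          has_derivative_mult[OF has_derivative_mult_right[OF nth_has_derivative] smooth_on_has_derivative[OF W_smooth z]]]]
    unfolding h1_def by simp
  have z1: "fd h1 z e\<^sub>t = 0" "fd h1 z e\<^sub>x = 0" if "z \<in> \<Omega>" for z
    using d1[OF that] \<Phi>x_t[OF that] \<Phi>xx_ode[OF that] fd_W[OF that] \<alpha> by simp_all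
  have d2: "fd h2 z v = fd \<Phi> z v - (z $ 2 * z $ 2 * fd W z v + (z $ 2 * v $ 2 + v $ 2 * z $ 2) * W z)
      - (z $ 2 * fd h1 z v + v $ 2 * h1 z)" if z: "z \<in> \<Omega>" for z v
    using fd_eq[OF has_derivative_diff[OF has_derivative_diff[OF smooth_on_has_derivative[OF \<Phi>_smooth z]
          has_derivative_mult[OF has_derivative_mult[OF nth_has_derivative nth_has_derivative] smooth_on_has_derivative[OF W_smooth z]]]
          has_derivative_mult[OF nth_has_derivative smooth_on_has_derivative[OF s1 z]]], of 2 2 2]
    unfolding h2_def by simp
  have z2: "fd h2 z e\<^sub>t = 0" "fd h2 z e\<^sub>x = 0" if "z \<in> \<Omega>" for z
    using d2[OF that] fd_\<Phi>_t[OF that] z1[OF that] fd_W[OF that] by (simp_all add: h1_def)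
  have \<Phi>: "\<Phi> z = (z $ 2)\<^sup>2 * W (y_axis c (z $ 3)) + z $ 2 * h1 (y_axis c (z $ 3)) + h2 (y_axis c (z $ 3))" if "z \<in> \<Omega>" for z
  proof -
    have "\<Phi> z = (z $ 2)\<^sup>2 * W z + z $ 2 * h1 z + h2 z" by (simp add: h2_def power2_eq_square)
    then show ?thesis using leafwise_const[OF W_smooth fd_W that] leafwise_const[OF s1 z1 that] leafwise_const[OF s2 z2 that] by (simp only:)
  qed
  have "walker_form A g \<kappa> (\<lambda>x y. x\<^sup>2 * W (y_axis c y) + x * h1 (y_axis c y) + h2 (y_axis c y))"
    by (rule walker_form_cong[OF walker]) (rule \<Phi>[unfolded \<Phi>_def, OF imageI])
  moreover have "\<forall>p\<in>chart_dom \<kappa>. f p = \<gamma> (cy \<kappa> p)" using \<gamma>_props(2) \<alpha> by simp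
  ultimately have "quadratic_form A g f \<kappa> (\<lambda>y. W (y_axis c y)) (\<lambda>y. h1 (y_axis c y)) (\<lambda>y. h2 (y_axis c y)) \<gamma>"
    unfolding quadratic_form_def
    using smooth_on_cy[OF W_smooth] smooth_on_cy[OF s1] smooth_on_cy[OF s2] \<gamma>_props(1,3) by blast
  then show ?thesis by blast
qed

lemma exponential_form_exists:
  assumes \<alpha>: "\<alpha> \<noteq> 0"
  shows "\<exists>a b c \<gamma>. exponential_form A g f \<kappa> \<alpha> a b c \<gamma>"
proof -
  \<comment> \<open>The particular solution of the equation for \<Phi>x that is constant in x:
    \<Phi>xx = \<alpha> (\<Phi>x - B). So \<Phi>x - B is a multiple of exp (\<alpha> x) on each
    leaf, and \<open>h1\<close> is the multiple.\<close>
  define B where "B = (\<lambda>z. - (2 / \<alpha>) * W z)"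
  define h1 where "h1 = (\<lambda>z. exp (- \<alpha> * z $ 2) * (\<Phi>x z - B z))"
  define h2 where "h2 = (\<lambda>z. \<Phi> z - z $ 2 * B z - 1 / \<alpha> * h1 z * exp (\<alpha> * z $ 2))"
  have sB: "smooth_on \<Omega> B" unfolding B_def by (intro smooth_intros openZ W_smooth)
  have s1: "smooth_on \<Omega> h1" unfolding h1_def by (intro smooth_intros smooth_on_exp openZ \<Phi>_smooth sB)
  have s2: "smooth_on \<Omega> h2" unfolding h2_def by (intro smooth_intros smooth_on_exp openZ \<Phi>_smooth sB s1)
  have zB: "fd B z e\<^sub>t = 0" "fd B z e\<^sub>x = 0" if z: "z \<in> \<Omega>" for z
    using fd_eq[OF has_derivative_mult_right[OF smooth_on_has_derivative[OF W_smooth z], of "- (2 / \<alpha>)"]] fd_W[OF z]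
    unfolding B_def by simp_all
  have e: "((\<lambda>z::real^3. exp (k * z $ 2)) has_derivative (\<lambda>v. exp (k * z $ 2) * (k * v $ 2))) (at z)" for z k
    by (rule has_derivative_eq_rhs[OF has_derivative_exp[OF has_derivative_mult_right[OF nth_has_derivative]]]) (simp add: mult_ac)
  have d1: "fd h1 z v = exp (- \<alpha> * z $ 2) * (fd \<Phi>x z v - fd B z v) + exp (- \<alpha> * z $ 2) * (- \<alpha> * v $ 2) * (\<Phi>x z - B z)"
    if z: "z \<in> \<Omega>" for z v
    unfolding h1_def
      fd_eq[OF has_derivative_mult[OF e has_derivative_diff[OF smooth_on_has_derivative[OF smooth_on_fd[OF \<Phi>_smooth] z]
          smooth_on_has_derivative[OF sB z]]]] ..
  have ode: "\<Phi>xx z = \<alpha> * (\<Phi>x z - B z)" if "z \<in> \<Omega>" for z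
    using \<Phi>xx_ode[OF that] \<alpha> by (simp add: B_def field_simps)
  have z1: "fd h1 z e\<^sub>t = 0" "fd h1 z e\<^sub>x = 0" if "z \<in> \<Omega>" for z
    using d1[OF that] \<Phi>x_t[OF that] ode[OF that] zB[OF that] by simp_all
  have d2: "fd h2 z v = fd \<Phi> z v - (z $ 2 * fd B z v + v $ 2 * B z)
      - (1 / \<alpha> * h1 z * (exp (\<alpha> * z $ 2) * (\<alpha> * v $ 2)) + 1 / \<alpha> * fd h1 z v * exp (\<alpha> * z $ 2))" if z: "z \<in> \<Omega>" for z v
    unfolding h2_def
      fd_eq[OF has_derivative_diff[OF has_derivative_diff[OF smooth_on_has_derivative[OF \<Phi>_smooth z]
          has_derivative_mult[OF nth_has_derivative smooth_on_has_derivative[OF sB z]]]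
          has_derivative_mult[OF has_derivative_mult_right[OF smooth_on_has_derivative[OF s1 z]] e]]] ..
  have h1e: "h1 z * exp (\<alpha> * z $ 2) = \<Phi>x z - B z" for z
  proof -
    have "h1 z * exp (\<alpha> * z $ 2) = (exp (- \<alpha> * z $ 2) * exp (\<alpha> * z $ 2)) * (\<Phi>x z - B z)"
      unfolding h1_def by (simp only: mult_ac)
    also have "exp (- \<alpha> * z $ 2) * exp (\<alpha> * z $ 2) = 1" by (simp add: exp_add[symmetric])
    finally show ?thesis by simp
  qed
  have z2: "fd h2 z e\<^sub>t = 0" "fd h2 z e\<^sub>x = 0" if "z \<in> \<Omega>" for z
  proof -
    show "fd h2 z e\<^sub>t = 0" unfolding d2[OF that] using fd_\<Phi>_t[OF that] z1(1)[OF that] zB(1)[OF that] by simp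
    have "1 / \<alpha> * h1 z * (exp (\<alpha> * z $ 2) * \<alpha>) = \<Phi>x z - B z" using h1e[of z] \<alpha> by simp
    then show "fd h2 z e\<^sub>x = 0" unfolding d2[OF that] using z1(2)[OF that] zB(2)[OF that] by simp
  qed
  \<comment> \<open>Integrating \<Phi>x once more gives h1 exp (\<alpha> x) / \<alpha>; the
    normalisation 1/\<alpha>^2 in the normal form therefore forces a = \<alpha> h1. The choice b = B
    is compatible with \<gamma>'' = W by the definition of \<open>B\<close>.\<close>
  have \<Phi>: "\<Phi> z = 1 / \<alpha>\<^sup>2 * (\<alpha> * h1 (y_axis c (z $ 3))) * exp (\<alpha> * z $ 2) + z $ 2 * B (y_axis c (z $ 3)) + h2 (y_axis c (z $ 3))"
    if "z \<in> \<Omega>" for z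
  proof -
    have "\<Phi> z = 1 / \<alpha>\<^sup>2 * (\<alpha> * h1 z) * exp (\<alpha> * z $ 2) + z $ 2 * B z + h2 z"
      using \<alpha> by (simp add: h2_def power2_eq_square)
    then show ?thesis
      using leafwise_const[OF sB zB that] leafwise_const[OF s1 z1 that] leafwise_const[OF s2 z2 that] by (simp only:)
  qed
  have w: "walker_form A g \<kappa> (\<lambda>x y. 1 / \<alpha>\<^sup>2 * (\<alpha> * h1 (y_axis c y)) * exp (\<alpha> * x) + x * B (y_axis c y) + h2 (y_axis c y))"
    by (rule walker_form_cong[OF walker]) (rule \<Phi>[unfolded \<Phi>_def, OF imageI])
  have sa: "smooth_on (cy \<kappa> ` chart_dom \<kappa>) (\<lambda>y. \<alpha> * h1 (y_axis c y))"
    by (intro smooth_on_mult open_cy smooth_on_const smooth_on_cy[OF s1])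
  have dd: "\<forall>y\<in>cy \<kappa> ` chart_dom \<kappa>. deriv (deriv \<gamma>) y = - (1 / 2) * \<alpha> * B (y_axis c y)"
    using \<gamma>_props(3) \<alpha> by (simp add: B_def)
  have "exponential_form A g f \<kappa> \<alpha> (\<lambda>y. \<alpha> * h1 (y_axis c y)) (\<lambda>y. B (y_axis c y)) (\<lambda>y. h2 (y_axis c y)) \<gamma>"
    unfolding exponential_form_def
    using \<alpha> sa smooth_on_cy[OF sB] smooth_on_cy[OF s2] \<gamma>_props(1,2) w dd by blast
  then show ?thesis by blast
qed

end

end

end

end

text \<open>The reflection x \<mapsto> -x preserves dx^2, dt and dy, hence the Walker form and
  \<partial>t, and reverses \<partial>x. It is obtained through \<open>new_chart\<close> so that the
  image is again a ball.\<close>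

lemma flipped_chart:
  assumes f: "smooth_fun_on A UNIV f" and p: "p \<in> chart_dom \<kappa>"
  obtains \<mu> r where "\<mu> \<in> CS" "p \<in> chart_dom \<mu>" "chart_dom \<mu> \<subseteq> chart_dom \<kappa>"
    "walker_form A g \<mu> (\<lambda>x y. \<phi> (- x) y)" "chart_map \<mu> ` chart_dom \<mu> = ball (chart_map \<mu> p) r" "r > 0"
    "\<And>q. q \<in> chart_dom \<mu> \<Longrightarrow> coord_tangent A \<mu> q e\<^sub>t = coord_tangent A \<kappa> q e\<^sub>t"
    "\<And>q. q \<in> chart_dom \<mu> \<Longrightarrow> coord_tangent A \<mu> q e\<^sub>x f = - coord_tangent A \<kappa> q e\<^sub>x f"
proof -
  define \<Psi> :: "real^3 \<Rightarrow> real^3" where "\<Psi> = (\<lambda>v. v $ 1 *\<^sub>R e\<^sub>t + (- v $ 2) *\<^sub>R e\<^sub>x + v $ 3 *\<^sub>R e\<^sub>y)"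
  have "linear \<Psi>" unfolding \<Psi>_def by (intro linearI) (simp_all add: vec_eq_iff forall_3)
  then have bl: "bounded_linear \<Psi>" by (simp add: linear_conv_bounded_linear)
  note d = bounded_linear_imp_has_derivative[OF bl]
  have d\<Psi>: "fd \<Psi> z = \<Psi>" for z by (rule fd_eq[OF d])
  have \<Psi>\<Psi>: "\<Psi> (\<Psi> v) = v" for v by (simp add: \<Psi>_def vec_eq_iff forall_3)
  have \<Psi>nth: "\<Psi> v $ 1 = v $ 1" "\<Psi> v $ 2 = - v $ 2" "\<Psi> v $ 3 = v $ 3" for v by (simp_all add: \<Psi>_def)
  have inj: "v = 0" if "fd \<Psi> (chart_map \<kappa> p) v = 0" for v
    using \<Psi>\<Psi>[of v] that linear_0[OF \<open>linear \<Psi>\<close>] unfolding d\<Psi> by simp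
  obtain \<mu> r where \<mu>: "\<mu> \<in> CS" "p \<in> chart_dom \<mu>" "chart_dom \<mu> \<subseteq> chart_dom \<kappa>"
    "chart_map \<kappa> ` chart_dom \<mu> \<subseteq> UNIV" "\<And>q. chart_map \<mu> q = \<Psi> (chart_map \<kappa> q)"
    "r > 0" "chart_map \<mu> ` chart_dom \<mu> = ball (chart_map \<mu> p) r"
    by (rule new_chart[OF cs p UNIV_I open_UNIV smooth_on_bounded_linear[OF bl] inj]) auto
  have flip: "coord_tangent A \<mu> q w = coord_tangent A \<kappa> q (\<Psi> w)" if q: "q \<in> chart_dom \<mu>" for q w
  proof -
    have qk: "q \<in> chart_dom \<kappa>" using q \<mu>(3) by blast
    obtain v where v: "coord_tangent A \<mu> q w = coord_tangent A \<kappa> q v"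
      using coord_tangent_change[OF cs \<mu>(1) qk q, of w] by (rule that)
    have "w $ i = \<Psi> v $ i" for i
    proof -
      have "w $ i = coord_tangent A \<kappa> q v (\<lambda>q. chart_map \<mu> q $ i)"
        unfolding v[symmetric] by (rule coord_tangent_coordinate[OF \<mu>(1) q, symmetric])
      also have "\<dots> = fd \<Psi> (chart_map \<kappa> q) v $ i"
        by (rule coord_tangent_new_coordinate[OF cs \<mu>(1) q \<mu>(3) \<mu>(5)]) (use d in \<open>auto simp: differentiable_def\<close>)
      finally show ?thesis unfolding d\<Psi> .
    qed
    then have "w = \<Psi> v" by (simp add: vec_eq_iff)
    then show ?thesis using v \<Psi>\<Psi>[of v] by simp
  qed
  have w: "walker_form A g \<mu> (\<lambda>x y. \<phi> (- x) y)"
    unfolding walker_form_def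
  proof (intro ballI)
    fix q D E assume q: "q \<in> chart_dom \<mu>" and DE: "D \<in> tangent_space A q" "E \<in> tangent_space A q"
    have qk: "q \<in> chart_dom \<kappa>" using q \<mu>(3) by blast
    obtain u v where uv: "D = coord_tangent A \<mu> q u" "E = coord_tangent A \<mu> q v"
      using DE unfolding tangent_space_eq[OF \<mu>(1) q] by auto
    have uvk: "D = coord_tangent A \<kappa> q (\<Psi> u)" "E = coord_tangent A \<kappa> q (\<Psi> v)"
      unfolding uv flip[OF q] by simp_all
    have co: "D (ct \<mu>) = u $ 1" "D (cx \<mu>) = u $ 2" "D (cy \<mu>) = u $ 3"
      "E (ct \<mu>) = v $ 1" "E (cx \<mu>) = v $ 2" "E (cy \<mu>) = v $ 3"
      unfolding uv by (rule coord_tangent_coordinate[OF \<mu>(1) q])+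
    have cok: "D (ct \<kappa>) = u $ 1" "D (cx \<kappa>) = - u $ 2" "D (cy \<kappa>) = u $ 3"
      "E (ct \<kappa>) = v $ 1" "E (cx \<kappa>) = - v $ 2" "E (cy \<kappa>) = v $ 3"
      unfolding uvk coord_tangent_coordinate[OF cs qk] \<Psi>nth by simp_all
    show "g q D E = D (ct \<mu>) * E (cy \<mu>) + D (cy \<mu>) * E (ct \<mu>) + D (cx \<mu>) * E (cx \<mu>)
        + \<phi> (- cx \<mu> q) (cy \<mu> q) * D (cy \<mu>) * E (cy \<mu>)"
      using walker[unfolded walker_form_def, rule_format, OF qk DE] unfolding co cok by (simp add: \<mu>(5) \<Psi>nth)
  qed
  have 1: "coord_tangent A \<mu> q e\<^sub>t = coord_tangent A \<kappa> q e\<^sub>t" if "q \<in> chart_dom \<mu>" for q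
    unfolding flip[OF that] by (simp add: \<Psi>_def)
  have 2: "coord_tangent A \<mu> q e\<^sub>x f = - coord_tangent A \<kappa> q e\<^sub>x f" if "q \<in> chart_dom \<mu>" for q
  proof -
    have qk: "q \<in> chart_dom \<kappa>" using that \<mu>(3) by blast
    have e: "\<Psi> e\<^sub>x = - 1 *\<^sub>R e\<^sub>x + 0 *\<^sub>R e\<^sub>x" by (simp add: \<Psi>_def)
    have "coord_tangent A \<kappa> q (\<Psi> e\<^sub>x) = (\<lambda>h. - 1 * coord_tangent A \<kappa> q e\<^sub>x h + 0 * coord_tangent A \<kappa> q e\<^sub>x h)"
      unfolding e by (rule coord_tangent_linear[OF cs qk])
    then show ?thesis unfolding flip[OF that] by simp
  qed
  show thesis by (rule that[OF \<mu>(1-3) w \<mu>(7,6) 1 2])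
qed

end

section \<open>The chart results in terms of chart-independent data\<close>

context walker_chart
begin

lemma soliton_eqI:
  assumes "smooth_fun_on A UNIV f" "ricci_soliton_const A g f l" "z \<in> \<Omega>"
  shows "soliton_eq f l z u v"
proof -
  obtain p where p: "p \<in> chart_dom \<kappa>" "z = chart_map \<kappa> p" using assms(3) by auto
  show ?thesis
    using soliton_chart[OF assms(1) p(1), of l] assms(2) unfolding ricci_soliton_const_def p(2) by blast
qed

lemma fd_F_eq:
  assumes "smooth_fun_on A UNIV f" "q \<in> chart_dom \<kappa>"
  shows "fd (F f) (chart_map \<kappa> q) v = coord_tangent A \<kappa> q v f"
  using coord_tangent_apply[OF f_at[OF assms(1)], of \<kappa> q v] by (simp add: F_def[OF assms(1)])

text \<open>With f_t = 0 the gradient is f_y \<partial>t + f_x \<partial>x, where \<partial>t is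
  null and orthogonal to \<partial>x. This ties the chart-dependent f_x to an invariant, up to
  sign.\<close>

lemma soliton_gradient_norm:
  assumes f: "smooth_fun_on A UNIV f" and sol: "ricci_soliton_const A g f 0"
    and ball: "\<Omega> = ball c r" and t: "\<And>q. q \<in> chart_dom \<kappa> \<Longrightarrow> coord_tangent A \<kappa> q e\<^sub>t f = 0"
    and p: "p \<in> chart_dom \<kappa>"
  shows "g p (gradient A g f p) (gradient A g f p) = (coord_tangent A \<kappa> p e\<^sub>x f)\<^sup>2"
    and "q \<in> chart_dom \<kappa> \<Longrightarrow> coord_tangent A \<kappa> q e\<^sub>x f = coord_tangent A \<kappa> p e\<^sub>x f"
proof -
  note eq = soliton_eqI[OF f sol]
  have Ft0: "fd (F f) z e\<^sub>t = 0" if "z \<in> \<Omega>" for z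
    using that fd_F_eq[OF f] t by auto
  show "g p (gradient A g f p) (gradient A g f p) = (coord_tangent A \<kappa> p e\<^sub>x f)\<^sup>2"
    unfolding fd_F_eq[OF f p, symmetric] by (rule gradient_norm[OF f eq refl ball Ft0 p])
  show "coord_tangent A \<kappa> q e\<^sub>x f = coord_tangent A \<kappa> p e\<^sub>x f" if q: "q \<in> chart_dom \<kappa>"
    unfolding fd_F_eq[OF f p, symmetric] fd_F_eq[OF f q, symmetric]
    using Fx_constant[OF f eq refl ball Ft0 imageI[OF p]] Fx_constant[OF f eq refl ball Ft0 imageI[OF q]] by simp
qed

lemma soliton_form_exists:
  assumes f: "smooth_fun_on A UNIV f" and sol: "ricci_soliton_const A g f 0"
    and ball: "\<Omega> = ball c r" and t: "\<And>q. q \<in> chart_dom \<kappa> \<Longrightarrow> coord_tangent A \<kappa> q e\<^sub>t f = 0"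
    and p: "p \<in> chart_dom \<kappa>" and x: "coord_tangent A \<kappa> p e\<^sub>x f = \<alpha>"
  shows "\<alpha> \<noteq> 0 \<Longrightarrow> \<exists>a b c \<gamma>. exponential_form A g f \<kappa> \<alpha> a b c \<gamma>"
    and "\<alpha> = 0 \<Longrightarrow> \<exists>a b c \<gamma>. quadratic_form A g f \<kappa> a b c \<gamma>"
proof -
  note eq = soliton_eqI[OF f sol]
  have Ft0: "fd (F f) z e\<^sub>t = 0" if "z \<in> \<Omega>" for z
    using that fd_F_eq[OF f] t by auto
  have Fx: "fd (F f) z e\<^sub>x = \<alpha>" if "z \<in> \<Omega>" for z
    using that fd_F_eq[OF f] soliton_gradient_norm(2)[OF f sol ball t p] x by auto
  show "\<alpha> \<noteq> 0 \<Longrightarrow> \<exists>a b c \<gamma>. exponential_form A g f \<kappa> \<alpha> a b c \<gamma>"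
    by (rule exponential_form_exists[OF f eq refl ball Ft0 Fx])
  show "\<alpha> = 0 \<Longrightarrow> \<exists>a b c \<gamma>. quadratic_form A g f \<kappa> a b c \<gamma>"
    by (rule quadratic_form_exists[OF f eq refl ball Ft0 Fx])
qed

end

section \<open>From charts to the connected manifold\<close>

context parallel_null
begin

lemma walker_chart_at:
  obtains \<kappa> \<phi> r where "walker_chart A g \<kappa> \<phi>" "\<kappa> \<in> CS" "p \<in> chart_dom \<kappa>" "r > 0"
    "chart_map \<kappa> ` chart_dom \<kappa> = ball (chart_map \<kappa> p) r"
    "\<And>q. q \<in> chart_dom \<kappa> \<Longrightarrow> V q = coord_tangent A \<kappa> q e\<^sub>t"
proof -
  obtain \<kappa> \<phi> r where w: "\<kappa> \<in> CS" "p \<in> chart_dom \<kappa>" "walker_form A g \<kappa> \<phi>" "r > 0"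
    "chart_map \<kappa> ` chart_dom \<kappa> = ball (chart_map \<kappa> p) r"
    "\<And>q. q \<in> chart_dom \<kappa> \<Longrightarrow> V q = coord_tangent A \<kappa> q e\<^sub>t"
    by (rule walker_chart_exists[of p]) (rule that)
  have "walker_chart A g \<kappa> \<phi>" by unfold_locales (rule w)+
  then show thesis using w by (intro that)
qed

text \<open>Both conclusions are read off at one point of nonzero curvature, where \<Phi>xx cannot
  vanish. The second one is the starting value for the propagation of V f = 0.\<close>

lemma soliton_steady:
  assumes f: "smooth_fun_on A UNIV f" and nonflat: "\<not> flat A g" and sol: "ricci_soliton_const A g f l"
  shows "l = 0" "\<exists>p. V p f = 0"
proof -
  obtain p X Y Q where c: "smooth_vfield_at A p X" "smooth_vfield_at A p Y" "smooth_vfield_at A p Q"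
    "curvature A g X Y Q p \<noteq> (\<lambda>h. 0)"
    using nonflat unfolding flat_def by blast
  obtain \<kappa> \<phi> r where w: "walker_chart A g \<kappa> \<phi>" and p: "p \<in> chart_dom \<kappa>"
    and V: "\<And>q. q \<in> chart_dom \<kappa> \<Longrightarrow> V q = coord_tangent A \<kappa> q e\<^sub>t"
    by (rule walker_chart_at[of p]) (rule that)
  interpret w: walker_chart A g \<kappa> \<phi> by (rule w)
  have nz: "w.\<Phi>xx (chart_map \<kappa> p) \<noteq> 0" using w.curvature_zero[OF p _ c(1-3)] c(4) by blast
  have z: "chart_map \<kappa> p \<in> chart_map \<kappa> ` chart_dom \<kappa>" using p by simp
  note eq = w.soliton_eqI[OF f sol]
  show "l = 0" using w.l_\<Phi>xx[OF f eq z] nz by simp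
  have "V p f = fd (w.F f) (chart_map \<kappa> p) e\<^sub>t" unfolding V[OF p] w.fd_F_eq[OF f p] ..
  then show "\<exists>p. V p f = 0" using w.\<Phi>xx_Ft[OF f eq z] nz by auto
qed

text \<open>Local constancy in different charts can be combined because V f does not depend on a
  chart: each Walker chart constructed from \<open>V\<close> has \<partial>t = V.\<close>

lemma soliton_V_zero:
  assumes conn: "connected (UNIV :: 'a set)" and f: "smooth_fun_on A UNIV f" and nonflat: "\<not> flat A g"
    and sol: "ricci_soliton_const A g f 0"
  shows "V q f = 0"
proof -
  obtain p0 where p0: "V p0 f = 0" using soliton_steady(2)[OF f nonflat sol] by blast
  have "\<exists>U. open U \<and> p \<in> U \<and> (\<forall>q\<in>U. V q f = V p f)" for p
  proof -
    obtain \<kappa> \<phi> r where w: "walker_chart A g \<kappa> \<phi>" and p: "p \<in> chart_dom \<kappa>"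
      and ball: "chart_map \<kappa> ` chart_dom \<kappa> = ball (chart_map \<kappa> p) r"
      and V: "\<And>q. q \<in> chart_dom \<kappa> \<Longrightarrow> V q = coord_tangent A \<kappa> q e\<^sub>t"
      by (rule walker_chart_at[of p]) (rule that)
    interpret w: walker_chart A g \<kappa> \<phi> by (rule w)
    have "V q f = fd (w.F f) (chart_map \<kappa> p) e\<^sub>t" if q: "q \<in> chart_dom \<kappa>" for q
      using w.Ft_constant[OF f w.soliton_eqI[OF f sol] refl ball imageI[OF q]]
      unfolding V[OF q] w.fd_F_eq[OF f q] .
    then show ?thesis using w.open_dom p by (intro exI[of _ "chart_dom \<kappa>"]) simp
  qed
  from locally_constant_imp_eq[of "\<lambda>p. V p f", OF conn this] p0 show ?thesis by metis
qed

lemma soliton_forms: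
  assumes conn: "connected (UNIV :: 'a set)" and f: "smooth_fun_on A UNIV f" and nonflat: "\<not> flat A g"
    and sol: "ricci_soliton_const A g f 0"
  shows "\<exists>C. coordinate_cover A C \<and>
         ((\<exists>\<alpha>. \<forall>\<kappa>\<in>C. \<exists>a b c \<gamma>. exponential_form A g f \<kappa> \<alpha> a b c \<gamma>) \<or>
          (\<forall>\<kappa>\<in>C. \<exists>a b c \<gamma>. quadratic_form A g f \<kappa> a b c \<gamma>))"
proof -
  note V0 = soliton_V_zero[OF conn f nonflat sol]
  define N where "N = (\<lambda>p. g p (gradient A g f p) (gradient A g f p))"
  have charts: "\<exists>\<kappa> \<phi> r. walker_chart A g \<kappa> \<phi> \<and> \<kappa> \<in> CS \<and> p \<in> chart_dom \<kappa> \<and>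
      chart_map \<kappa> ` chart_dom \<kappa> = ball (chart_map \<kappa> p) r \<and>
      (\<forall>q\<in>chart_dom \<kappa>. coord_tangent A \<kappa> q e\<^sub>t f = 0)" for p
    by (rule walker_chart_at[of p]) (metis V0)
  have "\<exists>U. open U \<and> p \<in> U \<and> (\<forall>q\<in>U. N q = N p)" for p
  proof -
    obtain \<kappa> \<phi> r where w: "walker_chart A g \<kappa> \<phi>" and p: "p \<in> chart_dom \<kappa>"
      and ball: "chart_map \<kappa> ` chart_dom \<kappa> = ball (chart_map \<kappa> p) r"
      and t: "\<And>q. q \<in> chart_dom \<kappa> \<Longrightarrow> coord_tangent A \<kappa> q e\<^sub>t f = 0"
      using charts[of p] by blast
    interpret w: walker_chart A g \<kappa> \<phi> by (rule w)
    have "N q = N p" if q: "q \<in> chart_dom \<kappa>" for q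
      using w.soliton_gradient_norm(1)[OF f sol ball t p] w.soliton_gradient_norm(1)[OF f sol ball t q]
        w.soliton_gradient_norm(2)[OF f sol ball t p q] by (simp add: N_def)
    then show ?thesis by (intro exI[of _ "chart_dom \<kappa>"] conjI ballI w.open_dom p)
  qed
  note N_const = locally_constant_imp_eq[of N, OF conn this]
  \<comment> \<open>\<open>N\<close> is constant on the manifold, so \<open>undefined\<close> serves
    as an arbitrary point.\<close>
  define \<alpha> where "\<alpha> = sqrt (N undefined)"
  \<comment> \<open>Which normal form applies depends only on the global \<alpha>, never on the
    chart; the two implications express this and give a cover of a single type.\<close>
  define good where "good = (\<lambda>\<kappa> :: ('a, 3) chart. (\<alpha> \<noteq> 0 \<longrightarrow> (\<exists>a b c \<gamma>. exponential_form A g f \<kappa> \<alpha> a b c \<gamma>)) \<and>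
      (\<alpha> = 0 \<longrightarrow> (\<exists>a b c \<gamma>. quadratic_form A g f \<kappa> a b c \<gamma>)))"
  have "\<exists>\<kappa>\<in>CS. p \<in> chart_dom \<kappa> \<and> good \<kappa>" for p
  proof -
    obtain \<kappa> \<phi> r where w: "walker_chart A g \<kappa> \<phi>" and cs: "\<kappa> \<in> CS" and p: "p \<in> chart_dom \<kappa>"
      and ball: "chart_map \<kappa> ` chart_dom \<kappa> = ball (chart_map \<kappa> p) r"
      and t: "\<And>q. q \<in> chart_dom \<kappa> \<Longrightarrow> coord_tangent A \<kappa> q e\<^sub>t f = 0"
      using charts[of p] by blast
    interpret w: walker_chart A g \<kappa> \<phi> by (rule w)
    let ?\<beta> = "coord_tangent A \<kappa> p e\<^sub>x f"
    have "\<alpha> = sqrt (N p)" unfolding \<alpha>_def by (simp only: N_const[of p undefined])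
    also have "N p = ?\<beta>\<^sup>2" unfolding N_def by (rule w.soliton_gradient_norm(1)[OF f sol ball t p])
    finally have "\<alpha> = \<bar>?\<beta>\<bar>" by simp
    \<comment> \<open>f_x is \<alpha> or -\<alpha> in the chart at hand; in the second case the
      reflected chart is taken instead.\<close>
    then consider "?\<beta> = \<alpha>" | "- ?\<beta> = \<alpha>" by linarith
    then show ?thesis
    proof cases
      case 1
      have "good \<kappa>" unfolding good_def
        using w.soliton_form_exists[OF f sol ball t p 1] by blast
      then show ?thesis using cs p by blast
    next
      case 2
      obtain \<mu> s where \<mu>: "\<mu> \<in> CS" "p \<in> chart_dom \<mu>" "chart_dom \<mu> \<subseteq> chart_dom \<kappa>"
        "walker_form A g \<mu> (\<lambda>x y. \<phi> (- x) y)" "chart_map \<mu> ` chart_dom \<mu> = ball (chart_map \<mu> p) s"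
        and flip: "\<And>q. q \<in> chart_dom \<mu> \<Longrightarrow> coord_tangent A \<mu> q e\<^sub>t = coord_tangent A \<kappa> q e\<^sub>t"
        "\<And>q. q \<in> chart_dom \<mu> \<Longrightarrow> coord_tangent A \<mu> q e\<^sub>x f = - coord_tangent A \<kappa> q e\<^sub>x f"
        by (rule w.flipped_chart[OF f p]) (rule that)
      interpret m: walker_chart A g \<mu> "\<lambda>x y. \<phi> (- x) y" by unfold_locales (rule \<mu>)+
      have t': "coord_tangent A \<mu> q e\<^sub>t f = 0" if "q \<in> chart_dom \<mu>" for q
        unfolding flip(1)[OF that] by (rule t) (use that \<mu>(3) in blast)
      have x': "coord_tangent A \<mu> p e\<^sub>x f = \<alpha>" using flip(2)[OF \<mu>(2)] 2 by simp
      have "good \<mu>" unfolding good_def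
        using m.soliton_form_exists[OF f sol \<mu>(5) t' \<mu>(2) x'] by blast
      then show ?thesis using \<mu>(1,2) by blast
    qed
  qed
  then have cover: "coordinate_cover A {\<kappa> \<in> CS. good \<kappa>}"
    unfolding coordinate_cover_def by blast
  show ?thesis
  proof (intro exI[of _ "{\<kappa> \<in> CS. good \<kappa>}"] conjI cover, cases "\<alpha> = 0")
    case True
    then show "(\<exists>\<alpha>. \<forall>\<kappa>\<in>{\<kappa> \<in> CS. good \<kappa>}. \<exists>a b c \<gamma>. exponential_form A g f \<kappa> \<alpha> a b c \<gamma>) \<or>
        (\<forall>\<kappa>\<in>{\<kappa> \<in> CS. good \<kappa>}. \<exists>a b c \<gamma>. quadratic_form A g f \<kappa> a b c \<gamma>)"
      by (intro disjI2) (simp add: good_def)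
  next
    case False
    then show "(\<exists>\<alpha>. \<forall>\<kappa>\<in>{\<kappa> \<in> CS. good \<kappa>}. \<exists>a b c \<gamma>. exponential_form A g f \<kappa> \<alpha> a b c \<gamma>) \<or>
        (\<forall>\<kappa>\<in>{\<kappa> \<in> CS. good \<kappa>}. \<exists>a b c \<gamma>. quadratic_form A g f \<kappa> a b c \<gamma>)"
      by (intro disjI1 exI[of _ \<alpha>]) (simp add: good_def)
  qed
qed

end

theorem theorem12:
  fixes A :: "('a::{second_countable_topology,t2_space}, 3) chart set"
    and g :: "'a metric_field"
    and f :: "'a \<Rightarrow> real"
  assumes "lorentzian_manifold A g"
    and "connected (UNIV :: 'a set)"
    and "strict_walker A g"
    and "\<not> flat A g"
    and "smooth_fun_on A UNIV f"
  shows
    "(gradient_ricci_soliton A g f \<longleftrightarrow>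
       (\<exists>C. coordinate_cover A C \<and>
         (\<forall>\<kappa>\<in>C. (\<exists>\<alpha> a b c \<gamma>. exponential_form A g f \<kappa> \<alpha> a b c \<gamma>) \<or>
                 (\<exists>a b c \<gamma>. quadratic_form A g f \<kappa> a b c \<gamma>))))
     \<and>
     (gradient_ricci_soliton A g f \<longleftrightarrow>
       (\<exists>C. coordinate_cover A C \<and>
         ((\<exists>\<alpha>. \<forall>\<kappa>\<in>C. \<exists>a b c \<gamma>. exponential_form A g f \<kappa> \<alpha> a b c \<gamma>) \<or>
          (\<forall>\<kappa>\<in>C. \<exists>a b c \<gamma>. quadratic_form A g f \<kappa> a b c \<gamma>))))
     \<and>
     (\<forall>\<kappa>\<in>coordinate_systems A. \<forall>\<alpha> a b c \<gamma>. exponential_form A g f \<kappa> \<alpha> a b c \<gamma> \<longrightarrow>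
       (\<forall>p\<in>chart_dom \<kappa>.
         gradient A g f p =
           (\<lambda>h. \<alpha> * coord_field A \<kappa> 2 p h + deriv \<gamma> (cy \<kappa> p) * coord_field A \<kappa> 1 p h) \<and>
         g p (gradient A g f p) (gradient A g f p) > 0))
     \<and>
     (\<forall>\<kappa>\<in>coordinate_systems A. \<forall>a b c \<gamma>. quadratic_form A g f \<kappa> a b c \<gamma> \<longrightarrow>
       (\<forall>p\<in>chart_dom \<kappa>.
         gradient A g f p = (\<lambda>h. deriv \<gamma> (cy \<kappa> p) * coord_field A \<kappa> 1 p h) \<and>
         g p (gradient A g f p) (gradient A g f p) = 0))
     \<and>
     (\<forall>l. ricci_soliton_const A g f l \<longrightarrow> l = 0)"
    (is "(?S \<longleftrightarrow> ?R1) \<and> (?S \<longleftrightarrow> ?R2) \<and> ?E \<and> ?Q \<and> ?L")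
proof -
  have "smooth_atlas A" "lorentzian_metric A g" using assms(1) by (simp_all add: lorentzian_manifold_def)
  then interpret lorentz3 A g by unfold_locales
  obtain V where "smooth_vfield_on A UNIV V" "\<forall>p. V p \<noteq> (\<lambda>h. 0) \<and> g p (V p) (V p) = 0"
    "\<forall>p X. smooth_vfield_at A p X \<longrightarrow> levi_civita A g X V p = (\<lambda>h. 0)"
    using assms(3) unfolding strict_walker_def by blast
  then interpret parallel_null A g V by unfold_locales simp_all
  note f = assms(5)
  have L: ?L using soliton_steady(1)[OF f assms(4)] by blast
  have SR2: "?S \<Longrightarrow> ?R2"
    unfolding gradient_ricci_soliton_def using L soliton_forms[OF assms(2) f assms(4)] by blast
  have R21: "?R2 \<Longrightarrow> ?R1" by blast
  \<comment> \<open>The converse is a pointwise statement, so it accepts the weaker cover condition,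
    in which the type and \<alpha> may vary from chart to chart. Both covers thus characterise
    solitons.\<close>
  have R1S: "?S" if R1: ?R1
  proof -
    obtain C where C: "coordinate_cover A C"
      "\<forall>\<kappa>\<in>C. (\<exists>\<alpha> a b c \<gamma>. exponential_form A g f \<kappa> \<alpha> a b c \<gamma>) \<or> (\<exists>a b c \<gamma>. quadratic_form A g f \<kappa> a b c \<gamma>)"
      using R1 by blast
    have "hessian A g f X Y p + ricci A g X Y p = 0 * g p (X p) (Y p)"
      if XY: "smooth_vfield_at A p X" "smooth_vfield_at A p Y" for p X Y
    proof -
      obtain \<kappa> where \<kappa>: "\<kappa> \<in> C" "\<kappa> \<in> CS" "p \<in> chart_dom \<kappa>" using C(1) unfolding coordinate_cover_def by blast
      from C(2) \<kappa>(1) consider \<alpha> a b c \<gamma> where "exponential_form A g f \<kappa> \<alpha> a b c \<gamma>"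
        | a b c \<gamma> where "quadratic_form A g f \<kappa> a b c \<gamma>" by blast
      then show ?thesis
        by cases (rule exponential_form_soliton(3)[OF f \<kappa>(2) _ \<kappa>(3) XY] quadratic_form_soliton(3)[OF f \<kappa>(2) _ \<kappa>(3) XY]; assumption)+
    qed
    then show ?S unfolding gradient_ricci_soliton_def ricci_soliton_const_def by blast
  qed
  have ?E by (intro ballI allI impI conjI exponential_form_soliton(1,2)[OF f])
  moreover have ?Q by (intro ballI allI impI conjI quadratic_form_soliton(1,2)[OF f])
  ultimately show ?thesis using L SR2 R21 R1S by blast
qed

end
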